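(* Let $0<\alpha<S$ and let $\{\phi_k\}\cup\{\psi_{\ell k}:\ell\ge J_0,\ 0\le k\le 2^\ell-1\}$ be a Cohen–Daubechies–Vial wavelet basis of $L^2([0,1])$ of smoothness at least $S$. Let $\Pi$ be the Gaussian prior on $L^2([0,1])$ given by $$\Pi=\mathcal L\Big(\sum_{k} g_k\phi_k+\sum_{\ell=J_0}^\infty\sum_{k=0}^{2^\ell-1}\sqrt{\mu_\ell}\,g_{\ell k}\psi_{\ell k}\Big),\qquad \mu_\ell=\ell^{-1}2^{-\ell(2\alpha+1)}\quad\text{for all } \ell\ge J_0,$$ where the $g_k,g_{\ell k}$ are i.i.d. $N(0,1)$ and the first sum runs over the finitely many scaling functions $\phi_k$ of the basis. Let $f_0\in\mathcal C^\alpha([0,1])$, let $\varepsilon_n=(n/\log n)^{-\alpha/(2\alpha+1)}$ (with $\varepsilon_1=0$), and suppose one observes $dY_0^{(n)}(t)=f_0(t)\,dt+dB(t)/\sqrt n$, $t\in[0,1]$, with $B$ Brownian motion on $[0,1]$. Then there exist constants $0<C<\infty$ and $M_0<\infty$, depending only on the wavelet basis, $\alpha$ and $\|f_0\|_{\alpha,\infty,\infty}$, such that for every $M_0\le M<\infty$, all $1\le r\le\infty$ and all $n\in\mathbb N$, $$E_{Y_0^{(n)}}\Pi\big(f:\|f-f_0\|_r>M\varepsilon_n\,\big|\,Y_0^{(n)}\big)\le n^{-C^2(M-M_0)^2}.$$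
   Context: Model: given $f\in L^2([0,1])$ one observes $dY^{(n)}(t)=f(t)\,dt+n^{-1/2}dB(t)$, $t\in[0,1]$ (Gaussian white noise model). $\Pi(\cdot\,|\,Y^{(n)})$ is the posterior distribution, i.e. the conditional law of $f$ given $Y^{(n)}$ when $f\sim\Pi$ is independent of $B$; $\Pi(\cdot|Y_0^{(n)})$ is this posterior evaluated at data $Y_0^{(n)}$ generated from the fixed function $f_0$, and $E_{Y_0^{(n)}}$ is expectation with respect to the law of $Y_0^{(n)}$. (Equivalently, one observes all wavelet coefficients $\int\phi_k\,dY^{(n)}$, $\int\psi_{\ell k}\,dY^{(n)}$, which are independent $N(\langle f,\phi_k\rangle,1/n)$, $N(\langle f,\psi_{\ell k}\rangle,1/n)$.) $\|\cdot\|_r$ is the $L^r([0,1])$-norm, with $\|f\|_\infty=\sup_x|f(x)|$. The series defining $\Pi$ converges uniformly almost surely. Cohen–Daubechies–Vial (CDV) basis of smoothness $S$: the orthonormal wavelet basis of $L^2([0,1])$ (Cohen, Daubechies, Vial 1993, Theorem 4.4) built from a compactly supported Daubechies scaling function $\phi$ and wavelet $\psi$ of sufficiently large order that they are $S$-times continuously differentiable, starting at a fixed resolution level $J_0$ (with $2^{J_0}$ at least twice the order of the Daubechies wavelet). It consists of finitely many scaling functions $\phi_k$ and of wavelets $\psi_{\ell k}$, $\ell\ge J_0$, $0\le k<2^\ell$; the functions supported in the interior of $[0,1]$ are the usual dilated translates $\psi_{\ell k}=2^{\ell/2}\psi(2^\ell\cdot-k)$, complemented by suitable boundary-corrected functions.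 $\mathcal C^\alpha([0,1])$ is the Hölder (Hölder–Zygmund if $\alpha$ is an integer) space, equal to the Besov space $B^\alpha_{\infty\infty}([0,1])$ with norm $\|f\|_{\alpha,\infty,\infty}=\sup_k|\langle f,\phi_k\rangle|+\sup_{\ell\ge J_0}2^{\ell(\alpha+1/2)}\sup_k|\langle f,\psi_{\ell k}\rangle|$. *)

theory Defs
  imports "HOL-Probability.Probability"
begin

section \<open>Cohen--Daubechies--Vial wavelets on the unit interval\<close>

definition l2_inner :: "(real \<Rightarrow> real) \<Rightarrow> (real \<Rightarrow> real) \<Rightarrow> real" where
  "l2_inner f g = (LINT x:{0..1}|lborel. f x * g x)"

text \<open>The filter has minimal length \<open>2N\<close> for its \<open>N\<close> vanishing moments; the usual Daubechies
  functions, supported in \<open>[0, 2N-1]\<close>, are translated so that both \<open>\<phi>\<close> and \<open>\<psi>\<close> live on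
  \<open>[-N+1, N]\<close>, an interval that is invariant under the reflection \<open>x \<mapsto> 1 - x\<close>. All choices of
  the spectral factor (extremal phase, least asymmetric, ...) are covered.\<close>

definition daubechies_pair :: "nat \<Rightarrow> (real \<Rightarrow> real) \<Rightarrow> (real \<Rightarrow> real) \<Rightarrow> bool" where
  "daubechies_pair N \<phi> \<psi> \<longleftrightarrow> N \<ge> 1 \<and>
     (\<exists>h :: int \<Rightarrow> real.
        (\<forall>n. n \<notin> {1 - int N..int N} \<longrightarrow> h n = 0) \<and>
        (\<forall>x. \<phi> x = sqrt 2 * (\<Sum>n = 1 - int N..int N. h n * \<phi> (2 * x - of_int n))) \<and>
        (\<forall>x. \<psi> x = sqrt 2 * (\<Sum>n = 1 - int N..int N.
                      (- 1) powi n * h (1 - n) * \<phi> (2 * x - of_int n)))) \<and>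
     (\<forall>x. x \<notin> {1 - real N..real N} \<longrightarrow> \<phi> x = 0) \<and>
     (\<forall>k :: int. (LINT x|lborel. \<phi> x * \<phi> (x - of_int k)) = of_bool (k = 0)) \<and>
     (LINT x|lborel. \<phi> x) = 1 \<and>
     (\<forall>p<N. (LINT x|lborel. x ^ p * \<psi> x) = 0)"

definition times_continuously_differentiable :: "nat \<Rightarrow> (real \<Rightarrow> real) \<Rightarrow> bool" where
  "times_continuously_differentiable S f \<longleftrightarrow>
     (\<forall>i<S. (deriv ^^ i) f differentiable_on UNIV) \<and> continuous_on UNIV ((deriv ^^ S) f)"

text \<open>\<open>e\<close> is an orthonormal basis of the linear span of \<open>g 0, \<dots>, g (N - 1)\<close>. The span condition is
  only imposed in one direction, because \<open>N\<close> orthonormal functions cannot lie in a proper subspace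
  of that span.\<close>

definition orthonormalization :: "nat \<Rightarrow> (nat \<Rightarrow> real \<Rightarrow> real) \<Rightarrow> (nat \<Rightarrow> real \<Rightarrow> real) \<Rightarrow> bool" where
  "orthonormalization N g e \<longleftrightarrow>
     (\<forall>i<N. \<exists>c :: nat \<Rightarrow> real. \<forall>x. e i x = (\<Sum>j<N. c j * g j x)) \<and>
     (\<forall>i<N. \<forall>j<N. (LINT x|lborel. e i x * e j x) = of_bool (i = j))"

text \<open>Boundary functions on the half line \<open>[0, \<infinity>)\<close>, before orthonormalization. The scaling
  functions \<open>edge_scaling N \<phi> k\<close> complete the translates \<open>\<phi>(\<cdot> - m)\<close>, \<open>m \<ge> N\<close>, so as to reproduce
  polynomials of degree less than \<open>N\<close>. The wavelet \<open>edge_wavelet N e k\<close> is the dilated boundary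
  scaling function \<open>\<surd>2 e\<^sub>k(2 \<cdot>)\<close> minus its projection onto the coarser scale; since it is already
  orthogonal to the interior translates, only the boundary part \<open>e\<^sub>m\<close> of the projection appears.\<close>

definition edge_scaling :: "nat \<Rightarrow> (real \<Rightarrow> real) \<Rightarrow> nat \<Rightarrow> real \<Rightarrow> real" where
  "edge_scaling N \<phi> k x =
     (if x \<ge> 0 then \<Sum>n = k..2 * N - 2. real (n choose k) * \<phi> (x + real n - real N + 1) else 0)"

definition edge_wavelet :: "nat \<Rightarrow> (nat \<Rightarrow> real \<Rightarrow> real) \<Rightarrow> nat \<Rightarrow> real \<Rightarrow> real" where
  "edge_wavelet N e k x = sqrt 2 * e k (2 * x)
     - (\<Sum>m<N. (LINT y|lborel. sqrt 2 * e k (2 * y) * e m y) * e m x)"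

text \<open>The \<open>2\<^sup>j\<close> functions of level \<open>j\<close>: \<open>N\<close> left boundary functions, \<open>2\<^sup>j - 2N\<close> dilated translates,
  and \<open>N\<close> right boundary functions (obtained from half-line functions by reflection).\<close>

definition level_function ::
  "nat \<Rightarrow> (nat \<Rightarrow> real \<Rightarrow> real) \<Rightarrow> (real \<Rightarrow> real) \<Rightarrow> (nat \<Rightarrow> real \<Rightarrow> real) \<Rightarrow> nat \<Rightarrow> nat \<Rightarrow> real \<Rightarrow> real"
  where
  "level_function N L f R j k x = sqrt (2 ^ j) *
     (if k < N then L k (2 ^ j * x)
      else if k < 2 ^ j - N then f (2 ^ j * x - real k)
      else R (2 ^ j - 1 - k) (2 ^ j * (1 - x)))"

definition wavelet_sum ::
  "nat \<Rightarrow> (nat \<Rightarrow> real \<Rightarrow> real) \<Rightarrow> (nat \<Rightarrow> nat \<Rightarrow> real \<Rightarrow> real) \<Rightarrow>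
    (nat \<Rightarrow> real) \<Rightarrow> (nat \<Rightarrow> nat \<Rightarrow> real) \<Rightarrow> nat \<Rightarrow> real \<Rightarrow> real" where
  "wavelet_sum J0 \<phi> \<psi> a b L x =
     (\<Sum>k<2 ^ J0. a k * \<phi> k x) + (\<Sum>l = J0..L. \<Sum>k<2 ^ l. b l k * \<psi> l k x)"

definition wavelet_orthonormal_basis ::
  "nat \<Rightarrow> (nat \<Rightarrow> real \<Rightarrow> real) \<Rightarrow> (nat \<Rightarrow> nat \<Rightarrow> real \<Rightarrow> real) \<Rightarrow> bool" where
  "wavelet_orthonormal_basis J0 \<phi> \<psi> \<longleftrightarrow>
     (\<forall>k<2 ^ J0. \<forall>k'<2 ^ J0. l2_inner (\<phi> k) (\<phi> k') = of_bool (k = k')) \<and>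
     (\<forall>k<2 ^ J0. \<forall>l\<ge>J0. \<forall>k'<2 ^ l. l2_inner (\<phi> k) (\<psi> l k') = 0) \<and>
     (\<forall>l\<ge>J0. \<forall>k<2 ^ l. \<forall>l'\<ge>J0. \<forall>k'<2 ^ l'.
        l2_inner (\<psi> l k) (\<psi> l' k') = of_bool (l = l' \<and> k = k')) \<and>
     (\<forall>f. f \<in> borel_measurable borel \<and> set_integrable lborel {0..1} (\<lambda>x. (f x)\<^sup>2) \<longrightarrow>
        (\<lambda>L. LINT x:{0..1}|lborel.
            (f x - wavelet_sum J0 \<phi> \<psi> (\<lambda>k. l2_inner f (\<phi> k)) (\<lambda>l k. l2_inner f (\<psi> l k)) L x)\<^sup>2)
        \<longlonglongrightarrow> 0)"

text \<open>\<open>\<phi> k\<close>, \<open>k < 2 ^ J0\<close>, are the scaling functions and \<open>\<psi> l k\<close>, \<open>l \<ge> J0\<close>, \<open>k < 2 ^ l\<close>, the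
  wavelets; only their values on \<open>[0, 1]\<close> matter. At the right end point the half-line construction
  is applied to the reflected scaling function \<open>f (1 - \<cdot>)\<close>. Any orthonormalization of the boundary
  functions is admitted.\<close>

definition cdv_basis ::
  "nat \<Rightarrow> nat \<Rightarrow> (nat \<Rightarrow> real \<Rightarrow> real) \<Rightarrow> (nat \<Rightarrow> nat \<Rightarrow> real \<Rightarrow> real) \<Rightarrow> bool" where
  "cdv_basis S J0 \<phi> \<psi> \<longleftrightarrow> wavelet_orthonormal_basis J0 \<phi> \<psi> \<and>
     (\<exists>N f w fL fR wL wR.
        daubechies_pair N f w \<and>
        times_continuously_differentiable S f \<and> times_continuously_differentiable S w \<and>
        2 * N \<le> 2 ^ J0 \<and>
        orthonormalization N (edge_scaling N f) fL \<and>
        orthonormalization N (edge_scaling N (\<lambda>x. f (1 - x))) fR \<and>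
        orthonormalization N (edge_wavelet N fL) wL \<and>
        orthonormalization N (edge_wavelet N fR) wR \<and>
        (\<forall>k<2 ^ J0. \<forall>x\<in>{0..1}. \<phi> k x = level_function N fL f fR J0 k x) \<and>
        (\<forall>l\<ge>J0. \<forall>k<2 ^ l. \<forall>x\<in>{0..1}. \<psi> l k x = level_function N wL w wR l k x))"


section \<open>Function spaces and norms\<close>

definition besov_norm ::
  "nat \<Rightarrow> (nat \<Rightarrow> real \<Rightarrow> real) \<Rightarrow> (nat \<Rightarrow> nat \<Rightarrow> real \<Rightarrow> real) \<Rightarrow> real \<Rightarrow> (real \<Rightarrow> real) \<Rightarrow> ennreal"
  where
  "besov_norm J0 \<phi> \<psi> \<alpha> f =
     (SUP k\<in>{..<2 ^ J0}. ennreal \<bar>l2_inner f (\<phi> k)\<bar>) +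
     (SUP l\<in>{J0..}. ennreal (2 powr (real l * (\<alpha> + 1 / 2))) *
        (SUP k\<in>{..<2 ^ l}. ennreal \<bar>l2_inner f (\<psi> l k)\<bar>))"

text \<open>Elements of the space are represented by their continuous versions.\<close>

definition holder_space ::
  "nat \<Rightarrow> (nat \<Rightarrow> real \<Rightarrow> real) \<Rightarrow> (nat \<Rightarrow> nat \<Rightarrow> real \<Rightarrow> real) \<Rightarrow> real \<Rightarrow> (real \<Rightarrow> real) set" where
  "holder_space J0 \<phi> \<psi> \<alpha> = {f. continuous_on {0..1} f \<and> besov_norm J0 \<phi> \<psi> \<alpha> f < \<infinity>}"

text \<open>Applied to continuous functions and \<open>1 \<le> r \<le> \<infinity>\<close> only.\<close>

definition Lr_norm :: "ereal \<Rightarrow> (real \<Rightarrow> real) \<Rightarrow> real" where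
  "Lr_norm r f = (if r = \<infinity> then SUP x\<in>{0..1}. \<bar>f x\<bar>
     else (LINT x:{0..1}|lborel. \<bar>f x\<bar> powr real_of_ereal r) powr (1 / real_of_ereal r))"

text \<open>\<open>C[0,1]\<close> with the \<open>\<sigma>\<close>-algebra generated by the point evaluations, which is both the Borel
  \<open>\<sigma>\<close>-algebra of the supremum norm and the trace of the Borel \<open>\<sigma>\<close>-algebra of \<open>L\<^sup>2[0,1]\<close>. The
  elements are \<open>undefined\<close> outside \<open>[0, 1]\<close>.\<close>

definition C01 :: "(real \<Rightarrow> real) measure" where
  "C01 = restrict_space (PiM {0..1} (\<lambda>_. borel)) {f. continuous_on {0..1} f}"


section \<open>Gaussian white noise, prior and posterior\<close>

text \<open>The law of Brownian motion on \<open>[0, 1]\<close>, that is: the coordinate process is a Brownian motion.\<close>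

definition wiener_measure :: "(real \<Rightarrow> real) measure \<Rightarrow> bool" where
  "wiener_measure W \<longleftrightarrow> prob_space W \<and> sets W = sets C01 \<and>
     (AE b in W. b 0 = 0) \<and>
     (\<forall>s t. 0 \<le> s \<and> s < t \<and> t \<le> 1 \<longrightarrow>
        distributed W lborel (\<lambda>b. b t - b s) (normal_density 0 (sqrt (t - s)))) \<and>
     (\<forall>(m :: nat) (t :: nat \<Rightarrow> real). 0 \<le> t 0 \<and> (\<forall>i<m. t i < t (Suc i)) \<and> t m \<le> 1 \<longrightarrow>
        prob_space.indep_vars W (\<lambda>_. borel) (\<lambda>i b. b (t (Suc i)) - b (t i)) {..<m})"

text \<open>The trajectory of \<open>dY(t) = f(t) dt + n\<^bsup>-1/2\<^esup> dB(t)\<close>, \<open>Y(0) = 0\<close>.\<close>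

definition observation :: "nat \<Rightarrow> (real \<Rightarrow> real) \<Rightarrow> (real \<Rightarrow> real) \<Rightarrow> real \<Rightarrow> real" where
  "observation n f b = (\<lambda>t\<in>{0..1}. (LINT s:{0..t}|lborel. f s) + b t / sqrt (real n))"

definition observation_law ::
  "(real \<Rightarrow> real) measure \<Rightarrow> nat \<Rightarrow> (real \<Rightarrow> real) \<Rightarrow> (real \<Rightarrow> real) measure" where
  "observation_law W n f = distr W C01 (observation n f)"

text \<open>The coordinates of \<open>gaussian_coefficients\<close> are the i.i.d. standard normal variables
  \<open>g\<^sub>k\<close> (left summand) and \<open>g\<^sub>l\<^sub>k\<close> (right summand).\<close>

definition gaussian_coefficients :: "(nat + nat \<times> nat \<Rightarrow> real) measure" where
  "gaussian_coefficients = PiM UNIV (\<lambda>_. density lborel std_normal_density)"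

definition prior_partial_sum ::
  "nat \<Rightarrow> (nat \<Rightarrow> real \<Rightarrow> real) \<Rightarrow> (nat \<Rightarrow> nat \<Rightarrow> real \<Rightarrow> real) \<Rightarrow> real \<Rightarrow>
    (nat + nat \<times> nat \<Rightarrow> real) \<Rightarrow> nat \<Rightarrow> real \<Rightarrow> real" where
  "prior_partial_sum J0 \<phi> \<psi> \<alpha> g =
     wavelet_sum J0 \<phi> \<psi> (\<lambda>k. g (Inl k))
       (\<lambda>l k. sqrt (inverse (real l) * 2 powr (- (real l * (2 * \<alpha> + 1)))) * g (Inr (l, k)))"

text \<open>The series converges uniformly on \<open>[0, 1]\<close> for almost all \<open>g\<close>; on the remaining null set it is
  replaced by \<open>0\<close>.\<close>

definition prior ::
  "nat \<Rightarrow> (nat \<Rightarrow> real \<Rightarrow> real) \<Rightarrow> (nat \<Rightarrow> nat \<Rightarrow> real \<Rightarrow> real) \<Rightarrow> real \<Rightarrow> (real \<Rightarrow> real) measure" where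
  "prior J0 \<phi> \<psi> \<alpha> = distr gaussian_coefficients C01
     (\<lambda>g. if uniformly_convergent_on {0..1} (prior_partial_sum J0 \<phi> \<psi> \<alpha> g)
          then (\<lambda>x\<in>{0..1}. lim (\<lambda>L. prior_partial_sum J0 \<phi> \<psi> \<alpha> g L x))
          else (\<lambda>x\<in>{0..1}. 0))"

text \<open>\<open>Q\<close> is a version of the regular conditional distribution of \<open>f\<close> given the observation \<open>Y\<close>,
  where \<open>f\<close> has law \<open>P\<close> and is independent of the Brownian motion \<open>B\<close> with law \<open>W\<close>.\<close>

definition posterior ::
  "(real \<Rightarrow> real) measure \<Rightarrow> (real \<Rightarrow> real) measure \<Rightarrow> nat \<Rightarrow>
    ((real \<Rightarrow> real) \<Rightarrow> (real \<Rightarrow> real) measure) \<Rightarrow> bool" where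
  "posterior W P n Q \<longleftrightarrow> Q \<in> measurable C01 (prob_algebra C01) \<and>
     (\<forall>A\<in>sets C01. \<forall>D\<in>sets C01.
        emeasure (P \<Otimes>\<^sub>M W) {(f, b) \<in> space (P \<Otimes>\<^sub>M W). f \<in> A \<and> observation n f b \<in> D} =
        (\<integral>\<^sup>+ y. emeasure (Q y) A * indicator D y
           \<partial>distr (P \<Otimes>\<^sub>M W) C01 (\<lambda>(f, b). observation n f b)))"

definition contraction_rate :: "real \<Rightarrow> nat \<Rightarrow> real" where
  "contraction_rate \<alpha> n =
     (if n = 1 then 0 else (real n / ln (real n)) powr (- (\<alpha> / (2 * \<alpha> + 1))))"

end

theory Submission
  imports Defs
begin

text \<open>The model is conjugate. Write \<open>\<theta>\<close> for the coefficient of \<open>f\<close> at a basis function \<open>e\<close> of prior variance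
  \<open>\<tau>\<close>. With \<open>\<rho> = n \<tau> / (n \<tau> + 1)\<close>, the residual \<open>\<theta> - \<rho> \<integral> e dY\<close> is uncorrelated with, hence independent of,
  the whole path \<open>Y\<close> under the prior, and it has law \<open>N(0, \<rho> / n)\<close>; so the posterior law of \<open>\<theta>\<close> is
  \<open>N(\<rho> \<integral> e dY, \<rho> / n)\<close>, for almost every \<open>Y\<close> under the marginal law of the data and, by absolute
  continuity, under the law for \<open>f\<^sub>0\<close>. There the posterior mean differs from the true coefficient \<open>\<theta>\<^sub>0\<close> by
  the bias \<open>(1 - \<rho>) \<theta>\<^sub>0\<close> and a Gaussian of variance at most \<open>\<rho> / n\<close>.

  Except with probability of order \<open>n\<^bsup>-T\<^sup>2/4\<^esup>\<close>, all coefficients at all levels \<open>l\<close> are within the bias plus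
  \<open>2 T\<close> times \<open>\<surd>((l + log n) \<rho> / n)\<close> of the truth. At most boundedly many wavelets of a level overlap, so
  the supremum norm is bounded by the sum over \<open>l\<close> of \<open>2\<^bsup>l/2\<^esup>\<close> times these bounds. The terms decay
  geometrically on both sides of the level where \<open>n \<tau>\<close> is of order one, and that level contributes a
  multiple of \<open>\<epsilon>\<^sub>n\<close>.\<close>


section \<open>Characteristic functions\<close>

text \<open>The posterior enters only as an arbitrary kernel \<open>Q\<close> that disintegrates the
  joint law of function and data, so nothing is known about \<open>Q y\<close> for an individual
  \<open>y\<close>; every statement on \<open>Q\<close> comes from integrating over events of the
  data. Treating one coefficient at a time keeps this one-dimensional: independence from the whole
  path reduces to an identity between characteristic functions at finitely many dyadic times, and a
  union bound recombines the coefficients. The factor \<open>1 / l\<close> of the prior variance is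
  matched to that bound: above the critical level the union over \<open>2 ^ l\<close> wavelets costs
  a factor of order \<open>l\<close>, which it cancels; below that level it inflates the bias by
  \<open>l\<close>, which is there at most of order \<open>log n\<close>, and this the rate allows.
  Absolute continuity is used between the laws of the data for two continuous functions, not between
  priors, so \<open>f0\<close> may be atypical for the prior; as the marginal law of the data is a
  mixture of such laws, a single good draw from the prior carries out the transfer.\<close>

lemma (in prob_space) weighted_char_zero_real:
  fixes X Z :: "'a \<Rightarrow> real"
  assumes X[measurable]: "X \<in> borel_measurable M" and Z[measurable]: "Z \<in> borel_measurable M"
    and K: "\<And>x. \<bar>Z x\<bar> \<le> K"
    and zero: "\<And>t. (CLINT x|M. complex_of_real (Z x) * iexp (t * X x)) = 0"
    and A[measurable]: "A \<in> sets borel"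
  shows "(LINT x|M. Z x * indicator A (X x)) = 0"
proof -
  \<comment> \<open>The maximum with 1 makes \<open>B\<close> positive, so that it can be divided
    by.\<close>
  define B where "B = max K 1"
  have B: "B > 0" "\<And>x. \<bar>Z x\<bar> \<le> B" using K by (auto simp: B_def le_max_iff_disj)
  have intZ: "integrable M Z"
    using B by (intro integrable_const_bound[where B=B]) auto
  have "(CLINT x|M. complex_of_real (Z x)) = 0"
    using zero[of 0] by simp
  then have Z0: "(LINT x|M. Z x) = 0"
    by simp
  \<comment> \<open>\<open>g = 1 + Z / B\<close> is a probability density: nonnegative by the choice
    of \<open>B\<close>, of mass one because the case \<open>t = 0\<close> of \<open>zero\<close>
    says that \<open>Z\<close> has mean zero. Under it \<open>X\<close> has the same characteristic
    function as under \<open>M\<close>, hence the same law; the difference of the two laws on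
    \<open>A\<close> is the claimed integral up to the factor \<open>B\<close>.\<close>
  define g where "g = (\<lambda>x. (B + Z x) / B)"
  have [measurable]: "g \<in> borel_measurable M" unfolding g_def by measurable
  have g0: "g x \<ge> 0" for x using B(1) B(2)[of x] by (auto simp: g_def)
  have intg: "integrable M g" unfolding g_def using intZ by simp
  have "(LINT x|M. g x) = 1"
    unfolding g_def using intZ Z0 B by (simp add: prob_space)
  then have "emeasure (density M g) (space M) = 1"
    using g0 intg by (simp add: emeasure_density nn_integral_eq_integral cong: nn_integral_cong_simp)
  then interpret D: prob_space "density M g"
    by (intro prob_spaceI) simp
  have 1: "real_distribution (distr (density M g) borel X)"
    by (intro D.real_distribution_distr) simp
  have 2: "real_distribution (distr M borel X)"
    by (intro real_distribution_distr) simp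
  have "char (distr (density M g) borel X) t = char (distr M borel X) t" for t
  proof -
    have i1: "integrable M (\<lambda>x. iexp (t * X x))"
      by (intro integrable_const_bound[where B=1]) auto
    have i2: "integrable M (\<lambda>x. complex_of_real (Z x) * iexp (t * X x))"
      using B by (intro integrable_const_bound[where B=B]) (auto simp: norm_mult)
    have "char (distr (density M g) borel X) t = (CLINT x|M. g x *\<^sub>R iexp (t * X x))"
      unfolding char_def using g0 by (simp add: integral_distr integral_density)
    also have "\<dots> = (CLINT x|M. iexp (t * X x) + (complex_of_real (Z x) * iexp (t * X x)) / B)"
      using B(1) by (intro Bochner_Integration.integral_cong) (auto simp: g_def scaleR_conv_of_real field_simps)
    also have "\<dots> = (CLINT x|M. iexp (t * X x))"
      using i1 i2 zero[of t] by simp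
    finally show ?thesis unfolding char_def by (simp add: integral_distr)
  qed
  then have eq: "distr (density M g) borel X = distr M borel X"
    by (intro Levy_uniqueness 1 2 ext)
  have *: "indicator (X -` A \<inter> space M) x = (indicator A (X x) :: 'b::zero_neq_one)" if "x \<in> space M" for x
    using that by (auto split: split_indicator)
  have i3: "integrable M (\<lambda>x. indicator A (X x) :: real)"
    by (intro integrable_const_bound[where B=1]) (auto split: split_indicator)
  have i4: "integrable M (\<lambda>x. Z x * indicator A (X x) :: real)"
    using B by (intro integrable_const_bound[where B=B]) (auto split: split_indicator intro: order_trans[OF abs_ge_zero])
  have "(LINT x|M. g x * indicator A (X x)) = (LINT y|distr (density M g) borel X. indicator A y)"
    using g0 by (subst integral_distr) (simp_all add: integral_density)
  also have "\<dots> = (LINT x|M. indicator A (X x))"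
    unfolding eq by (subst integral_distr) simp_all
  finally have "(LINT x|M. g x * indicator A (X x)) - (LINT x|M. indicator A (X x)) = 0" by simp
  moreover have "(LINT x|M. g x * indicator A (X x)) = (LINT x|M. indicator A (X x) + Z x * indicator A (X x) / B)"
    using B(1) by (intro Bochner_Integration.integral_cong) (auto simp: g_def field_simps)
  ultimately show ?thesis using i3 i4 B(1) by simp
qed

text \<open>Conjugating and replacing \<open>t\<close> by \<open>-t\<close> carries the hypothesis
  over to \<open>cnj (Z x)\<close>, hence to the real and imaginary parts, where the real case
  applies.\<close>

lemma (in prob_space) weighted_char_zero:
  fixes X :: "'a \<Rightarrow> real" and Z :: "'a \<Rightarrow> complex"
  assumes X[measurable]: "X \<in> borel_measurable M" and Z[measurable]: "Z \<in> borel_measurable M"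
    and K: "\<And>x. cmod (Z x) \<le> K"
    and zero: "\<And>t. (CLINT x|M. Z x * iexp (t * X x)) = 0"
    and A[measurable]: "A \<in> sets borel"
  shows "(CLINT x|M. Z x * indicator A (X x)) = 0"
proof -
  have int: "integrable M (\<lambda>x. Z x * W x)" if [measurable]: "W \<in> borel_measurable M" and "\<And>x. cmod (W x) \<le> 1" for W
    using K that(2) order_trans[OF norm_ge_zero K]
    by (intro integrable_const_bound[where B="K * 1"]) (auto simp: norm_mult intro!: mult_mono simp del: mult_1_right)
  have cnjZ[measurable]: "(\<lambda>x. cnj (Z x)) \<in> borel_measurable M"
    by (rule measurable_compose[OF Z borel_measurable_continuous_onI]) (intro continuous_intros)
  have int': "integrable M (\<lambda>x. cnj (Z x) * W x)" if [measurable]: "W \<in> borel_measurable M" and "\<And>x. cmod (W x) \<le> 1" for W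
    using K that(2) order_trans[OF norm_ge_zero K]
    by (intro integrable_const_bound[where B="K * 1"]) (auto simp: norm_mult intro!: mult_mono simp del: mult_1_right)
  have zero': "(CLINT x|M. cnj (Z x) * iexp (t * X x)) = 0" for t
  proof -
    have "(CLINT x|M. cnj (Z x) * iexp (t * X x)) = (CLINT x|M. cnj (Z x * iexp ((-t) * X x)))"
      by (intro Bochner_Integration.integral_cong) (auto simp: exp_cnj)
    also have "\<dots> = cnj (CLINT x|M. Z x * iexp ((-t) * X x))" by (rule Bochner_Integration.integral_cnj)
    finally show ?thesis using zero[of "-t"] by simp
  qed
  have Re: "(LINT x|M. Re (Z x) * indicator A (X x)) = 0"
  proof (rule weighted_char_zero_real[where K=K])
    fix t
    have "(CLINT x|M. complex_of_real (Re (Z x)) * iexp (t * X x)) =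
        (CLINT x|M. (Z x * iexp (t * X x) + cnj (Z x) * iexp (t * X x)) / 2)"
      by (intro Bochner_Integration.integral_cong refl)
        (simp only: distrib_right[symmetric] complex_add_cnj, simp)
    then show "(CLINT x|M. complex_of_real (Re (Z x)) * iexp (t * X x)) = 0"
      using zero[of t] zero'[of t] int[of "\<lambda>x. iexp (t * X x)"] int'[of "\<lambda>x. iexp (t * X x)"] by simp
  qed (auto intro: order_trans[OF abs_Re_le_cmod K])
  have ii: "- (\<i> * (a * (\<i> * e))) = a * e" for a e :: complex
    by (simp add: mult.left_commute[of a])
  have Im: "(LINT x|M. Im (Z x) * indicator A (X x)) = 0"
  proof (rule weighted_char_zero_real[where K=K])
    fix t
    have "(CLINT x|M. complex_of_real (Im (Z x)) * iexp (t * X x)) =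
        (CLINT x|M. (Z x * iexp (t * X x) - cnj (Z x) * iexp (t * X x)) / (2 * \<i>))"
      by (intro Bochner_Integration.integral_cong refl)
        (simp only: left_diff_distrib[symmetric] complex_diff_cnj, simp add: ii)
    then show "(CLINT x|M. complex_of_real (Im (Z x)) * iexp (t * X x)) = 0"
      using zero[of t] zero'[of t] int[of "\<lambda>x. iexp (t * X x)"] int'[of "\<lambda>x. iexp (t * X x)"] by simp
  qed (auto intro: order_trans[OF abs_Im_le_cmod K])
  have i: "integrable M (\<lambda>x. Z x * indicator A (X x))"
    by (rule int) (auto split: split_indicator)
  have 1: "Re (CLINT x|M. Z x * indicator A (X x)) = (LINT x|M. Re (Z x) * indicator A (X x))"
    unfolding integral_Re[OF i, symmetric] by (intro Bochner_Integration.integral_cong) (auto split: split_indicator)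
  have 2: "Im (CLINT x|M. Z x * indicator A (X x)) = (LINT x|M. Im (Z x) * indicator A (X x))"
    unfolding integral_Im[OF i, symmetric] by (intro Bochner_Integration.integral_cong) (auto split: split_indicator)
  show ?thesis using 1 2 Re Im by (simp add: complex_eq_iff)
qed

text \<open>Exponentials are traded for indicators one coordinate at a time. The exponentials of the
  remaining coordinates and the indicators already obtained are absorbed into the weight; therefore
  the weight is complex and arbitrary in the induction.\<close>

lemma (in prob_space) weighted_char_zero_finite:
  fixes Y :: "'i \<Rightarrow> 'a \<Rightarrow> real" and Z :: "'a \<Rightarrow> complex"
  assumes "finite J" and Y: "\<And>j. j \<in> J \<Longrightarrow> Y j \<in> borel_measurable M"
    and Z: "Z \<in> borel_measurable M" and K: "\<And>x. cmod (Z x) \<le> K"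
    and zero: "\<And>b. (CLINT x|M. Z x * iexp (\<Sum>j\<in>J. b j * Y j x)) = 0"
    and A: "\<And>j. j \<in> J \<Longrightarrow> A j \<in> sets borel"
  shows "(CLINT x|M. Z x * (\<Prod>j\<in>J. indicator (A j) (Y j x))) = 0"
  using assms(1-5,6)
proof (induction J arbitrary: Z)
  case empty
  from empty(4)[of "\<lambda>_. 0"] show ?case by simp
next
  case (insert i J)
  have [measurable]: "Y j \<in> borel_measurable M" if "j \<in> insert i J" for j using insert.prems(1) that by simp
  have Yi[measurable]: "Y i \<in> borel_measurable M" by simp
  have [measurable]: "Z \<in> borel_measurable M" by fact
  have [measurable]: "A i \<in> sets borel" using insert.prems by simp
  have *: "(CLINT x|M. (Z x * indicator (A i) (Y i x)) * iexp (\<Sum>j\<in>J. b j * Y j x)) = 0" for b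
  proof -
    have "(CLINT x|M. (Z x * iexp (\<Sum>j\<in>J. b j * Y j x)) * indicator (A i) (Y i x)) = 0"
    proof (rule weighted_char_zero[where K=K])
      fix t
      let ?b = "\<lambda>j. if j = i then t else b j"
      have "(\<Sum>j\<in>insert i J. ?b j * Y j x) = t * Y i x + (\<Sum>j\<in>J. b j * Y j x)" for x
        using insert.hyps by (auto intro!: sum.cong)
      then have "(CLINT x|M. Z x * iexp (\<Sum>j\<in>J. b j * Y j x) * iexp (t * Y i x)) =
          (CLINT x|M. Z x * iexp (\<Sum>j\<in>insert i J. ?b j * Y j x))"
        by (intro Bochner_Integration.integral_cong refl)
          (simp only: mult.assoc exp_add[symmetric] distrib_left[symmetric] of_real_add[symmetric] add.commute)
      also have "\<dots> = 0" by (rule insert.prems)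
      finally show "(CLINT x|M. Z x * iexp (\<Sum>j\<in>J. b j * Y j x) * iexp (t * Y i x)) = 0" .
    qed (auto simp: norm_mult insert.prems simp del: of_real_sum of_real_mult)
    then show ?thesis by (simp add: mult_ac)
  qed
  have "(CLINT x|M. (Z x * indicator (A i) (Y i x)) * (\<Prod>j\<in>J. indicator (A j) (Y j x))) = 0"
  proof (rule insert.IH[OF _ _ _ *])
    show "cmod (Z x * indicator (A i) (Y i x)) \<le> K" for x
      using insert.prems(3)[of x] order_trans[OF norm_ge_zero insert.prems(3)] by (auto split: split_indicator)
  qed (use insert.prems in auto)
  then show ?case using insert.hyps by (simp add: mult_ac)
qed

section \<open>Normal laws: characteristic function, tails, conditioning\<close>

lemma char_normal_density:
  assumes "\<sigma> > 0"
  shows "char (density lborel (normal_density 0 \<sigma>)) t = exp (- (\<sigma>\<^sup>2 * t\<^sup>2 / 2))"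
proof -
  interpret N: prob_space "density lborel std_normal_density"
    by (rule prob_space_normal_density) simp
  have "distributed (density lborel std_normal_density) lborel (\<lambda>x. x) std_normal_density"
    by (auto simp: distributed_def cong: distr_cong intro!: distr_id2)
  from N.normal_density_affine[OF this, of \<sigma> 0] assms
  have "distr (density lborel std_normal_density) lborel (\<lambda>x. \<sigma> * x) = density lborel (normal_density 0 \<sigma>)"
    by (simp add: distributed_def)
  then have "char (density lborel (normal_density 0 \<sigma>)) t =
      char (distr (density lborel std_normal_density) borel (\<lambda>x. \<sigma> * x)) t"
    by (metis distr_cong sets_lborel)
  also have "\<dots> = char (density lborel std_normal_density) (t * \<sigma>)"
    unfolding char_def by (simp add: integral_distr mult_ac)
  finally show ?thesis
    by (simp add: char_std_normal_distribution power_mult_distrib mult_ac)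
qed

text \<open>Comparison with the normal density of twice the variance: on the tail half of the
  exponent is at least \<open>u\<^sup>2 / (4 * \<sigma>\<^sup>2)\<close>, and the other half is
  integrated away. The ratio of the normalizing constants is \<open>sqrt 2\<close>, rounded up to
  2.\<close>

lemma normal_tail:
  assumes "\<sigma> > 0" "u \<ge> 0"
  shows "measure (density lborel (normal_density 0 \<sigma>)) {x. \<bar>x\<bar> > u} \<le> 2 * exp (- (u\<^sup>2 / (4 * \<sigma>\<^sup>2)))"
proof -
  interpret N: prob_space "density lborel (normal_density 0 \<sigma>)"
    by (rule prob_space_normal_density) fact
  interpret N2: prob_space "density lborel (normal_density 0 (sqrt 2 * \<sigma>))"
    by (rule prob_space_normal_density) (simp add: assms)
  let ?c = "2 * exp (- (u\<^sup>2 / (4 * \<sigma>\<^sup>2)))"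
  have le: "normal_density 0 \<sigma> x \<le> ?c * normal_density 0 (sqrt 2 * \<sigma>) x" if "\<bar>x\<bar> > u" for x
  proof -
    have "u\<^sup>2 \<le> x\<^sup>2" using that assms(2) by (metis abs_ge_zero less_eq_real_def power2_abs power_mono)
    then have "u\<^sup>2 / (4 * \<sigma>\<^sup>2) \<le> x\<^sup>2 / (4 * \<sigma>\<^sup>2)" by (intro divide_right_mono) auto
    then have e: "exp (- x\<^sup>2 / (2 * \<sigma>\<^sup>2)) \<le> exp (- (u\<^sup>2 / (4 * \<sigma>\<^sup>2))) * exp (- x\<^sup>2 / (4 * \<sigma>\<^sup>2))"
      unfolding exp_add[symmetric] using assms(1) by (simp add: field_simps)
    have s: "sqrt 2 \<le> 2" by (rule real_le_lsqrt) auto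
    have "normal_density 0 \<sigma> x = (1 / sqrt (2 * pi * \<sigma>\<^sup>2)) * exp (- x\<^sup>2 / (2 * \<sigma>\<^sup>2))"
      by (simp add: normal_density_def)
    also have "\<dots> \<le> (1 / sqrt (2 * pi * \<sigma>\<^sup>2)) * (exp (- (u\<^sup>2 / (4 * \<sigma>\<^sup>2))) * exp (- x\<^sup>2 / (4 * \<sigma>\<^sup>2)))"
      by (intro mult_left_mono e) auto
    also have "\<dots> = sqrt 2 * exp (- (u\<^sup>2 / (4 * \<sigma>\<^sup>2))) * normal_density 0 (sqrt 2 * \<sigma>) x"
      using assms(1) by (simp add: normal_density_def power_mult_distrib real_sqrt_mult divide_simps)
    also have "\<dots> \<le> 2 * exp (- (u\<^sup>2 / (4 * \<sigma>\<^sup>2))) * normal_density 0 (sqrt 2 * \<sigma>) x"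
      by (intro mult_right_mono s) auto
    finally show ?thesis .
  qed
  have "emeasure (density lborel (normal_density 0 \<sigma>)) {x. \<bar>x\<bar> > u}
      = (\<integral>\<^sup>+x. normal_density 0 \<sigma> x * indicator {x. \<bar>x\<bar> > u} x \<partial>lborel)"
    by (subst emeasure_density) (auto simp: ennreal_mult'' split: split_indicator intro!: nn_integral_cong)
  also have "\<dots> \<le> (\<integral>\<^sup>+x. ennreal ?c * normal_density 0 (sqrt 2 * \<sigma>) x \<partial>lborel)"
    using le by (intro nn_integral_mono) (auto split: split_indicator simp: ennreal_mult'[symmetric])
  also have "\<dots> = ennreal ?c * emeasure (density lborel (normal_density 0 (sqrt 2 * \<sigma>))) UNIV"
    by (subst nn_integral_cmult) (auto simp: emeasure_density)
  also have "\<dots> = ennreal ?c" using N2.emeasure_space_1 by simp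
  finally show ?thesis unfolding N.emeasure_eq_measure by (simp add: ennreal_le_iff)
qed

text \<open>Levy uniqueness for the law of \<open>X\<close> under \<open>M\<close> conditioned on
  \<open>D\<close>. The conditional law exists only if \<open>D\<close> has positive measure, hence
  the case distinction.\<close>

lemma (in prob_space) conditional_normal:
  fixes X :: "'a \<Rightarrow> real"
  assumes X[measurable]: "X \<in> borel_measurable M" and D[measurable]: "D \<in> sets M" and "\<sigma> > 0"
    and char: "\<And>a. (CLINT x|M. indicator D x * iexp (a * X x)) = exp (- (\<sigma>\<^sup>2 * a\<^sup>2 / 2)) * measure M D"
    and A[measurable]: "A \<in> sets borel"
  shows "measure M {x\<in>space M. x \<in> D \<and> X x \<in> A} = measure (density lborel (normal_density 0 \<sigma>)) A * measure M D"
proof (cases "measure M D = 0")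
  case True
  moreover have "measure M {x\<in>space M. x \<in> D \<and> X x \<in> A} \<le> measure M D"
    by (intro finite_measure_mono) auto
  ultimately show ?thesis using measure_nonneg[of M "{x\<in>space M. x \<in> D \<and> X x \<in> A}"] by simp
next
  case False
  define p where "p = measure M D"
  have p: "p > 0" using False by (simp add: p_def zero_less_measure_iff)
  let ?g = "\<lambda>x. indicator D x / p"
  have g: "0 \<le> ?g x" for x using p by simp
  have "emeasure (density M ?g) (space M) = (\<integral>\<^sup>+x. ennreal (1 / p) * indicator D x \<partial>M)"
    by (simp add: emeasure_density ennreal_indicator[symmetric] ennreal_mult'[symmetric] p less_imp_le cong: nn_integral_cong_simp)
  also have "\<dots> = ennreal (1 / p) * ennreal p"
    by (simp add: nn_integral_cmult emeasure_eq_measure p_def)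
  also have "\<dots> = 1" using p by (simp add: ennreal_mult'[symmetric])
  finally interpret G: prob_space "density M ?g" by (intro prob_spaceI) simp
  interpret N: prob_space "density lborel (normal_density 0 \<sigma>)"
    by (rule prob_space_normal_density) fact
  have "distr (density M ?g) borel X = density lborel (normal_density 0 \<sigma>)"
  proof (intro Levy_uniqueness ext)
    show "real_distribution (distr (density M ?g) borel X)"
      by (intro G.real_distribution_distr) simp
    show "real_distribution (density lborel (normal_density 0 \<sigma>))"
      using N.prob_space_axioms by (simp add: real_distribution_def real_distribution_axioms_def)
    fix t
    have "char (distr (density M ?g) borel X) t = (CLINT x|M. ?g x *\<^sub>R iexp (t * X x))"
      unfolding char_def using g by (simp add: integral_distr integral_density)
    also have "\<dots> = (CLINT x|M. indicator D x * iexp (t * X x) / p)"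
      by (intro Bochner_Integration.integral_cong) (auto split: split_indicator simp: scaleR_conv_of_real)
    also have "\<dots> = exp (- (\<sigma>\<^sup>2 * t\<^sup>2 / 2)) * p / p"
      using char[of t] by (simp add: p_def)
    also have "\<dots> = char (density lborel (normal_density 0 \<sigma>)) t"
      using p \<open>\<sigma> > 0\<close> by (simp add: char_normal_density)
    finally show "char (distr (density M ?g) borel X) t = char (density lborel (normal_density 0 \<sigma>)) t" .
  qed
  then have "emeasure (density lborel (normal_density 0 \<sigma>)) A = emeasure (density M ?g) (X -` A \<inter> space M)"
    using emeasure_distr[of X "density M ?g" borel A] by simp
  also have "\<dots> = (\<integral>\<^sup>+x. ennreal (1 / p) * indicator {x\<in>space M. x \<in> D \<and> X x \<in> A} x \<partial>M)"
    using p by (subst emeasure_density) (auto intro!: nn_integral_cong split: split_indicator)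
  also have "\<dots> = ennreal (1 / p) * emeasure M {x\<in>space M. x \<in> D \<and> X x \<in> A}"
    by (subst nn_integral_cmult) auto
  finally have "ennreal (measure (density lborel (normal_density 0 \<sigma>)) A) = ennreal (1 / p * measure M {x\<in>space M. x \<in> D \<and> X x \<in> A})"
    using p by (simp only: N.emeasure_eq_measure emeasure_eq_measure) (subst ennreal_mult', simp_all)
  then show ?thesis
    using p by (simp add: p_def[symmetric] field_simps)
qed

section \<open>Path space\<close>

definition dfloor :: "nat \<Rightarrow> real \<Rightarrow> real" where
  "dfloor p x = real_of_int \<lfloor>2 ^ p * x\<rfloor> / 2 ^ p"

text \<open>Path events are tested at these times only: finitely many of them lie on one uniform
  grid, so the Brownian increments over that grid describe them, and by continuity of paths they
  determine all other times.\<close>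

definition unit_dyadics :: "real set" where
  "unit_dyadics = {real i / 2 ^ p | i p. i \<le> 2 ^ p}"

lemma dfloor_le: "dfloor p x \<le> x"
  unfolding dfloor_def by (simp add: divide_le_eq mult.commute)

lemma dfloor_ge: "x - 1 / 2 ^ p \<le> dfloor p x"
proof -
  have "2 ^ p * x - 1 \<le> real_of_int \<lfloor>2 ^ p * x\<rfloor>" by linarith
  then have "(2 ^ p * x - 1) / 2 ^ p \<le> dfloor p x"
    unfolding dfloor_def by (intro divide_right_mono) auto
  then show ?thesis by (simp add: diff_divide_distrib)
qed

lemma dfloor_tendsto: "(\<lambda>p. dfloor p x) \<longlonglongrightarrow> x"
proof (rule tendsto_sandwich)
  have "(\<lambda>p. x - (1 / 2) ^ p) \<longlonglongrightarrow> x - 0"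
    by (intro tendsto_intros) simp
  then show "(\<lambda>p. x - 1 / 2 ^ p) \<longlonglongrightarrow> x" by (simp add: power_one_over)
qed (auto intro!: always_eventually dfloor_le dfloor_ge)

lemma dfloor_dyadic:
  assumes "x \<in> {0..1}" shows "dfloor p x \<in> unit_dyadics"
proof -
  have "2 ^ p * x \<le> 2 ^ p * 1" using assms by (intro mult_left_mono) auto
  then have "\<lfloor>2 ^ p * x\<rfloor> \<le> 2 ^ p" by (metis floor_mono floor_of_nat mult_1_right of_nat_numeral of_nat_power)
  moreover have "0 \<le> \<lfloor>2 ^ p * x\<rfloor>" using assms by simp
  ultimately have "dfloor p x = real (nat \<lfloor>2 ^ p * x\<rfloor>) / 2 ^ p" "nat \<lfloor>2 ^ p * x\<rfloor> \<le> 2 ^ p"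
    by (auto simp: dfloor_def nat_le_iff)
  then show ?thesis unfolding unit_dyadics_def by blast
qed

lemma unit_dyadics_subset: "unit_dyadics \<subseteq> {0..1}"
proof
  fix t :: real assume "t \<in> unit_dyadics"
  then obtain i p :: nat where t: "t = real i / 2 ^ p" "i \<le> 2 ^ p" by (auto simp: unit_dyadics_def)
  from t(2) have "real i \<le> 2 ^ p" by (metis of_nat_le_iff of_nat_numeral of_nat_power)
  then show "t \<in> {0..1}" by (simp add: t(1))
qed

lemma dfloor_unit: "x \<in> {0..1} \<Longrightarrow> dfloor p x \<in> {0..1}"
  using dfloor_dyadic unit_dyadics_subset by blast

lemma unit_dyadicsE:
  assumes "finite J" "J \<subseteq> unit_dyadics"
  obtains p where "\<And>t. t \<in> J \<Longrightarrow> \<exists>i\<le>2 ^ p. t = real i / 2 ^ p"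
proof -
  have "\<exists>p. \<forall>t\<in>J. \<exists>i\<le>2 ^ p. t = real i / 2 ^ p"
    using assms
  proof (induction J)
    case (insert t J)
    then obtain p q i where p: "\<forall>t\<in>J. \<exists>i\<le>2 ^ p. t = real i / 2 ^ p" and t: "t = real i / 2 ^ q" "i \<le> 2 ^ q"
      by (auto simp: unit_dyadics_def)
    have up: "\<exists>j\<le>2 ^ (a + b). real i / 2 ^ a = real j / 2 ^ (a + b)" if "i \<le> 2 ^ a" for i a b :: nat
      using that by (intro exI[of _ "i * 2 ^ b"]) (simp add: power_add)
    have "\<forall>s\<in>insert t J. \<exists>i\<le>2 ^ (p + q). s = real i / 2 ^ (p + q)"
    proof
      fix s assume "s \<in> insert t J"
      then consider "s = t" | "s \<in> J" by blast
      then show "\<exists>i\<le>2 ^ (p + q). s = real i / 2 ^ (p + q)"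
      proof cases
        case 1
        then show ?thesis using up[OF t(2), of p] t(1) by (simp add: add.commute)
      next
        case 2
        then obtain j where "j \<le> 2 ^ p" "s = real j / 2 ^ p" using p by blast
        then show ?thesis using up[of j p q] by simp
      qed
    qed
    then show ?case by blast
  qed auto
  then show ?thesis using that by blast
qed

lemma space_C01: "space C01 = {f \<in> extensional {0..1}. continuous_on {0..1} f}"
  by (auto simp: C01_def space_restrict_space space_PiM PiE_def)

lemma C01_continuous: "f \<in> space C01 \<Longrightarrow> continuous_on {0..1} f"
  by (simp add: space_C01)

lemma C01_eval: "t \<in> {0..1} \<Longrightarrow> (\<lambda>f. f t) \<in> borel_measurable C01"
  unfolding C01_def by (intro measurable_restrict_space1) simp

lemma measurable_C01I:
  assumes "\<And>x. x \<in> space M \<Longrightarrow> g x \<in> space C01"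
    and "\<And>t. t \<in> {0..1} \<Longrightarrow> (\<lambda>x. g x t) \<in> borel_measurable M"
  shows "g \<in> measurable M C01"
  unfolding C01_def
  by (intro measurable_restrict_space2 measurable_PiM_single')
    (use assms in \<open>auto simp: space_C01 PiE_def\<close>)

text \<open>The index \<open>2 ^ p\<close> is included for the point \<open>x = 1\<close>, which
  lies in no half-open cell with a smaller index.\<close>

lemma dfloor_step_sum:
  fixes g :: "real \<Rightarrow> real"
  assumes "x \<in> {0..1}"
  shows "(\<Sum>i\<le>2 ^ p. g (real i / 2 ^ p) * indicator {real i / 2 ^ p..<(real i + 1) / 2 ^ p} x) = g (dfloor p x)"
proof -
  define m where "m = nat \<lfloor>2 ^ p * x\<rfloor>"
  have "2 ^ p * x \<le> 2 ^ p * 1" using assms by (intro mult_left_mono) auto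
  then have "\<lfloor>2 ^ p * x\<rfloor> \<le> 2 ^ p" by (metis floor_mono floor_of_nat mult_1_right of_nat_numeral of_nat_power)
  moreover have nn: "0 \<le> \<lfloor>2 ^ p * x\<rfloor>" using assms by simp
  ultimately have m: "m \<le> 2 ^ p" "real_of_int \<lfloor>2 ^ p * x\<rfloor> = real m"
    by (auto simp: m_def nat_le_iff)
  have "x \<in> {real i / 2 ^ p..<(real i + 1) / 2 ^ p} \<longleftrightarrow> i = m" for i
  proof -
    have "x \<in> {real i / 2 ^ p..<(real i + 1) / 2 ^ p} \<longleftrightarrow> real i \<le> 2 ^ p * x \<and> 2 ^ p * x < real i + 1"
      by (simp add: field_simps)
    also have "\<dots> \<longleftrightarrow> \<lfloor>2 ^ p * x\<rfloor> = int i" by linarith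
    also have "\<dots> \<longleftrightarrow> i = m" using nn by (auto simp: m_def)
    finally show ?thesis .
  qed
  then have *: "indicator {real i / 2 ^ p..<(real i + 1) / 2 ^ p} x = (if i = m then 1 else 0)" for i
    unfolding indicator_def by simp
  have "(\<Sum>i\<le>2 ^ p. g (real i / 2 ^ p) * indicator {real i / 2 ^ p..<(real i + 1) / 2 ^ p} x) = g (real m / 2 ^ p)"
    unfolding * using m(1)
    by (subst sum.cong[OF refl, where h="\<lambda>i. if i = m then g (real m / 2 ^ p) else 0"]) auto
  also have "\<dots> = g (dfloor p x)" using m by (simp add: dfloor_def)
  finally show ?thesis .
qed

text \<open>Replacing \<open>x\<close> by the grid point to its left gives finite sums of products
  of a function of \<open>f\<close> and a function of \<open>x\<close>; they converge pointwise by
  continuity of \<open>f\<close>. Joint measurability makes integrals of \<open>f\<close> measurable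
  functions of \<open>f\<close>.\<close>

lemma C01_joint: "(\<lambda>(f, x). indicator {0..1} x * f x) \<in> borel_measurable (C01 \<Otimes>\<^sub>M lborel)"
proof (rule borel_measurable_LIMSEQ_real)
  let ?h = "\<lambda>p (f, x). indicator {0..1} x *
     (\<Sum>i\<le>2 ^ p. f (real i / 2 ^ p) * indicator {real i / 2 ^ p..<(real i + 1) / 2 ^ p} x)"
  show "?h p \<in> borel_measurable (C01 \<Otimes>\<^sub>M lborel)" for p
  proof -
    have [measurable]: "(\<lambda>f. f (real i / 2 ^ p)) \<in> borel_measurable C01" if "i \<in> {..2 ^ p}" for i
      using that unit_dyadics_subset by (intro C01_eval) (auto simp: unit_dyadics_def)
    show ?thesis by measurable
  qed
  show "(\<lambda>p. ?h p z) \<longlonglongrightarrow> (case z of (f, x) \<Rightarrow> indicator {0..1} x * f x)"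
    if "z \<in> space (C01 \<Otimes>\<^sub>M lborel)" for z
  proof -
    obtain f x where z: "z = (f, x)" by force
    then have f: "continuous_on {0..1} f" using that by (auto simp: space_pair_measure C01_continuous)
    show ?thesis
    proof (cases "x \<in> {0..1}")
      case True
      have "(\<lambda>p. f (dfloor p x)) \<longlonglongrightarrow> f x"
        by (intro continuous_on_tendsto_compose[OF f dfloor_tendsto] True always_eventually allI dfloor_unit)
      then show ?thesis using True unfolding z prod.case dfloor_step_sum[OF True] by simp
    qed (simp add: z)
  qed
qed

lemma C01_set_integral_measurable:
  assumes [measurable]: "u \<in> borel_measurable borel" and "t \<in> {0..1}"
  shows "(\<lambda>f. LINT x:{0..t}|lborel. f x * u x) \<in> borel_measurable C01"
proof -
  have *: "indicat_real {0..t} x *\<^sub>R (f x * u x) = indicator {0..t} x * (indicator {0..1} x * f x) * u x" for f x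
    using assms by (auto split: split_indicator)
  note C01_joint[measurable]
  have "(\<lambda>(f, x). indicat_real {0..t} x * (case (f, x) of (f, x) \<Rightarrow> indicator {0..1} x * f x) * u x) \<in> borel_measurable (C01 \<Otimes>\<^sub>M lborel)"
    by measurable
  then show ?thesis
    unfolding set_lebesgue_integral_def *
    by (intro lborel.borel_measurable_lebesgue_integral) simp
qed

lemma continuous_primitive:
  fixes f :: "real \<Rightarrow> real"
  assumes "continuous_on {0..1} f"
  shows "continuous_on {0..1} (\<lambda>t. LINT s:{0..t}|lborel. f s)"
proof -
  have "(LINT s:{0..t}|lborel. f s) = integral {0..t} f" if "t \<in> {0..1}" for t
  proof -
    have "continuous_on {0..t} f" using that by (intro continuous_on_subset[OF assms]) auto
    then show ?thesis
      by (rule set_borel_integral_eq_integral(2)[OF borel_integrable_atLeastAtMost'])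
  qed
  moreover have "continuous_on {0..1} (\<lambda>t. integral {0..t} f)"
    by (intro indefinite_integral_continuous_1 integrable_continuous_interval assms)
  ultimately show ?thesis by (simp cong: continuous_on_cong_simp)
qed

lemma observation_in_C01:
  assumes "continuous_on {0..1} f" "continuous_on {0..1} b"
  shows "observation n f b \<in> space C01"
  unfolding space_C01 observation_def
  by (auto simp: divide_inverse cong: continuous_on_cong_simp
    intro!: continuous_on_add continuous_primitive continuous_on_mult_right assms)

text \<open>Elements of \<open>C01\<close> are \<open>undefined\<close> off the unit interval while
  \<open>f0\<close> is any function on the line; this identifies \<open>f0\<close> with its
  representative in \<open>C01\<close>.\<close>

lemma observation_restrict: "observation n (restrict f {0..1}) b = observation n f b"
  unfolding observation_def
  by (auto simp: restrict_def fun_eq_iff set_lebesgue_integral_def intro!: Bochner_Integration.integral_cong split: split_indicator)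

lemma observation_measurable_pair:
  "(\<lambda>(f, b). observation n f b) \<in> measurable (C01 \<Otimes>\<^sub>M C01) C01"
proof (rule measurable_C01I)
  show "(case x of (f, b) \<Rightarrow> observation n f b) \<in> space C01" if "x \<in> space (C01 \<Otimes>\<^sub>M C01)" for x
    using that by (auto simp: space_pair_measure C01_continuous intro: observation_in_C01)
  fix t :: real assume t: "t \<in> {0..1}"
  note [measurable] = C01_eval[OF t] C01_set_integral_measurable[of "\<lambda>_. 1", OF _ t, simplified]
  have "(\<lambda>(f, b). (LINT s:{0..t}|lborel. f s) + b t / sqrt (real n)) \<in> borel_measurable (C01 \<Otimes>\<^sub>M C01)"
    by measurable
  then show "(\<lambda>x. (case x of (f, b) \<Rightarrow> observation n f b) t) \<in> borel_measurable (C01 \<Otimes>\<^sub>M C01)"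
    using t by (simp add: observation_def split_beta)
qed

lemma observation_measurable:
  assumes "continuous_on {0..1} f"
  shows "observation n f \<in> measurable C01 C01"
proof -
  have "restrict f {0..1} \<in> space C01"
    using assms by (simp add: space_C01 cong: continuous_on_cong_simp)
  from measurable_compose[OF measurable_Pair1'[OF this] observation_measurable_pair]
  show ?thesis by (simp add: observation_restrict)
qed

section \<open>Generators of the path space\<close>

definition cylinders :: "(real \<Rightarrow> real) set set" where
  "cylinders = {{f \<in> space C01. restrict f J \<in> A} | J A.
     finite J \<and> J \<subseteq> unit_dyadics \<and> A \<in> sets (PiM J (\<lambda>_. borel))}"

text \<open>Two generators with different purposes: rectangles are stable under intersection, as
  Dynkin induction requires, and split into events at single times; cylinders also contain
  complements and finite unions, so they form an algebra from which measurable sets can be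
  approximated.\<close>

definition rectangles :: "(real \<Rightarrow> real) set set" where
  "rectangles = {{f \<in> space C01. \<forall>t\<in>J. f t \<in> A t} | J A.
     finite J \<and> J \<subseteq> unit_dyadics \<and> (\<forall>t\<in>J. A t \<in> sets borel)}"

lemma rectangles_subset_cylinders: "rectangles \<subseteq> cylinders"
proof
  fix D assume "D \<in> rectangles"
  then obtain J A where D: "D = {f \<in> space C01. \<forall>t\<in>J. f t \<in> A t}" "finite J" "J \<subseteq> unit_dyadics" "\<forall>t\<in>J. A t \<in> sets borel"
    by (auto simp: rectangles_def)
  then have "D = {f \<in> space C01. restrict f J \<in> PiE J A}" by (auto simp: PiE_iff)
  moreover have "PiE J A \<in> sets (PiM J (\<lambda>_. borel))"
    using D by (intro sets_PiM_I_finite) auto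
  ultimately show "D \<in> cylinders" using D unfolding cylinders_def by blast
qed

lemma cylinders_sets: "cylinders \<subseteq> sets C01"
proof
  fix D assume "D \<in> cylinders"
  then obtain J A where D: "D = {f \<in> space C01. restrict f J \<in> A}" "finite J" "J \<subseteq> unit_dyadics" "A \<in> sets (PiM J (\<lambda>_. borel))"
    by (auto simp: cylinders_def)
  have "(\<lambda>f. restrict f J) \<in> measurable C01 (PiM J (\<lambda>_. borel))"
    using D unit_dyadics_subset by (intro measurable_restrict C01_eval) auto
  from measurable_sets[OF this D(4)] show "D \<in> sets C01"
    unfolding D(1) by (simp add: vimage_def Int_def conj_commute)
qed

lemma rectangles_Int_stable: "Int_stable rectangles"
proof (rule Int_stableI)
  fix D E assume "D \<in> rectangles" "E \<in> rectangles"
  then obtain J A K B where D: "D = {f \<in> space C01. \<forall>t\<in>J. f t \<in> A t}" "finite J" "J \<subseteq> unit_dyadics" "\<forall>t\<in>J. A t \<in> sets borel"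
    and E: "E = {f \<in> space C01. \<forall>t\<in>K. f t \<in> B t}" "finite K" "K \<subseteq> unit_dyadics" "\<forall>t\<in>K. B t \<in> sets borel"
    by (auto simp: rectangles_def)
  define C where "C t = (if t \<in> J then A t else UNIV) \<inter> (if t \<in> K then B t else UNIV)" for t
  have "D \<inter> E = {f \<in> space C01. \<forall>t\<in>J \<union> K. f t \<in> C t}"
    unfolding D(1) E(1) C_def by (simp add: set_eq_iff) blast
  moreover have "\<forall>t\<in>J \<union> K. C t \<in> sets borel" using D(4) E(4) by (auto simp: C_def)
  moreover have "finite (J \<union> K)" "J \<union> K \<subseteq> unit_dyadics" using D E by auto
  ultimately show "D \<inter> E \<in> rectangles" unfolding rectangles_def by blast
qed

text \<open>On continuous paths the evaluation at any \<open>t\<close> is the limit of the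
  evaluations at the dyadic times \<open>dfloor p t\<close>, so dyadic evaluations already
  generate.\<close>

lemma sets_C01_rectangles: "sets C01 = sigma_sets (space C01) rectangles"
proof
  have sub: "rectangles \<subseteq> Pow (space C01)" by (auto simp: rectangles_def)
  show "sigma_sets (space C01) rectangles \<subseteq> sets C01"
    using rectangles_subset_cylinders cylinders_sets by (intro sets.sigma_sets_subset) auto
  let ?M = "sigma (space C01) rectangles"
  have dy: "(\<lambda>f. f t) \<in> borel_measurable ?M" if "t \<in> unit_dyadics" for t
  proof (rule measurableI)
    fix A :: "real set" assume "A \<in> sets borel"
    then have "{f \<in> space C01. \<forall>s\<in>{t}. f s \<in> (\<lambda>_. A) s} \<in> rectangles"
      using that unfolding rectangles_def
      by (intro CollectI exI[of _ "{t}"] exI[of _ "\<lambda>_. A"] conjI) auto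
    then have "{f \<in> space C01. f t \<in> A} \<in> sets ?M"
      using sub by (auto simp: sets_measure_of)
    then show "(\<lambda>f. f t) -` A \<inter> space ?M \<in> sets ?M"
      using sub by (simp add: space_measure_of vimage_def Int_def conj_commute)
  qed simp
  have id: "(\<lambda>f. f) \<in> measurable ?M C01"
  proof (rule measurable_C01I)
    fix t :: real assume t: "t \<in> {0..1}"
    show "(\<lambda>f. f t) \<in> borel_measurable ?M"
    proof (rule borel_measurable_LIMSEQ_real)
      show "(\<lambda>f. f (dfloor p t)) \<in> borel_measurable ?M" for p
        by (rule dy[OF dfloor_dyadic[OF t]])
      show "(\<lambda>p. f (dfloor p t)) \<longlonglongrightarrow> f t" if "f \<in> space ?M" for f
        using that sub t
        by (intro continuous_on_tendsto_compose[OF C01_continuous dfloor_tendsto] always_eventually allI dfloor_unit)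
           (simp_all add: space_measure_of)
    qed
  qed (use sub in \<open>simp add: space_measure_of\<close>)
  show "sets C01 \<subseteq> sigma_sets (space C01) rectangles"
  proof
    fix A assume A: "A \<in> sets C01"
    have "(\<lambda>f. f) -` A \<inter> space ?M \<in> sets ?M"
      by (rule measurable_sets[OF id A])
    moreover have "A \<subseteq> space C01" using A by (rule sets.sets_into_space)
    ultimately show "A \<in> sigma_sets (space C01) rectangles"
      using sub by (simp add: space_measure_of sets_measure_of Int_absorb2)
  qed
qed

text \<open>Replaces a multivariate version of Levy's uniqueness theorem.\<close>

lemma (in prob_space) weighted_char_zero_path:
  fixes Z :: "'a \<Rightarrow> complex"
  assumes Y[measurable]: "Y \<in> measurable M C01" and Z[measurable]: "Z \<in> borel_measurable M"
    and K: "\<And>x. cmod (Z x) \<le> K"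
    and zero: "\<And>J b. finite J \<Longrightarrow> J \<subseteq> unit_dyadics \<Longrightarrow> (CLINT x|M. Z x * iexp (\<Sum>t\<in>J. b t * Y x t)) = 0"
    and A: "A \<in> sets C01"
  shows "(CLINT x:(Y -` A \<inter> space M)|M. Z x) = 0"
proof -
  have intZ: "set_integrable M B Z" if "B \<in> sets M" for B
    unfolding set_integrable_def using that K order_trans[OF norm_ge_zero K]
    by (intro integrable_const_bound[where B=K]) (auto split: split_indicator)
  \<comment> \<open>The empty set of times gives the whole space; the Dynkin induction needs it for
    complements.\<close>
  have Z0: "(CLINT x|M. Z x) = 0" using zero[of "{}"] by simp
  have sub: "rectangles \<subseteq> Pow (space C01)" by (auto simp: rectangles_def)
  from A have "A \<in> sigma_sets (space C01) rectangles" by (simp add: sets_C01_rectangles)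
  then show ?thesis
  proof (induction rule: sigma_sets_induct_disjoint[OF rectangles_Int_stable sub, consumes 1, case_names basic empty compl union])
    case (basic A)
    then obtain J B where D: "A = {f \<in> space C01. \<forall>t\<in>J. f t \<in> B t}" "finite J" "J \<subseteq> unit_dyadics" "\<forall>t\<in>J. B t \<in> sets borel"
      by (auto simp: rectangles_def)
    have "(CLINT x|M. Z x * (\<Prod>t\<in>J. indicator (B t) (Y x t))) = 0"
    proof (rule weighted_char_zero_finite[OF D(2) _ Z K zero[OF D(2,3)]])
      show "(\<lambda>x. Y x t) \<in> borel_measurable M" if "t \<in> J" for t
        using that D(3) unit_dyadics_subset by (intro measurable_compose[OF Y C01_eval]) auto
    qed (use D in auto)
    also have "(CLINT x|M. Z x * (\<Prod>t\<in>J. indicator (B t) (Y x t))) = (CLINT x:(Y -` A \<inter> space M)|M. Z x)"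
      unfolding set_lebesgue_integral_def
    proof (intro Bochner_Integration.integral_cong refl)
      fix x assume x: "x \<in> space M"
      then have "Y x \<in> space C01" using measurable_space[OF Y] by simp
      then have "(\<Prod>t\<in>J. indicator (B t) (Y x t)) = (indicator (Y -` A \<inter> space M) x :: complex)"
        using D x by (auto simp: indicator_def prod_zero_iff intro!: prod.neutral)
      then show "Z x * (\<Prod>t\<in>J. indicator (B t) (Y x t)) = indicat_real (Y -` A \<inter> space M) x *\<^sub>R Z x"
        by (auto split: split_indicator)
    qed
    finally show ?case by simp
  next
    case empty
    then show ?case by (simp add: set_lebesgue_integral_def)
  next
    case (compl A)
    then have A: "A \<in> sets C01" by (simp add: sets_C01_rectangles)
    then have [measurable]: "Y -` A \<inter> space M \<in> sets M" by simp
    have "Y -` (space C01 - A) \<inter> space M = space M - Y -` A \<inter> space M"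
      using measurable_space[OF Y] by auto
    moreover have "(CLINT x:(space M - (Y -` A \<inter> space M))|M. Z x) = (CLINT x|M. Z x - indicator (Y -` A \<inter> space M) x *\<^sub>R Z x)"
      unfolding set_lebesgue_integral_def by (intro Bochner_Integration.integral_cong) (auto split: split_indicator)
    moreover have "(CLINT x|M. Z x - indicator (Y -` A \<inter> space M) x *\<^sub>R Z x) = (CLINT x|M. Z x) - (CLINT x:(Y -` A \<inter> space M)|M. Z x)"
      unfolding set_lebesgue_integral_def using intZ[of "Y -` A \<inter> space M"] intZ[of "space M"]
      by (intro Bochner_Integration.integral_diff) (auto simp: set_integrable_def integrable_const_bound[where B=K] K)
    ultimately show ?case using compl.IH Z0 by simp
  next
    case (union A)
    then have A: "A i \<in> sets C01" for i by (auto simp: sets_C01_rectangles)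
    have eq: "Y -` (\<Union>i. A i) \<inter> space M = (\<Union>i. Y -` A i \<inter> space M)" by auto
    have "(CLINT x:(\<Union>i. Y -` A i \<inter> space M)|M. Z x) = (\<Sum>i. (CLINT x:(Y -` A i \<inter> space M)|M. Z x))"
    proof (rule lebesgue_integral_countable_add)
      show "set_integrable M (\<Union>i. Y -` A i \<inter> space M) Z"
        using A by (intro intZ) auto
      show "(Y -` A i \<inter> space M) \<inter> (Y -` A j \<inter> space M) = {}" if "i \<noteq> j" for i j
        using union(1) that by (auto simp: disjoint_family_on_def)
    qed (use A in auto)
    then show ?case using union.IH by (simp add: eq)
  qed
qed

section \<open>Pathwise Wiener integrals\<close>

definition step_integral :: "nat \<Rightarrow> (real \<Rightarrow> real) \<Rightarrow> (real \<Rightarrow> real) \<Rightarrow> real" where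
  "step_integral p u b = (\<Sum>i<2 ^ p. u (real i / 2 ^ p) * (b (real (Suc i) / 2 ^ p) - b (real i / 2 ^ p)))"

definition path_integral :: "(real \<Rightarrow> real) \<Rightarrow> (real \<Rightarrow> real) \<Rightarrow> real" where
  "path_integral u b = lim (\<lambda>p. step_integral p u b)"

text \<open>For these integrands the Wiener integral exists path by path, so that no stochastic integral is
  needed; the wavelets and the indicators of dyadic intervals are among them.\<close>

definition integrand :: "(real \<Rightarrow> real) \<Rightarrow> bool" where
  "integrand u \<longleftrightarrow> u \<in> borel_measurable borel \<and> (\<exists>B. \<forall>x. \<bar>u x\<bar> \<le> B) \<and>
     (\<forall>x\<in>{0..<1}. (\<lambda>p. u (dfloor p x)) \<longlonglongrightarrow> u x) \<and>
     (\<forall>b. continuous_on {0..1} b \<longrightarrow> convergent (\<lambda>p. step_integral p u b))"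

lemma step_integral_linear:
  "step_integral p (\<lambda>x. c * u x + v x) b = c * step_integral p u b + step_integral p v b"
  unfolding step_integral_def by (simp add: distrib_right sum.distrib sum_distrib_left mult.assoc)

lemma path_integral_LIMSEQ:
  "integrand u \<Longrightarrow> continuous_on {0..1} b \<Longrightarrow> (\<lambda>p. step_integral p u b) \<longlonglongrightarrow> path_integral u b"
  by (simp add: integrand_def path_integral_def convergent_LIMSEQ_iff)

lemma path_integral_linear:
  assumes "integrand u" "integrand v" "continuous_on {0..1} b"
  shows "path_integral (\<lambda>x. c * u x + v x) b = c * path_integral u b + path_integral v b"
proof -
  have "(\<lambda>p. step_integral p (\<lambda>x. c * u x + v x) b) \<longlonglongrightarrow> c * path_integral u b + path_integral v b"
    unfolding step_integral_linear by (intro tendsto_intros path_integral_LIMSEQ assms)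
  then show ?thesis unfolding path_integral_def by (rule limI)
qed

lemma integrand_linear:
  assumes u: "integrand u" and v: "integrand v"
  shows "integrand (\<lambda>x. c * u x + v x)"
  unfolding integrand_def
proof (intro conjI ballI allI impI)
  show "(\<lambda>x. c * u x + v x) \<in> borel_measurable borel" using u v by (auto simp: integrand_def)
  obtain B C where "\<And>x. \<bar>u x\<bar> \<le> B" "\<And>x. \<bar>v x\<bar> \<le> C" using u v by (auto simp: integrand_def)
  then have "\<bar>c * u x + v x\<bar> \<le> \<bar>c\<bar> * B + C" for x
    by (intro order_trans[OF abs_triangle_ineq] add_mono) (auto simp: abs_mult intro: mult_left_mono)
  then show "\<exists>B. \<forall>x. \<bar>c * u x + v x\<bar> \<le> B" by blast
  show "(\<lambda>p. c * u (dfloor p x) + v (dfloor p x)) \<longlonglongrightarrow> c * u x + v x" if "x \<in> {0..<1}" for x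
    using u v that by (intro tendsto_intros) (auto simp: integrand_def)
  show "convergent (\<lambda>p. step_integral p (\<lambda>x. c * u x + v x) b)" if "continuous_on {0..1} b" for b
    unfolding step_integral_linear using u v that
    by (intro convergent_add convergent_mult convergent_const) (auto simp: integrand_def)
qed

lemma integrand_zero: "integrand (\<lambda>_. 0)"
  by (auto simp: integrand_def step_integral_def convergent_const)

lemma step_integral_indicator:
  assumes "i \<le> 2 ^ p"
  shows "step_integral p (indicator {0..<real i / 2 ^ p}) b = b (real i / 2 ^ p) - b 0"
proof -
  have "step_integral p (indicator {0..<real i / 2 ^ p}) b =
     (\<Sum>j<2 ^ p. if j < i then b (real (Suc j) / 2 ^ p) - b (real j / 2 ^ p) else 0)"
    unfolding step_integral_def by (intro sum.cong) (auto simp: divide_less_cancel)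
  also have "\<dots> = (\<Sum>j<i. b (real (Suc j) / 2 ^ p) - b (real j / 2 ^ p))"
    by (rule sum.mono_neutral_cong_right) (use assms in auto)
  also have "\<dots> = b (real i / 2 ^ p) - b 0"
    using sum_lessThan_telescope[of "\<lambda>j. b (real j / 2 ^ p)" i] by simp
  finally show ?thesis .
qed

lemma unit_dyadic_eventually:
  assumes "t \<in> unit_dyadics"
  shows "\<exists>p0. \<forall>p\<ge>p0. \<exists>i\<le>2 ^ p. t = real i / 2 ^ p"
proof -
  obtain i p0 where t: "t = real i / 2 ^ p0" "i \<le> 2 ^ p0" using assms by (auto simp: unit_dyadics_def)
  have "\<exists>j\<le>2 ^ p. t = real j / 2 ^ p" if "p \<ge> p0" for p
  proof -
    have p: "(2::nat) ^ p = 2 ^ p0 * 2 ^ (p - p0)" using that by (simp add: power_add[symmetric])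
    have p': "(2::real) ^ p = 2 ^ p0 * 2 ^ (p - p0)" using that by (simp add: power_add[symmetric])
    show ?thesis using t by (intro exI[of _ "i * 2 ^ (p - p0)"]) (auto simp: p p')
  qed
  then show ?thesis by blast
qed

text \<open>As soon as \<open>t\<close> is a grid point the step integrals telescope and no longer
  change with \<open>p\<close>. These integrands turn a linear combination of values of a path at
  dyadic times into one path integral, on a par with those of the wavelets.\<close>

lemma
  assumes t: "t \<in> unit_dyadics"
  shows integrand_indicator: "integrand (indicator {0..<t})"
    and path_integral_indicator: "path_integral (indicator {0..<t}) b = b t - b 0"
proof -
  obtain p0 where p0: "\<And>p. p \<ge> p0 \<Longrightarrow> \<exists>i\<le>2 ^ p. t = real i / 2 ^ p"
    using unit_dyadic_eventually[OF t] by blast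
  have ev: "\<forall>\<^sub>F p in sequentially. step_integral p (indicator {0..<t}) b = b t - b 0" for b
    unfolding eventually_sequentially
    by (rule exI[of _ p0]) (use p0 step_integral_indicator in blast)
  have lim: "(\<lambda>p. step_integral p (indicator {0..<t}) b) \<longlonglongrightarrow> b t - b 0" for b
    by (rule tendsto_eventually[OF ev])
  then show "path_integral (indicator {0..<t}) b = b t - b 0" unfolding path_integral_def by (rule limI)
  have eq: "indicator {0..<t} (dfloor p x) = (indicator {0..<t} x :: real)" if x: "x \<in> {0..<1}" and p: "p \<ge> p0" for p x
  proof -
    obtain i where i: "t = real i / 2 ^ p" using p0[OF p] by blast
    have "dfloor p x < t \<longleftrightarrow> \<lfloor>2 ^ p * x\<rfloor> < int i" by (simp add: dfloor_def i divide_less_cancel) linarith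
    also have "\<dots> \<longleftrightarrow> x < t" by (simp add: i floor_less_iff field_simps)
    finally show ?thesis using dfloor_unit[of x p] x by (auto split: split_indicator)
  qed
  show "integrand (indicator {0..<t})"
    unfolding integrand_def
  proof (intro conjI ballI allI impI)
    show "\<exists>B. \<forall>x. \<bar>indicat_real {0..<t} x\<bar> \<le> B" by (rule exI[of _ 1]) (auto split: split_indicator)
    show "(\<lambda>p. indicator {0..<t} (dfloor p x)) \<longlonglongrightarrow> indicat_real {0..<t} x" if "x \<in> {0..<1}" for x
      by (rule tendsto_eventually) (auto simp: eventually_sequentially intro!: exI[of _ p0] eq that)
    show "convergent (\<lambda>p. step_integral p (indicator {0..<t}) b)" for b
      using lim by (auto simp: convergent_def)
  qed auto
qed

lemma integrand_sum:
  assumes "finite J" "\<And>j. j \<in> J \<Longrightarrow> integrand (u j)"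
  shows "integrand (\<lambda>x. \<Sum>j\<in>J. c j * u j x) \<and>
    (\<forall>b. continuous_on {0..1} b \<longrightarrow> path_integral (\<lambda>x. \<Sum>j\<in>J. c j * u j x) b = (\<Sum>j\<in>J. c j * path_integral (u j) b))"
  using assms
proof (induction J)
  case empty
  then show ?case by (auto simp: integrand_zero path_integral_def step_integral_def)
next
  case (insert j J)
  then show ?case
    using integrand_linear[of "u j" "\<lambda>x. \<Sum>j\<in>J. c j * u j x" "c j"]
      path_integral_linear[of "u j" "\<lambda>x. \<Sum>j\<in>J. c j * u j x" _ "c j"] by auto
qed

text \<open>Summation by parts moves the increments from the rough path \<open>b\<close> to
  \<open>u\<close>. What remains is a Riemann-Stieltjes sum of \<open>b\<close> against a Lipschitz
  integrator, and refining the grid changes it by at most \<open>L\<close> times the modulus of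
  continuity of \<open>b\<close>.\<close>

lemma step_integral_convergent_lipschitz:
  assumes u: "L-lipschitz_on {0..1} u" and b: "continuous_on {0..1} b"
  shows "convergent (\<lambda>p. step_integral p u b)"
proof -
  define s where "s p i = real i / 2 ^ p" for p i :: nat
  define J where "J p = (\<Sum>i<2 ^ p. b (s p (Suc i)) * (u (s p (Suc i)) - u (s p i)))" for p
  have s_unit: "s p i \<in> {0..1}" if "i \<le> 2 ^ p" for p i
    using that unit_dyadics_subset by (auto simp: s_def unit_dyadics_def)
  have s_mono: "s p i \<le> s p j" if "i \<le> j" for p i j
    using that unfolding s_def by (intro divide_right_mono) auto
  have s_Suc: "s p (Suc i) - s p i = 1 / 2 ^ p" for p i
    by (simp add: s_def field_simps)
  have L: "0 \<le> L" using u by (rule lipschitz_on_nonneg)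
  have abel: "step_integral p u b = u 1 * b 1 - u 0 * b 0 - J p" for p
  proof -
    have "step_integral p u b = (\<Sum>i<2 ^ p. (u (s p (Suc i)) * b (s p (Suc i)) - u (s p i) * b (s p i)) -
        b (s p (Suc i)) * (u (s p (Suc i)) - u (s p i)))"
      unfolding step_integral_def s_def by (intro sum.cong) (auto simp: algebra_simps)
    also have "\<dots> = (\<Sum>i<2 ^ p. (u (s p (Suc i)) * b (s p (Suc i)) - u (s p i) * b (s p i))) - J p"
      unfolding J_def by (rule sum_subtractf)
    also have "(\<Sum>i<2 ^ p. (u (s p (Suc i)) * b (s p (Suc i)) - u (s p i) * b (s p i))) = u 1 * b 1 - u 0 * b 0"
      using sum_lessThan_telescope[of "\<lambda>i. u (s p i) * b (s p i)" "2 ^ p"] by (simp add: s_def)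
    finally show ?thesis .
  qed
  have diff: "\<bar>J q - J p\<bar> \<le> L * w"
    if pq: "p \<le> q" and w: "\<And>x y. x \<in> {0..1} \<Longrightarrow> y \<in> {0..1} \<Longrightarrow> \<bar>x - y\<bar> \<le> 1 / 2 ^ p \<Longrightarrow> \<bar>b x - b y\<bar> \<le> w" for p q w
  proof -
    \<comment> \<open>Each cell of grid \<open>p\<close> splits into \<open>k\<close> cells of grid
      \<open>q\<close>; writing both sums over the fine cells leaves only values of \<open>b\<close>
      within one coarse cell to be compared.\<close>
    define k where "k = (2::nat) ^ (q - p)"
    have k: "(2::nat) ^ q = 2 ^ p * k" "k > 0" using pq by (auto simp: k_def power_add[symmetric])
    have kr: "(2::real) ^ q = 2 ^ p * real k" using k(1) by (metis of_nat_mult of_nat_numeral of_nat_power)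
    have sk: "s q (i * k) = s p i" for i using k(2) by (simp add: s_def kr)
    have sk': "s q (i * k + k) = s p (Suc i)" for i
      using sk[of "Suc i"] by (simp only: mult_Suc add.commute)
    have Jq: "J q = (\<Sum>i<2 ^ p. \<Sum>j=i * k..<i * k + k. b (s q (Suc j)) * (u (s q (Suc j)) - u (s q j)))"
      unfolding J_def k(1) by (rule sum.nat_group[symmetric])
    have Jp: "J p = (\<Sum>i<2 ^ p. \<Sum>j=i * k..<i * k + k. b (s p (Suc i)) * (u (s q (Suc j)) - u (s q j)))"
      unfolding J_def
    proof (intro sum.cong refl)
      fix i
      have "(\<Sum>j=i * k..<i * k + k. u (s q (Suc j)) - u (s q j)) = u (s q (i * k + k)) - u (s q (i * k))"
        by (rule sum_Suc_diff') simp
      then have "(\<Sum>j=i * k..<i * k + k. u (s q (Suc j)) - u (s q j)) = u (s p (Suc i)) - u (s p i)"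
        by (simp only: sk sk')
      then show "b (s p (Suc i)) * (u (s p (Suc i)) - u (s p i)) =
          (\<Sum>j=i * k..<i * k + k. b (s p (Suc i)) * (u (s q (Suc j)) - u (s q j)))"
        by (simp only: sum_distrib_left[symmetric])
    qed
    have eq: "J q - J p = (\<Sum>i<2 ^ p. \<Sum>j=i * k..<i * k + k. (b (s q (Suc j)) - b (s p (Suc i))) * (u (s q (Suc j)) - u (s q j)))"
      unfolding Jq Jp sum_subtractf[symmetric] by (simp add: algebra_simps)
    have "\<bar>J q - J p\<bar> \<le> (\<Sum>i<2 ^ p. \<Sum>j=i * k..<i * k + k. w * (L / 2 ^ q))"
      unfolding eq
    proof (intro order_trans[OF sum_abs] sum_mono)
      fix i j assume i: "i \<in> {..<(2::nat) ^ p}" and j: "j \<in> {i * k..<i * k + k}"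
      have "i * k + k \<le> 2 ^ p * k" using i by (metis Suc_leI add.commute lessThan_iff mult_Suc mult_le_mono1)
      then have j2: "Suc j \<le> 2 ^ q" using j k(1) by simp
      have "s q (Suc j) \<le> s q (i * k + k)" by (rule s_mono) (use j in simp)
      moreover have "s q (i * k) \<le> s q (Suc j)" by (rule s_mono) (use j in simp)
      ultimately have "\<bar>s q (Suc j) - s p (Suc i)\<bar> \<le> 1 / 2 ^ p"
        using s_Suc[of p i] unfolding sk sk' by linarith
      then have 1: "\<bar>b (s q (Suc j)) - b (s p (Suc i))\<bar> \<le> w"
        using i j2 by (intro w s_unit) auto
      have 2: "\<bar>u (s q (Suc j)) - u (s q j)\<bar> \<le> L / 2 ^ q"
        using lipschitz_onD[OF u s_unit[of "Suc j" q] s_unit[of j q]] j2 by (simp add: dist_real_def s_Suc)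
      show "\<bar>(b (s q (Suc j)) - b (s p (Suc i))) * (u (s q (Suc j)) - u (s q j))\<bar> \<le> w * (L / 2 ^ q)"
        unfolding abs_mult by (rule mult_mono[OF 1 2]) (use 1 in auto)
    qed
    also have "\<dots> = 2 ^ p * (real k * (w * (L / 2 ^ q)))"
      by (simp only: sum_constant card_lessThan card_atLeastLessThan add_diff_cancel_left' of_nat_power of_nat_numeral)
    also have "\<dots> = L * w * ((2 ^ p * real k) / 2 ^ q)"
      unfolding times_divide_eq_right by (simp only: mult_ac)
    also have "\<dots> = L * w" unfolding kr[symmetric] by simp
    finally show ?thesis .
  qed
  have "Cauchy J"
  proof (rule metric_CauchyI)
    fix e :: real assume e: "e > 0"
    have "uniformly_continuous_on {0..1} b" by (rule compact_uniformly_continuous[OF b]) simp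
    moreover have e': "0 < e / (2 * (L + 1))" using e L by simp
    ultimately obtain d where d: "d > 0" "\<And>x y. x \<in> {0..1} \<Longrightarrow> y \<in> {0..1} \<Longrightarrow> dist y x < d \<Longrightarrow> dist (b y) (b x) < e / (2 * (L + 1))"
      unfolding uniformly_continuous_on_def using e' by blast
    obtain p where p: "(1 / 2) ^ p < d" using real_arch_pow_inv[OF d(1)] by force
    have *: "\<bar>J q - J p\<bar> < e / 2" if "q \<ge> p" for q
    proof -
      have "\<bar>J q - J p\<bar> \<le> L * (e / (2 * (L + 1)))"
        using p d(2) by (intro diff that) (force simp: dist_real_def power_one_over intro: less_imp_le)
      also have "\<dots> < e / 2" using e L by (simp add: field_simps)
      finally show ?thesis .
    qed
    show "\<exists>M. \<forall>m\<ge>M. \<forall>n\<ge>M. dist (J m) (J n) < e"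
    proof (intro exI[of _ p] allI impI)
      fix m n assume "m \<ge> p" "n \<ge> p"
      then show "dist (J m) (J n) < e" using *[of m] *[of n] unfolding dist_real_def by linarith
    qed
  qed
  then have "convergent J" by (rule Cauchy_convergent)
  from convergent_diff[OF convergent_const this] show ?thesis by (simp only: abel)
qed

lemma integrand_lipschitz:
  assumes u: "L-lipschitz_on {0..1} u"
  shows "integrand (\<lambda>x. indicator {0..1} x * u x)" (is "integrand ?u")
  unfolding integrand_def
proof (intro conjI ballI allI impI)
  have c: "continuous_on {0..1} u" by (rule lipschitz_on_continuous_on[OF u])
  show "?u \<in> borel_measurable borel"
    using borel_measurable_continuous_on_indicator[OF _ c] by simp
  obtain B where "\<forall>x\<in>{0..1}. \<bar>u x\<bar> \<le> B"
    using compact_imp_bounded[OF compact_continuous_image[OF c]] by (auto simp: bounded_iff)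
  then have "\<bar>?u x\<bar> \<le> \<bar>B\<bar>" for x by (force split: split_indicator)
  then show "\<exists>B. \<forall>x. \<bar>?u x\<bar> \<le> B" by blast
  show "(\<lambda>p. ?u (dfloor p x)) \<longlonglongrightarrow> ?u x" if "x \<in> {0..<1}" for x
  proof -
    have x: "x \<in> {0..1}" using that by simp
    have "(\<lambda>p. u (dfloor p x)) \<longlonglongrightarrow> u x"
      by (intro continuous_on_tendsto_compose[OF c dfloor_tendsto] x always_eventually allI dfloor_unit)
    then show ?thesis using dfloor_unit[OF x] x by simp
  qed
  show "convergent (\<lambda>p. step_integral p ?u b)" if "continuous_on {0..1} b" for b
  proof -
    have "real i / 2 ^ p \<in> {0..1}" if "i < 2 ^ p" for i p
      using that less_imp_le[OF that] unit_dyadics_subset by (auto simp: unit_dyadics_def)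
    then have "step_integral p ?u b = step_integral p u b" for p
      unfolding step_integral_def by (intro sum.cong) auto
    then show ?thesis using step_integral_convergent_lipschitz[OF u that] by simp
  qed
qed

lemma primitive_diff:
  fixes f :: "real \<Rightarrow> real"
  assumes f: "continuous_on {0..1} f" and "0 \<le> s" "s \<le> t" "t \<le> 1"
  shows "(LINT x:{0..t}|lborel. f x) - (LINT x:{0..s}|lborel. f x) = (LINT x:{s..<t}|lborel. f x)"
proof -
  have int: "set_integrable lborel A f" if "A \<subseteq> {0..1}" "A \<in> sets borel" for A
    by (rule set_integrable_subset[OF borel_integrable_atLeastAtMost'[OF f]]) (use that in auto)
  have open_right: "(LINT x:{0..r}|lborel. f x) = (LINT x:{0..<r}|lborel. f x)" if r: "r \<le> 1" for r
    unfolding set_lebesgue_integral_def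
  proof (rule integral_cong_AE)
    show "(\<lambda>x. indicator {0..r} x *\<^sub>R f x) \<in> borel_measurable lborel" "(\<lambda>x. indicator {0..<r} x *\<^sub>R f x) \<in> borel_measurable lborel"
      using int[of "{0..r}"] int[of "{0..<r}"] atLeastLessThan_subseteq_atLeastAtMost_iff[of 0 r 0 "1::real"] r by (auto simp: set_integrable_def dest: borel_measurable_integrable)
    have "AE x in lborel. x \<noteq> r" by (rule AE_lborel_singleton)
    then show "AE x in lborel. indicator {0..r} x *\<^sub>R f x = indicator {0..<r} x *\<^sub>R f x"
      by eventually_elim (auto split: split_indicator)
  qed
  moreover have "(LINT x:{0..<s} \<union> {s..<t}|lborel. f x) = (LINT x:{0..<s}|lborel. f x) + (LINT x:{s..<t}|lborel. f x)"
    by (intro set_integral_Un int) (use assms in auto)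
  moreover have "{0..<s} \<union> {s..<t} = {0..<t}" using assms by auto
  ultimately show ?thesis using assms by (simp add: open_right)
qed

text \<open>Against a primitive the step integral equals the integral of
  \<open>f x * u (dfloor p x)\<close>, and dominated convergence applies. This serves twice: for the
  drift of the observation, and with \<open>f = 1\<close> for the Riemann sums that give the
  variance of a Wiener integral.\<close>

lemma step_integral_primitive:
  fixes f :: "real \<Rightarrow> real"
  assumes f: "continuous_on {0..1} f" and u: "u \<in> borel_measurable borel" "\<And>x. \<bar>u x\<bar> \<le> B"
    and lim: "\<And>x. x \<in> {0..<1} \<Longrightarrow> (\<lambda>p. u (dfloor p x)) \<longlonglongrightarrow> u x"
  shows "(\<lambda>p. step_integral p u (\<lambda>t. LINT x:{0..t}|lborel. f x)) \<longlonglongrightarrow> (LINT x:{0..1}|lborel. f x * u x)"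
proof -
  have fi: "set_integrable lborel {0..1} f" by (rule borel_integrable_atLeastAtMost'[OF f])
  then have fm[measurable]: "(\<lambda>x. indicator {0..1} x * f x) \<in> borel_measurable lborel"
    unfolding set_integrable_def by (auto dest: borel_measurable_integrable)
  have dm[measurable]: "dfloor p \<in> borel_measurable borel" for p unfolding dfloor_def by measurable
  have um[measurable]: "(\<lambda>x. u (dfloor p x)) \<in> borel_measurable borel" for p by (rule measurable_compose[OF dm u(1)])
  have eq: "step_integral p u (\<lambda>t. LINT x:{0..t}|lborel. f x) = (LINT x:{0..1}|lborel. f x * u (dfloor p x))" for p
  proof -
    let ?I = "\<lambda>i. {real i / 2 ^ p..<real (Suc i) / 2 ^ p}"
    have sub: "?I i \<subseteq> {0..1}" if "i < 2 ^ p" for i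
    proof -
      have "real (Suc i) / 2 ^ p \<in> unit_dyadics" using Suc_leI[OF that] unfolding unit_dyadics_def by blast
      then have "real (Suc i) / 2 ^ p \<in> {0..1}" using unit_dyadics_subset by blast
      moreover have "0 \<le> real i / 2 ^ p" by simp
      ultimately have h: "0 \<le> real i / 2 ^ p" "real (Suc i) / 2 ^ p \<le> 1" unfolding atLeastAtMost_iff by auto
      show ?thesis
      proof
        fix x assume "x \<in> ?I i"
        then have "real i / 2 ^ p \<le> x \<and> x < real (Suc i) / 2 ^ p" by (simp only: atLeastLessThan_iff)
        then show "x \<in> {0..1}" using h unfolding atLeastAtMost_iff by linarith
      qed
    qed
    have i: "set_integrable lborel (?I i) f" if "i < 2 ^ p" for i
      by (rule set_integrable_subset[OF fi]) (use sub[OF that] in auto)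
    have "step_integral p u (\<lambda>t. LINT x:{0..t}|lborel. f x) = (\<Sum>i<2 ^ p. u (real i / 2 ^ p) * (LINT x:?I i|lborel. f x))"
      unfolding step_integral_def
    proof (intro sum.cong refl arg_cong2[where f="(*)"])
      fix i :: nat assume "i \<in> {..<2 ^ p}"
      then have "Suc i \<le> 2 ^ p" by simp
      then have "real (Suc i) / 2 ^ p \<in> unit_dyadics" unfolding unit_dyadics_def by blast
      then have "real (Suc i) / 2 ^ p \<in> {0..1}" using unit_dyadics_subset by blast
      then show "(LINT x:{0..real (Suc i) / 2 ^ p}|lborel. f x) - (LINT x:{0..real i / 2 ^ p}|lborel. f x) = (LINT x:?I i|lborel. f x)"
        unfolding atLeastAtMost_iff by (intro primitive_diff[OF f]) (auto intro!: divide_right_mono)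
    qed
    also have "\<dots> = (LINT x|lborel. (\<Sum>i<2 ^ p. u (real i / 2 ^ p) * (indicator (?I i) x *\<^sub>R f x)))"
      using i by (subst Bochner_Integration.integral_sum) (auto simp: set_integrable_def set_lebesgue_integral_def)
    also have "\<dots> = (LINT x:{0..1}|lborel. f x * u (dfloor p x))"
      unfolding set_lebesgue_integral_def
    proof (rule integral_cong_AE)
      \<comment> \<open>The point 1 lies in none of the cells with index below \<open>2 ^ p\<close>;
        it is a null set.\<close>
      have "AE x in lborel. x \<noteq> (1::real)" by (rule AE_lborel_singleton)
      then show "AE x in lborel. (\<Sum>i<2 ^ p. u (real i / 2 ^ p) * (indicator (?I i) x *\<^sub>R f x)) = indicator {0..1} x *\<^sub>R (f x * u (dfloor p x))"
      proof eventually_elim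
        fix x :: real assume x: "x \<noteq> 1"
        show "(\<Sum>i<2 ^ p. u (real i / 2 ^ p) * (indicator (?I i) x *\<^sub>R f x)) = indicator {0..1} x *\<^sub>R (f x * u (dfloor p x))"
        proof (cases "x \<in> {0..1}")
          case True
          have 0: "indicator (?I (2 ^ p)) x = (0::real)" using True x by simp
          have "u (dfloor p x) = (\<Sum>i\<le>2 ^ p. u (real i / 2 ^ p) * indicator (?I i) x)"
            using dfloor_step_sum[OF True, of u p] by (simp add: add.commute)
          also have "\<dots> = (\<Sum>i<2 ^ p. u (real i / 2 ^ p) * indicator (?I i) x)"
            unfolding lessThan_Suc_atMost[symmetric] sum.lessThan_Suc 0 by simp
          finally have 1: "u (dfloor p x) = (\<Sum>i<2 ^ p. u (real i / 2 ^ p) * indicator (?I i) x)" .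
          have "indicator {0..1} x *\<^sub>R (f x * u (dfloor p x)) = u (dfloor p x) * f x" using True by simp
          also have "\<dots> = (\<Sum>i<2 ^ p. u (real i / 2 ^ p) * (indicator (?I i) x *\<^sub>R f x))"
            unfolding 1 sum_distrib_right real_scaleR_def mult.assoc ..
          finally show ?thesis by (rule sym)
        next
          case False
          then have "indicator (?I i) x = (0::real)" if "i \<in> {..<2 ^ p}" for i
            using sub[of i] that unfolding indicator_eq_0_iff by blast
          then have "(\<Sum>i<2 ^ p. u (real i / 2 ^ p) * (indicator (?I i) x *\<^sub>R f x)) = 0"
            by (intro sum.neutral ballI) (simp only: mult_zero_right scale_zero_left)
          then show ?thesis using False by simp
        qed
      qed
      have "(\<lambda>x. indicator (?I i) x *\<^sub>R f x) \<in> borel_measurable lborel" if "i \<in> {..<2 ^ p}" for i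
        using i that unfolding set_integrable_def by (auto dest: borel_measurable_integrable)
      then show "(\<lambda>x. \<Sum>i<2 ^ p. u (real i / 2 ^ p) * (indicator (?I i) x *\<^sub>R f x)) \<in> borel_measurable lborel"
        by (intro borel_measurable_sum borel_measurable_times) auto
      have "(\<lambda>x. (indicator {0..1} x * f x) * u (dfloor p x)) \<in> borel_measurable lborel" by measurable
      then show "(\<lambda>x. indicator {0..1} x *\<^sub>R (f x * u (dfloor p x))) \<in> borel_measurable lborel"
        by (simp add: mult.assoc)
    qed
    finally show ?thesis .
  qed
  show ?thesis
    unfolding eq
    unfolding set_lebesgue_integral_def
  proof (rule integral_dominated_convergence)
    show "integrable lborel (\<lambda>x. B * (indicator {0..1} x *\<^sub>R \<bar>f x\<bar>))"
      using set_integrable_abs[OF fi] unfolding set_integrable_def by simp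
    have "AE x in lborel. x \<noteq> (1::real)" by (rule AE_lborel_singleton)
    then show "AE x in lborel. (\<lambda>p. indicator {0..1} x *\<^sub>R (f x * u (dfloor p x))) \<longlonglongrightarrow> indicator {0..1} x *\<^sub>R (f x * u x)"
      by eventually_elim (auto split: split_indicator intro!: tendsto_intros lim)
    show "AE x in lborel. norm (indicator {0..1} x *\<^sub>R (f x * u (dfloor p x))) \<le> B * (indicator {0..1} x *\<^sub>R \<bar>f x\<bar>)" for p
      using u(2) by (intro AE_I2) (auto split: split_indicator simp: abs_mult mult.commute[of B] intro!: mult_left_mono)
    have "(\<lambda>x. (indicator {0..1} x * f x) * u (dfloor p x)) \<in> borel_measurable lborel" for p by measurable
    then show "(\<lambda>x. indicator {0..1} x *\<^sub>R (f x * u (dfloor p x))) \<in> borel_measurable lborel" for p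
      by (simp add: mult.assoc)
    have "(\<lambda>x. (indicator {0..1} x * f x) * u x) \<in> borel_measurable lborel" using u(1) by measurable
    then show "(\<lambda>x. indicator {0..1} x *\<^sub>R (f x * u x)) \<in> borel_measurable lborel" by (simp add: mult.assoc)
  qed
qed

lemma path_integral_observation:
  assumes u: "integrand u" and f: "continuous_on {0..1} f" and b: "continuous_on {0..1} b"
  shows "path_integral u (observation n f b) = (LINT x:{0..1}|lborel. f x * u x) + path_integral u b / sqrt (real n)"
proof -
  obtain B where B: "\<And>x. \<bar>u x\<bar> \<le> B" using u by (auto simp: integrand_def)
  have unit: "real i / 2 ^ p \<in> {0..1}" if "i \<le> 2 ^ p" for i p
    using that unit_dyadics_subset unfolding unit_dyadics_def by blast
  have "step_integral p u (observation n f b) =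
      step_integral p u (\<lambda>t. LINT x:{0..t}|lborel. f x) + step_integral p u b / sqrt (real n)" for p
    unfolding step_integral_def sum_divide_distrib sum.distrib[symmetric]
  proof (intro sum.cong refl)
    fix i :: nat assume i: "i \<in> {..<2 ^ p}"
    have 1: "real i / 2 ^ p \<in> {0..1}" using i by (intro unit) auto
    have 2: "real (Suc i) / 2 ^ p \<in> {0..1}" using i by (intro unit) auto
    show "u (real i / 2 ^ p) * (observation n f b (real (Suc i) / 2 ^ p) - observation n f b (real i / 2 ^ p)) =
         u (real i / 2 ^ p) * ((LBINT x:{0..real (Suc i) / 2 ^ p}. f x) - (LBINT x:{0..real i / 2 ^ p}. f x)) +
         u (real i / 2 ^ p) * (b (real (Suc i) / 2 ^ p) - b (real i / 2 ^ p)) / sqrt (real n)"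
      using 1 2 unfolding observation_def by (simp add: diff_divide_distrib algebra_simps del: of_nat_Suc)
  qed
  moreover have "(\<lambda>p. step_integral p u (\<lambda>t. LINT x:{0..t}|lborel. f x) + step_integral p u b / sqrt (real n))
      \<longlonglongrightarrow> (LINT x:{0..1}|lborel. f x * u x) + path_integral u b * inverse (sqrt (real n))"
    unfolding divide_inverse
    by (intro tendsto_add tendsto_mult_right step_integral_primitive[OF f _ B] path_integral_LIMSEQ u b)
      (use u in \<open>auto simp: integrand_def\<close>)
  ultimately show ?thesis unfolding path_integral_def divide_inverse by (intro limI) simp
qed

lemma path_integral_measurable:
  assumes "integrand u"
  shows "path_integral u \<in> borel_measurable C01"
proof (rule borel_measurable_LIMSEQ_real)
  show "(\<lambda>b. step_integral p u b) \<in> borel_measurable C01" for p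
  proof -
    have unit: "real i / 2 ^ p \<in> {0..1}" if "i \<le> 2 ^ p" for i
      using that unit_dyadics_subset unfolding unit_dyadics_def by blast
    have [measurable]: "(\<lambda>b. b (real i / 2 ^ p)) \<in> borel_measurable C01" "(\<lambda>b. b (real (Suc i) / 2 ^ p)) \<in> borel_measurable C01"
      if "i \<in> {..<2 ^ p}" for i
      using that by (intro C01_eval unit; simp)+
    show ?thesis unfolding step_integral_def by measurable
  qed
  show "(\<lambda>p. step_integral p u b) \<longlonglongrightarrow> path_integral u b" if "b \<in> space C01" for b
    using that by (intro path_integral_LIMSEQ assms C01_continuous)
qed

section \<open>Path integrals under Wiener measure\<close>

lemma wiener_properties:
  assumes "wiener_measure W"
  shows "prob_space W" "sets W = sets C01" "space W = space C01" "AE b in W. b 0 = 0"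
    "prob_space.indep_vars W (\<lambda>_. borel) (\<lambda>i b. b (real (Suc i) / 2 ^ p) - b (real i / 2 ^ p)) {..<2 ^ p}"
    "\<And>i. i < 2 ^ p \<Longrightarrow> distributed W lborel (\<lambda>b. b (real (Suc i) / 2 ^ p) - b (real i / 2 ^ p)) (normal_density 0 (sqrt (1 / 2 ^ p)))"
proof -
  note W = assms[unfolded wiener_measure_def]
  show "prob_space W" "sets W = sets C01" "AE b in W. b 0 = 0" using W by auto
  then show "space W = space C01" by (intro sets_eq_imp_space_eq) auto
  show "prob_space.indep_vars W (\<lambda>_. borel) (\<lambda>i b. b (real (Suc i) / 2 ^ p) - b (real i / 2 ^ p)) {..<2 ^ p}"
    using W[THEN conjunct2, THEN conjunct2, THEN conjunct2, THEN conjunct2, rule_format, of "\<lambda>i. real i / 2 ^ p" "2 ^ p"]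
    by (simp add: divide_strict_right_mono)
  fix i :: nat assume i: "i < 2 ^ p"
  have "real (Suc i) / 2 ^ p \<in> unit_dyadics" using Suc_leI[OF i] unfolding unit_dyadics_def by blast
  then have "real (Suc i) / 2 ^ p \<in> {0..1}" using unit_dyadics_subset by blast
  moreover have "real (Suc i) / 2 ^ p - real i / 2 ^ p = 1 / 2 ^ p" by (simp add: diff_divide_distrib[symmetric])
  ultimately show "distributed W lborel (\<lambda>b. b (real (Suc i) / 2 ^ p) - b (real i / 2 ^ p)) (normal_density 0 (sqrt (1 / 2 ^ p)))"
    using W[THEN conjunct2, THEN conjunct2, THEN conjunct2, THEN conjunct1, rule_format, of "real i / 2 ^ p" "real (Suc i) / 2 ^ p"]
    by (simp add: divide_strict_right_mono)
qed

text \<open>Independent increments factorize the characteristic function. The variance is a Riemann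
  sum of \<open>(u x)\<^sup>2\<close>, written as a step integral against the identity path so that
  its limit is an instance of \<open>step_integral_primitive\<close>.\<close>

lemma wiener_char_step:
  assumes W: "wiener_measure W"
  shows "(CLINT b|W. iexp (s * step_integral p u b)) = exp (- (s\<^sup>2 / 2) * step_integral p (\<lambda>x. (u x)\<^sup>2) (\<lambda>t. t))"
proof -
  interpret prob_space W by (rule wiener_properties[OF W])
  let ?D = "\<lambda>i b. b (real (Suc i) / 2 ^ p) - b (real i / 2 ^ p) :: real"
  have [measurable]: "?D i \<in> borel_measurable W" if "i < 2 ^ p" for i
    using wiener_properties(6)[OF W that] by (auto simp: distributed_def)
  have c: "char (distr W borel (\<lambda>b. u (real i / 2 ^ p) * ?D i b)) s = exp (- (s\<^sup>2 / 2) * ((u (real i / 2 ^ p))\<^sup>2 * (1 / 2 ^ p)))"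
    if i: "i < 2 ^ p" for i
  proof -
    have D: "?D i \<in> borel_measurable W" using wiener_properties(6)[OF W i] by (auto simp: distributed_def)
    have "distr W borel (?D i) = density lborel (normal_density 0 (sqrt (1 / 2 ^ p)))"
    proof -
      have "distr W lborel (?D i) = density lborel (normal_density 0 (sqrt (1 / 2 ^ p)))"
        using wiener_properties(6)[OF W i] by (simp add: distributed_def)
      moreover have "distr W borel (?D i) = distr W lborel (?D i)" by (rule distr_cong) auto
      ultimately show ?thesis by simp
    qed
    then have "char (distr W borel (?D i)) (s * u (real i / 2 ^ p)) = exp (- ((sqrt (1 / 2 ^ p))\<^sup>2 * (s * u (real i / 2 ^ p))\<^sup>2 / 2))"
      by (simp only:) (rule char_normal_density, simp)
    moreover have "char (distr W borel (?D i)) (s * u (real i / 2 ^ p)) = char (distr W borel (\<lambda>b. u (real i / 2 ^ p) * ?D i b)) s"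
      unfolding char_def using D by (simp add: integral_distr mult_ac)
    ultimately show ?thesis by (simp add: power_mult_distrib mult_ac)
  qed
  have ind: "indep_vars (\<lambda>_. borel) (\<lambda>i b. u (real i / 2 ^ p) * ?D i b) {..<2 ^ p}"
    by (rule indep_vars_compose2[OF wiener_properties(5)[OF W]]) simp
  have m: "(\<lambda>b. step_integral p u b) \<in> borel_measurable W" unfolding step_integral_def
    using wiener_properties(6)[OF W] by (intro borel_measurable_sum borel_measurable_times) (auto simp: distributed_def)
  have "(CLINT b|W. iexp (s * step_integral p u b)) = char (distr W borel (\<lambda>b. \<Sum>i<2 ^ p. u (real i / 2 ^ p) * ?D i b)) s"
    unfolding char_def using m by (subst integral_distr) (auto simp: step_integral_def)
  also have "\<dots> = (\<Prod>i<2 ^ p. char (distr W borel (\<lambda>b. u (real i / 2 ^ p) * ?D i b)) s)"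
    by (rule char_distr_sum[OF ind])
  also have "\<dots> = (\<Prod>i<2 ^ p. complex_of_real (exp (- (s\<^sup>2 / 2) * ((u (real i / 2 ^ p))\<^sup>2 * (1 / 2 ^ p)))))"
    by (intro prod.cong refl c) simp
  also have "\<dots> = complex_of_real (exp (- (s\<^sup>2 / 2) * (\<Sum>i<2 ^ p. (u (real i / 2 ^ p))\<^sup>2 * (1 / 2 ^ p))))"
    unfolding of_real_prod[symmetric] exp_sum[OF finite_lessThan, symmetric] sum_distrib_left ..
  also have "(\<Sum>i<2 ^ p. (u (real i / 2 ^ p))\<^sup>2 * (1 / 2 ^ p)) = step_integral p (\<lambda>x. (u x)\<^sup>2) (\<lambda>t. t)"
    unfolding step_integral_def by (intro sum.cong refl) (simp add: diff_divide_distrib[symmetric])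
  finally show ?thesis .
qed

text \<open>Both sides are limits of the step versions as the grid is refined, on the left by
  dominated convergence. So the pathwise integral is centred normal with variance the squared
  \<open>L2\<close> norm of \<open>u\<close>, the Wiener isometry.\<close>

lemma wiener_char:
  assumes W: "wiener_measure W" and u: "integrand u"
  shows "(CLINT b|W. iexp (s * path_integral u b)) = exp (- (s\<^sup>2 / 2) * (LINT x:{0..1}|lborel. (u x)\<^sup>2))"
proof -
  interpret prob_space W by (rule wiener_properties[OF W])
  note sp = wiener_properties(2,3)[OF W]
  have unit: "real i / 2 ^ p \<in> {0..1}" if "i \<le> 2 ^ p" for i p
    using that unit_dyadics_subset unfolding unit_dyadics_def by blast
  obtain B where B: "\<And>x. \<bar>u x\<bar> \<le> B" using u by (auto simp: integrand_def)
  have B2: "\<bar>(u x)\<^sup>2\<bar> \<le> B\<^sup>2" for x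
    using B[of x] by (simp add: abs_le_square_iff[symmetric]) 
  have m: "(\<lambda>b. step_integral p u b) \<in> borel_measurable W" for p unfolding step_integral_def
    using wiener_properties(6)[OF W] by (intro borel_measurable_sum borel_measurable_times) (auto simp: distributed_def)
  have [measurable]: "path_integral u \<in> borel_measurable W"
    using path_integral_measurable[OF u] by (simp cong: measurable_cong_sets add: measurable_cong_sets[OF sp(1) refl])
  have "(\<lambda>p. CLINT b|W. iexp (s * step_integral p u b)) \<longlonglongrightarrow> (CLINT b|W. iexp (s * path_integral u b))"
  proof (rule integral_dominated_convergence[where w="\<lambda>_. 1"])
    show "AE b in W. (\<lambda>p. iexp (s * step_integral p u b)) \<longlonglongrightarrow> iexp (s * path_integral u b)"
      using sp by (intro AE_I2 tendsto_intros path_integral_LIMSEQ u C01_continuous) simp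
  qed (use m in auto)
  moreover have "(\<lambda>p. CLINT b|W. iexp (s * step_integral p u b)) \<longlonglongrightarrow> exp (- (s\<^sup>2 / 2) * (LINT x:{0..1}|lborel. (u x)\<^sup>2))"
  proof -
    have "(\<lambda>p. step_integral p (\<lambda>x. (u x)\<^sup>2) (\<lambda>t. LINT x:{0..t}|lborel. 1)) \<longlonglongrightarrow> (LINT x:{0..1}|lborel. 1 * (u x)\<^sup>2)"
      by (intro step_integral_primitive[OF _ _ B2]) (use u in \<open>auto simp: integrand_def intro!: tendsto_intros\<close>)
    moreover have "step_integral p (\<lambda>x. (u x)\<^sup>2) (\<lambda>t. LINT x:{0..t}|lborel. 1) = step_integral p (\<lambda>x. (u x)\<^sup>2) (\<lambda>t. t)" for p
    proof -
      have one: "(LINT x:{0..t}|lborel. 1) = t" if "t \<ge> 0" for t :: real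
        using that by (simp add: set_lebesgue_integral_def)
      show ?thesis unfolding step_integral_def by (intro sum.cong refl) (simp add: one del: of_nat_Suc)
    qed
    ultimately have "(\<lambda>p. step_integral p (\<lambda>x. (u x)\<^sup>2) (\<lambda>t. t)) \<longlonglongrightarrow> (LINT x:{0..1}|lborel. (u x)\<^sup>2)" by simp
    then show ?thesis unfolding wiener_char_step[OF W] by (intro tendsto_intros)
  qed
  ultimately show ?thesis by (rule LIMSEQ_unique)
qed

section \<open>Mutual absolute continuity of the observation laws\<close>

text \<open>Induction over the generated sigma-algebra. One set \<open>E\<close> has to approximate
  \<open>D\<close> under both measures at once, since absolute continuity compares the two laws on
  the same cylinder.\<close>

lemma (in finite_measure) approx_by_algebra:
  assumes N: "finite_measure N" "sets N = sets M"
    and alg: "algebra \<Omega> \<A>" and M: "sets M = sigma_sets \<Omega> \<A>" and D: "D \<in> sets M" and "e > 0"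
  shows "\<exists>E\<in>\<A>. measure M ((D - E) \<union> (E - D)) < e \<and> measure N ((D - E) \<union> (E - D)) < e"
proof -
  interpret N: finite_measure N by fact
  interpret alg: algebra \<Omega> \<A> by fact
  have sub: "\<A> \<subseteq> sets M" unfolding M by auto
  have sp: "space M = \<Omega>" "space N = \<Omega>"
  proof -
    have "\<Union>(sets M) = \<Omega>" unfolding M using sigma_sets_into_sp[OF alg.space_closed] sigma_sets_top by blast
    moreover have "\<Union>(sets M) = space M" using sets.sets_into_space by blast
    ultimately show "space M = \<Omega>" by simp
    then show "space N = \<Omega>" using sets_eq_imp_space_eq[OF N(2)] by simp
  qed
  from D have "D \<in> sigma_sets \<Omega> \<A>" by (simp add: M)
  then show ?thesis using \<open>e > 0\<close>
  proof (induction arbitrary: e)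
    case (Basic D)
    then show ?case by (intro bexI[of _ D]) auto
  next
    case Empty
    then show ?case by (intro bexI[of _ "{}"]) auto
  next
    case (Compl D)
    then obtain E where E: "E \<in> \<A>" "measure M ((D - E) \<union> (E - D)) < e" "measure N ((D - E) \<union> (E - D)) < e" by blast
    have "D \<subseteq> \<Omega>" using Compl(1) sigma_sets_into_sp[OF alg.space_closed] by blast
    moreover have "E \<subseteq> \<Omega>" using E alg.space_closed by blast
    ultimately have "((\<Omega> - D) - (\<Omega> - E)) \<union> ((\<Omega> - E) - (\<Omega> - D)) = (D - E) \<union> (E - D)" by blast
    then show ?case using E by (intro bexI[of _ "\<Omega> - E"]) auto
  next
    case (Union A)
    have A: "A i \<in> sets M" "A i \<in> sets N" for i using Union(1) by (auto simp: M N(2))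
    define U where "U k = (\<Union>i<k. A i)" for k :: nat
    have U: "range U \<subseteq> sets M" "range U \<subseteq> sets N" "incseq U" "(\<Union>k. U k) = (\<Union>i. A i)"
      using A by (auto simp: U_def incseq_def lessThan_Suc_atMost intro!: sets.finite_UN) force+
    have "\<forall>\<^sub>F k in sequentially. measure M (\<Union>i. A i) - measure M (U k) < e / 2"
      using order_tendstoD(1)[OF finite_Lim_measure_incseq[OF U(1,3)], of "measure M (\<Union>i. A i) - e / 2"] \<open>e > 0\<close> unfolding U(4)
      by (auto elim!: eventually_mono)
    moreover have "\<forall>\<^sub>F k in sequentially. measure N (\<Union>i. A i) - measure N (U k) < e / 2"
      using order_tendstoD(1)[OF N.finite_Lim_measure_incseq[OF U(2,3)], of "measure N (\<Union>i. A i) - e / 2"] \<open>e > 0\<close> unfolding U(4)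
      by (auto elim!: eventually_mono)
    ultimately have "\<forall>\<^sub>F k in sequentially. measure M (\<Union>i. A i) - measure M (U k) < e / 2 \<and> measure N (\<Union>i. A i) - measure N (U k) < e / 2"
      by (rule eventually_conj)
    then obtain k where k: "measure M (\<Union>i. A i) - measure M (U k) < e / 2" "measure N (\<Union>i. A i) - measure N (U k) < e / 2"
      using eventually_happens by force
    \<comment> \<open>The truncation index \<open>k\<close> is fixed before the approximating sets
      are chosen, so the accuracy may depend on it: \<open>k\<close> errors of this size add up to
      at most \<open>e / 2\<close>, the other half being spent on the truncation.\<close>
    have "\<forall>i. \<exists>E\<in>\<A>. measure M ((A i - E) \<union> (E - A i)) < e / (2 * (real k + 1)) \<and> measure N ((A i - E) \<union> (E - A i)) < e / (2 * (real k + 1))"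
      using Union \<open>e > 0\<close> by auto
    then obtain E where E: "\<And>i. E i \<in> \<A>" "\<And>i. measure M ((A i - E i) \<union> (E i - A i)) < e / (2 * (real k + 1))"
      "\<And>i. measure N ((A i - E i) \<union> (E i - A i)) < e / (2 * (real k + 1))" by metis
    define F where "F = (\<Union>i<k. E i)"
    have F: "F \<in> \<A>" unfolding F_def using E(1) by (intro alg.finite_UN) auto
    have E': "E i \<in> sets M" "E i \<in> sets N" for i using E(1)[of i] sub N(2) by auto
    have key: "measure K (((\<Union>i. A i) - F) \<union> (F - (\<Union>i. A i))) < e"
      if K: "finite_measure K" "sets K = sets M" "measure K (\<Union>i. A i) - measure K (U k) < e / 2"
        "\<And>i. measure K ((A i - E i) \<union> (E i - A i)) < e / (2 * (real k + 1))" for K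
    proof -
      interpret K: finite_measure K by fact
      have AK: "A i \<in> sets K" "E i \<in> sets K" for i using A(1) E'(1) K(2) by auto
      have UK: "U k \<in> sets K" "(\<Union>i. A i) \<in> sets K" using AK by (auto simp: U_def)
      have "((\<Union>i. A i) - F) \<union> (F - (\<Union>i. A i)) \<subseteq> ((\<Union>i. A i) - U k) \<union> (\<Union>i<k. (A i - E i) \<union> (E i - A i))"
        by (auto simp: U_def F_def)
      then have "measure K (((\<Union>i. A i) - F) \<union> (F - (\<Union>i. A i))) \<le> measure K (((\<Union>i. A i) - U k) \<union> (\<Union>i<k. (A i - E i) \<union> (E i - A i)))"
        using AK UK by (intro K.finite_measure_mono) auto
      also have "\<dots> \<le> measure K ((\<Union>i. A i) - U k) + measure K (\<Union>i<k. (A i - E i) \<union> (E i - A i))"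
        using AK UK by (intro measure_Un_le) auto
      also have "measure K ((\<Union>i. A i) - U k) = measure K (\<Union>i. A i) - measure K (U k)"
        using UK by (intro K.finite_measure_Diff) (auto simp: U_def)
      also have "measure K (\<Union>i<k. (A i - E i) \<union> (E i - A i)) \<le> (\<Sum>i<k. measure K ((A i - E i) \<union> (E i - A i)))"
        using AK by (intro K.finite_measure_subadditive_finite) auto
      also have "\<dots> \<le> (\<Sum>i<k. e / (2 * (real k + 1)))"
        by (intro sum_mono less_imp_le K)
      also have "\<dots> \<le> e / 2" using \<open>e > 0\<close> by (simp add: field_simps)
      finally show ?thesis using K(3) by simp
    qed
    show ?case
      using key[OF finite_measure_axioms refl k(1) E(2)] key[OF N k(2) E(3)] F by blast
  qed
qed

lemma cylinders_algebra: "algebra (space C01) cylinders"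
  unfolding algebra_iff_Un
proof (intro conjI ballI)
  show "cylinders \<subseteq> Pow (space C01)" by (auto simp: cylinders_def)
  have "{} = {f \<in> space C01. restrict f {} \<in> ({} :: (real \<Rightarrow> real) set)}" by auto
  then show "{} \<in> cylinders" unfolding cylinders_def
    by (intro CollectI exI[of _ "{}"] conjI) auto
next
  fix D assume "D \<in> cylinders"
  then obtain J A where D: "D = {f \<in> space C01. restrict f J \<in> A}" "finite J" "J \<subseteq> unit_dyadics" "A \<in> sets (PiM J (\<lambda>_. borel))"
    by (auto simp: cylinders_def)
  have "space C01 - D = {f \<in> space C01. restrict f J \<in> space (PiM J (\<lambda>_. borel)) - A}"
    by (auto simp: D(1) space_PiM)
  moreover have "space (PiM J (\<lambda>_. borel)) - A \<in> sets (PiM J (\<lambda>_. borel))" using D(4) by auto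
  ultimately show "space C01 - D \<in> cylinders" using D(2,3) unfolding cylinders_def by blast
next
  fix D E assume "D \<in> cylinders" "E \<in> cylinders"
  then obtain J A K B where D: "D = {f \<in> space C01. restrict f J \<in> A}" "finite J" "J \<subseteq> unit_dyadics" "A \<in> sets (PiM J (\<lambda>_. borel))"
    and E: "E = {f \<in> space C01. restrict f K \<in> B}" "finite K" "K \<subseteq> unit_dyadics" "B \<in> sets (PiM K (\<lambda>_. borel))"
    by (auto simp: cylinders_def)
  let ?L = "PiM (J \<union> K) (\<lambda>_. borel :: real measure)"
  let ?C = "((\<lambda>x. restrict x J) -` A \<inter> space ?L) \<union> ((\<lambda>x. restrict x K) -` B \<inter> space ?L)"
  have "D \<union> E = {f \<in> space C01. restrict f (J \<union> K) \<in> ?C}"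
    unfolding D(1) E(1) by (auto simp: space_PiM Int_absorb1)
  moreover have "?C \<in> sets ?L"
    using D(4) E(4) by (intro sets.Un measurable_sets[OF measurable_restrict_subset]) auto
  ultimately show "D \<union> E \<in> cylinders" using D(2,3) E(2,3) unfolding cylinders_def
    by (intro CollectI exI[of _ "J \<union> K"] exI[of _ ?C] conjI) auto
qed

lemma sets_C01_cylinders: "sets C01 = sigma_sets (space C01) cylinders"
proof
  show "sets C01 \<subseteq> sigma_sets (space C01) cylinders"
    unfolding sets_C01_rectangles by (rule sigma_sets_mono') (rule rectangles_subset_cylinders)
  show "sigma_sets (space C01) cylinders \<subseteq> sets C01"
    using cylinders_sets by (intro sets.sigma_sets_subset) auto
qed

text \<open>Cauchy--Schwarz against the likelihood ratio of the two Gaussian vectors. The bound depends on the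
  shift only through its energy, which stays bounded as the partition is refined; hence it extends to
  all cylinders and by approximation yields the qualitative part of the Cameron--Martin theorem.\<close>

lemma gaussian_shift_bound:
  fixes h :: "nat \<Rightarrow> real"
  assumes \<sigma>: "\<sigma> > 0" and A: "A \<in> sets (PiM {..<m} (\<lambda>_. borel))"
  shows "(emeasure (PiM {..<m} (\<lambda>i. density lborel (normal_density (h i) \<sigma>))) A)\<^sup>2
    \<le> ennreal (exp (\<Sum>i<m. (h i)\<^sup>2 / \<sigma>\<^sup>2)) * emeasure (PiM {..<m} (\<lambda>i. density lborel (normal_density 0 \<sigma>))) A"
proof -
  let ?N = "\<lambda>h. density lborel (normal_density h \<sigma>)"
  let ?H = "PiM {..<m} (\<lambda>i. ?N 0)"
  \<comment> \<open>The likelihood ratio of the normal laws with means \<open>h i\<close> and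
    0.\<close>
  define r where "r i x = exp ((h i * x - (h i)\<^sup>2 / 2) / \<sigma>\<^sup>2)" for i x
  have r0: "r i x > 0" for i x by (simp add: r_def)
  have rm[measurable]: "r i \<in> borel_measurable borel" for i unfolding r_def by measurable
  interpret H: product_prob_space "\<lambda>i. ?N 0" "{..<m}"
    by (intro product_prob_spaceI prob_space_normal_density \<sigma>)
  interpret N': product_prob_space "\<lambda>i. ?N (h i)" "{..<m}"
    by (intro product_prob_spaceI prob_space_normal_density \<sigma>)
  have setsH: "sets ?H = sets (PiM {..<m} (\<lambda>_. borel))" by (intro sets_PiM_cong) auto
  have nd: "normal_density 0 \<sigma> x * r i x = normal_density (h i) \<sigma> x" for i x
  proof -
    have "- x\<^sup>2 / (2 * \<sigma>\<^sup>2) + (h i * x - (h i)\<^sup>2 / 2) / \<sigma>\<^sup>2 = - (x - h i)\<^sup>2 / (2 * \<sigma>\<^sup>2)"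
      using \<sigma> by (simp add: field_simps power2_eq_square)
    then show ?thesis unfolding normal_density_def r_def by (simp add: mult.assoc exp_add[symmetric])
  qed
  \<comment> \<open>Completing the square turns the squared ratio into a normal density centred at
    twice the shift; hence its second moment is exactly
    \<open>exp ((h i)\<^sup>2 / \<sigma>\<^sup>2)\<close>.\<close>
  have nd2: "normal_density 0 \<sigma> x * (r i x)\<^sup>2 = exp ((h i)\<^sup>2 / \<sigma>\<^sup>2) * normal_density (2 * h i) \<sigma> x" for i x
  proof -
    have "- x\<^sup>2 / (2 * \<sigma>\<^sup>2) + 2 * ((h i * x - (h i)\<^sup>2 / 2) / \<sigma>\<^sup>2) = (h i)\<^sup>2 / \<sigma>\<^sup>2 + (- (x - 2 * h i)\<^sup>2 / (2 * \<sigma>\<^sup>2))"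
      using \<sigma> by (simp add: field_simps power2_eq_square)
    then have "exp (- x\<^sup>2 / (2 * \<sigma>\<^sup>2)) * (r i x)\<^sup>2 = exp ((h i)\<^sup>2 / \<sigma>\<^sup>2) * exp (- (x - 2 * h i)\<^sup>2 / (2 * \<sigma>\<^sup>2))"
      unfolding r_def exp_add[symmetric] exp_double[symmetric] by simp
    then show ?thesis unfolding normal_density_def by simp
  qed
  let ?R = "\<lambda>x. ennreal (\<Prod>i<m. r i (x i))"
  have Rm[measurable]: "?R \<in> borel_measurable ?H"
    by (intro measurable_compose[OF _ measurable_ennreal] borel_measurable_prod measurable_compose[OF _ rm]) auto
  have eq: "density ?H ?R = PiM {..<m} (\<lambda>i. ?N (h i))"
  proof (rule N'.PiM_eqI)
    show "sets (density ?H ?R) = sets (PiM {..<m} (\<lambda>i. ?N (h i)))" by (auto intro!: sets_PiM_cong)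
    fix B :: "nat \<Rightarrow> real set" assume B: "\<And>i. i \<in> {..<m} \<Longrightarrow> B i \<in> sets (?N (h i))"
    have "PiE {..<m} B \<in> sets ?H" using B by (intro sets_PiM_I_finite) auto
    then have "emeasure (density ?H ?R) (PiE {..<m} B) = (\<integral>\<^sup>+x. ?R x * indicator (PiE {..<m} B) x \<partial>?H)"
      by (rule emeasure_density[OF Rm])
    also have "\<dots> = (\<integral>\<^sup>+x. (\<Prod>i<m. ennreal (r i (x i)) * indicator (B i) (x i)) \<partial>?H)"
    proof (intro nn_integral_cong)
      fix x assume "x \<in> space ?H"
      then have "indicator (PiE {..<m} B) x = (\<Prod>i<m. indicator (B i) (x i) :: ennreal)"
        by (auto simp: space_PiM PiE_iff indicator_def prod_zero_iff intro!: prod.neutral[symmetric])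
      then show "?R x * indicator (PiE {..<m} B) x = (\<Prod>i<m. ennreal (r i (x i)) * indicator (B i) (x i))"
        using r0 by (simp add: prod.distrib prod_ennreal less_imp_le)
    qed
    also have "\<dots> = (\<Prod>i<m. \<integral>\<^sup>+x. ennreal (r i x) * indicator (B i) x \<partial>?N 0)"
      using B by (intro H.product_nn_integral_prod) auto
    also have "\<dots> = (\<Prod>i<m. emeasure (?N (h i)) (B i))"
    proof (intro prod.cong refl)
      fix i assume "i \<in> {..<m}"
      then have [measurable]: "B i \<in> sets borel" using B by auto
      have "(\<integral>\<^sup>+x. ennreal (r i x) * indicator (B i) x \<partial>?N 0) = (\<integral>\<^sup>+x. ennreal (normal_density 0 \<sigma> x * r i x) * indicator (B i) x \<partial>lborel)"
        using r0 by (subst nn_integral_density) (auto simp: ennreal_mult'' mult.assoc less_imp_le)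
      then show "(\<integral>\<^sup>+x. ennreal (r i x) * indicator (B i) x \<partial>?N 0) = emeasure (?N (h i)) (B i)"
        by (subst emeasure_density) (auto simp: nd)
    qed
    finally show "emeasure (density ?H ?R) (PiE {..<m} B) = (\<Prod>i<m. emeasure (?N (h i)) (B i))" .
  qed simp
  have A': "A \<in> sets ?H" using A setsH by simp
  have "(emeasure (PiM {..<m} (\<lambda>i. ?N (h i))) A)\<^sup>2 = (\<integral>\<^sup>+x. ?R x * indicator A x \<partial>?H)\<^sup>2"
    unfolding eq[symmetric] using emeasure_density[OF Rm A'] by simp
  also have "\<dots> \<le> (\<integral>\<^sup>+x. (?R x)\<^sup>2 \<partial>?H) * (\<integral>\<^sup>+x. (indicator A x)\<^sup>2 \<partial>?H)"
    using A' by (intro Cauchy_Schwarz_nn_integral) auto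
  also have "(\<integral>\<^sup>+x. (indicator A x)\<^sup>2 \<partial>?H) = (\<integral>\<^sup>+x. indicator A x \<partial>?H)"
    by (intro nn_integral_cong) (auto split: split_indicator)
  also have "\<dots> = emeasure ?H A" using A' by simp
  also have "(\<integral>\<^sup>+x. (?R x)\<^sup>2 \<partial>?H) = (\<integral>\<^sup>+x. (\<Prod>i<m. ennreal ((r i (x i))\<^sup>2)) \<partial>?H)"
    using r0 by (intro nn_integral_cong) (simp add: prod_ennreal ennreal_power prod_nonneg less_imp_le prod_power_distrib)
  also have "\<dots> = (\<Prod>i<m. \<integral>\<^sup>+x. ennreal ((r i x)\<^sup>2) \<partial>?N 0)"
    by (intro H.product_nn_integral_prod) auto
  also have "\<dots> = (\<Prod>i<m. ennreal (exp ((h i)\<^sup>2 / \<sigma>\<^sup>2)))"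
  proof (intro prod.cong refl)
    fix i
    interpret N2: prob_space "?N (2 * h i)" by (rule prob_space_normal_density[OF \<sigma>])
    have "(\<integral>\<^sup>+x. ennreal ((r i x)\<^sup>2) \<partial>?N 0) = (\<integral>\<^sup>+x. ennreal (exp ((h i)\<^sup>2 / \<sigma>\<^sup>2)) * ennreal (normal_density (2 * h i) \<sigma> x) \<partial>lborel)"
      by (subst nn_integral_density) (auto simp: ennreal_mult''[symmetric] nd2 ennreal_mult'[symmetric])
    also have "\<dots> = ennreal (exp ((h i)\<^sup>2 / \<sigma>\<^sup>2)) * emeasure (?N (2 * h i)) UNIV"
      by (subst nn_integral_cmult) (auto simp: emeasure_density)
    finally show "(\<integral>\<^sup>+x. ennreal ((r i x)\<^sup>2) \<partial>?N 0) = ennreal (exp ((h i)\<^sup>2 / \<sigma>\<^sup>2))"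
      using N2.emeasure_space_1 by simp
  qed
  also have "\<dots> = ennreal (exp (\<Sum>i<m. (h i)\<^sup>2 / \<sigma>\<^sup>2))"
    by (simp add: prod_ennreal exp_sum)
  finally show ?thesis .
qed

lemma wiener_increment_law:
  fixes h :: "nat \<Rightarrow> real"
  assumes W: "wiener_measure W"
  shows "distr W (PiM {..<2 ^ p} (\<lambda>_. borel)) (\<lambda>b. \<lambda>i\<in>{..<2 ^ p}. h i + (b (real (Suc i) / 2 ^ p) - b (real i / 2 ^ p)))
    = PiM {..<2 ^ p} (\<lambda>i. density lborel (normal_density (h i) (sqrt (1 / 2 ^ p))))" (is "distr W ?P ?X = _")
proof -
  interpret prob_space W by (rule wiener_properties[OF W])
  let ?D = "\<lambda>i b. b (real (Suc i) / 2 ^ p) - b (real i / 2 ^ p) :: real"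
  let ?s = "sqrt (1 / 2 ^ p)"
  have D: "distributed W lborel (\<lambda>b. h i + ?D i b) (normal_density (h i) ?s)" if "i < 2 ^ p" for i
    using normal_density_affine[OF wiener_properties(6)[OF W that], of 1 "h i"] by simp
  have ind: "indep_vars (\<lambda>_. borel) (\<lambda>i b. h i + ?D i b) {..<2 ^ p}"
    by (rule indep_vars_compose2[OF wiener_properties(5)[OF W]]) simp
  have "distr W ?P ?X = PiM {..<2 ^ p} (\<lambda>i. distr W borel (\<lambda>b. h i + ?D i b))"
  proof (subst indep_vars_iff_distr_eq_PiM'[symmetric])
    show "(\<lambda>b. h i + ?D i b) \<in> borel_measurable W" if "i \<in> {..<2 ^ p}" for i
      using D[of i] that by (simp add: distributed_def)
  qed (use ind in \<open>auto simp: lessThan_empty_iff\<close>)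
  also have "\<dots> = PiM {..<2 ^ p} (\<lambda>i. density lborel (normal_density (h i) ?s))"
  proof (rule PiM_cong[OF refl])
    fix i :: nat assume "i \<in> {..<2 ^ p}"
    then have "distr W lborel (\<lambda>b. h i + ?D i b) = density lborel (normal_density (h i) ?s)"
      using D[of i] by (simp add: distributed_def)
    moreover have "distr W borel (\<lambda>b. h i + ?D i b) = distr W lborel (\<lambda>b. h i + ?D i b)" by (rule distr_cong) auto
    ultimately show "distr W borel (\<lambda>b. h i + ?D i b) = density lborel (normal_density (h i) ?s)" by simp
  qed
  finally show ?thesis .
qed

lemma primitive_at_0: "(LINT s:{0..0}|lborel. f s :: real) = (0::real)" for f :: "real \<Rightarrow> real"
proof -
  have "AE s in lborel. s \<noteq> (0::real)" by (rule AE_lborel_singleton)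
  then have "AE s in lborel. indicator {0..0} s *\<^sub>R f s = 0" by eventually_elim auto
  then show ?thesis unfolding set_lebesgue_integral_def by (rule integral_eq_zero_AE)
qed

text \<open>On a grid containing the times of \<open>D\<close>, both observations are the same map
  \<open>\<Phi>\<close> of the Brownian increments, unshifted for \<open>f\<close> and shifted by
  \<open>h\<close>, the scaled increments of the difference of the primitives, for \<open>g\<close>.
  So \<open>D\<close> pulls back to one event \<open>A'\<close> under two Gaussian product
  measures.\<close>

lemma observation_law_cylinder_bound:
  assumes W: "wiener_measure W" and f: "continuous_on {0..1} f" and g: "continuous_on {0..1} g" and n: "n \<ge> 1"
    and G: "\<And>x. x \<in> {0..1} \<Longrightarrow> \<bar>g x - f x\<bar> \<le> G" and D: "D \<in> cylinders"
  shows "(emeasure (observation_law W n g) D)\<^sup>2 \<le> ennreal (exp (real n * G\<^sup>2)) * emeasure (observation_law W n f) D"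
proof -
  interpret prob_space W by (rule wiener_properties[OF W])
  note sp = wiener_properties(2,3)[OF W]
  obtain J A where D: "D = {f \<in> space C01. restrict f J \<in> A}" "finite J" "J \<subseteq> unit_dyadics" "A \<in> sets (PiM J (\<lambda>_. borel))"
    using D by (auto simp: cylinders_def)
  have DC: "D \<in> sets C01" using assms(6) cylinders_sets by blast
  obtain p where p: "\<And>t. t \<in> J \<Longrightarrow> \<exists>i\<le>2 ^ p. t = real i / 2 ^ p"
    using unit_dyadicsE[OF D(2,3)] by blast
  then obtain idx where idx: "\<And>t. t \<in> J \<Longrightarrow> idx t \<le> 2 ^ p" "\<And>t. t \<in> J \<Longrightarrow> t = real (idx t) / 2 ^ p" by metis
  have unit: "real i / 2 ^ p \<in> {0..1}" if "i \<le> 2 ^ p" for i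
    using that unit_dyadics_subset unfolding unit_dyadics_def by blast
  let ?F = "\<lambda>(f :: real \<Rightarrow> real) (t :: real). LINT s:{0..t}|lborel. f s"
  let ?P = "PiM {..<2 ^ p} (\<lambda>_. borel) :: (nat \<Rightarrow> real) measure"
  define h where "h j = sqrt n * ((?F g (real (Suc j) / 2 ^ p) - ?F g (real j / 2 ^ p)) - (?F f (real (Suc j) / 2 ^ p) - ?F f (real j / 2 ^ p)))" for j
  define \<Phi> where "\<Phi> x = (\<lambda>t\<in>J. ?F f t + (\<Sum>j<idx t. x j) / sqrt n)" for x :: "nat \<Rightarrow> real"
  define X where "X k b = (\<lambda>i\<in>{..<2 ^ p}. k i + (b (real (Suc i) / 2 ^ p) - b (real i / 2 ^ p)))" for k b :: "_ \<Rightarrow> real"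
  have \<Phi>m: "\<Phi> \<in> measurable ?P (PiM J (\<lambda>_. borel))"
    unfolding \<Phi>_def
  proof (intro measurable_restrict)
    fix t assume "t \<in> J"
    have [measurable]: "(\<lambda>x. x j) \<in> borel_measurable ?P" if "j \<in> {..<idx t}" for j
      using that idx(1)[OF \<open>t \<in> J\<close>] by (intro measurable_component_singleton) auto
    show "(\<lambda>x. ?F f t + (\<Sum>j<idx t. x j) / sqrt n) \<in> borel_measurable ?P" by measurable
  qed
  define A' where "A' = \<Phi> -` A \<inter> space ?P"
  have A': "A' \<in> sets ?P" unfolding A'_def by (rule measurable_sets[OF \<Phi>m D(4)])
  have Xm: "X k \<in> measurable W ?P" for k
    unfolding X_def
  proof (intro measurable_restrict)
    fix i :: nat assume i: "i \<in> {..<2 ^ p}"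
    have [measurable]: "(\<lambda>b. b (real i / 2 ^ p)) \<in> borel_measurable C01" "(\<lambda>b. b (real (Suc i) / 2 ^ p)) \<in> borel_measurable C01"
      using i by (intro C01_eval unit; simp)+
    have "(\<lambda>b. k i + (b (real (Suc i) / 2 ^ p) - b (real i / 2 ^ p))) \<in> borel_measurable C01" by measurable
    then show "(\<lambda>b. k i + (b (real (Suc i) / 2 ^ p) - b (real i / 2 ^ p))) \<in> borel_measurable W"
      by (simp add: measurable_cong_sets[OF sp(1) refl])
  qed
  have F0: "?F f 0 = 0" for f by (rule primitive_at_0)
  have tele: "q (real i / 2 ^ p) = q 0 + (\<Sum>j<i. q (real (Suc j) / 2 ^ p) - q (real j / 2 ^ p))" for q :: "real \<Rightarrow> real" and i
    using sum_lessThan_telescope[of "\<lambda>j. q (real j / 2 ^ p)" i] by simp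
  have obs: "observation n g b \<in> D \<longleftrightarrow> X h b \<in> A'" "observation n f b \<in> D \<longleftrightarrow> X (\<lambda>_. 0) b \<in> A'"
    if b: "b \<in> space W" "b 0 = 0" for b
  proof -
    have bC: "continuous_on {0..1} b" using b sp C01_continuous by simp
    have mem: "observation n f b \<in> space C01" "observation n g b \<in> space C01"
      using observation_in_C01 bC f g by auto
    have XP: "X k b \<in> space ?P" for k by (auto simp: X_def space_PiM)
    have Xs: "(\<Sum>j<idx t. X k b j) = (\<Sum>j<idx t. k j) + b t" if "t \<in> J" for k t
    proof -
      have "(\<Sum>j<idx t. X k b j) = (\<Sum>j<idx t. k j + (b (real (Suc j) / 2 ^ p) - b (real j / 2 ^ p)))"
        using idx(1)[OF that] by (intro sum.cong) (auto simp: X_def)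
      also have "\<dots> = (\<Sum>j<idx t. k j) + b (real (idx t) / 2 ^ p)"
        unfolding sum.distrib using tele[of b "idx t"] b(2) by simp
      finally show ?thesis by (simp only: idx(2)[OF that, symmetric])
    qed
    have t01: "t \<in> {0..1}" if "t \<in> J" for t using that D(3) unit_dyadics_subset by auto
    have "restrict (observation n f b) J = \<Phi> (X (\<lambda>_. 0) b)"
      unfolding \<Phi>_def using t01 by (auto simp: fun_eq_iff observation_def Xs)
    then show "observation n f b \<in> D \<longleftrightarrow> X (\<lambda>_. 0) b \<in> A'"
      unfolding D(1) A'_def using mem XP by auto
    have hs: "(\<Sum>j<idx t. h j) = sqrt n * (?F g t - ?F f t)" if "t \<in> J" for t
    proof -
      have "(\<Sum>j<idx t. h j) = sqrt n * ((\<Sum>j<idx t. ?F g (real (Suc j) / 2 ^ p) - ?F g (real j / 2 ^ p)) - (\<Sum>j<idx t. ?F f (real (Suc j) / 2 ^ p) - ?F f (real j / 2 ^ p)))"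
        unfolding h_def sum_distrib_left[symmetric] sum_subtractf ..
      also have "\<dots> = sqrt n * (?F g (real (idx t) / 2 ^ p) - ?F f (real (idx t) / 2 ^ p))"
        using tele[of "?F g" "idx t"] tele[of "?F f" "idx t"] by (simp only: F0 add_0)
      finally show ?thesis by (simp only: idx(2)[OF that, symmetric])
    qed
    have "restrict (observation n g b) J = \<Phi> (X h b)"
      unfolding \<Phi>_def using t01 n by (auto simp: fun_eq_iff observation_def Xs hs add_divide_distrib)
    then show "observation n g b \<in> D \<longleftrightarrow> X h b \<in> A'"
      unfolding D(1) A'_def using mem XP by auto
  qed
  have emO: "emeasure (observation_law W n q) D = emeasure W {b \<in> space W. observation n q b \<in> D}"
    if "continuous_on {0..1} q" for q
    unfolding observation_law_def
    using observation_measurable[OF that] DC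
    by (subst emeasure_distr) (auto simp: measurable_cong_sets[OF sp(1) refl] vimage_def Int_def conj_commute)
  have obm: "{b \<in> space W. observation n q b \<in> D} \<in> sets W" if "continuous_on {0..1} q" for q
    using measurable_sets[OF observation_measurable[OF that] DC] sp by (simp add: vimage_def Int_def conj_commute)
  have Xem: "{b \<in> space W. X k b \<in> A'} \<in> sets W" for k
    using measurable_sets[OF Xm A'] by (simp add: vimage_def Int_def conj_commute)
  have dX: "emeasure W {b \<in> space W. X k b \<in> A'} = emeasure (distr W ?P (X k)) A'" for k
    using A' Xm by (subst emeasure_distr) (auto simp: vimage_def Int_def conj_commute)
  let ?s = "sqrt (1 / 2 ^ p) :: real"
  have dX': "distr W ?P (X k) = PiM {..<2 ^ p} (\<lambda>i. density lborel (normal_density (k i) ?s))" for k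
    unfolding X_def by (rule wiener_increment_law[OF W])
  have "emeasure (observation_law W n g) D = emeasure (PiM {..<2 ^ p} (\<lambda>i. density lborel (normal_density (h i) ?s))) A'"
    unfolding emO[OF g] dX'[symmetric] dX[symmetric]
    using wiener_properties(4)[OF W] obs(1) by (intro emeasure_eq_AE obm Xem g) auto
  moreover have "emeasure (observation_law W n f) D = emeasure (PiM {..<2 ^ p} (\<lambda>i. density lborel (normal_density 0 ?s))) A'"
    unfolding emO[OF f] dX'[symmetric, of "\<lambda>_. 0"] dX[symmetric]
    using wiener_properties(4)[OF W] obs(2) by (intro emeasure_eq_AE obm Xem f) auto
  moreover have "(emeasure (PiM {..<2 ^ p} (\<lambda>i. density lborel (normal_density (h i) ?s))) A')\<^sup>2
    \<le> ennreal (exp (\<Sum>i<2 ^ p. (h i)\<^sup>2 / ?s\<^sup>2)) * emeasure (PiM {..<2 ^ p} (\<lambda>i. density lborel (normal_density 0 ?s))) A'"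
    by (rule gaussian_shift_bound[OF _ A']) simp
  \<comment> \<open>A shift over a cell is at most \<open>sqrt n * G / 2 ^ p\<close>, against a
    variance of \<open>1 / 2 ^ p\<close>; so each of the \<open>2 ^ p\<close> terms is at most
    \<open>n * G\<^sup>2 / 2 ^ p\<close>, and the total does not depend on the grid.\<close>
  moreover have "(\<Sum>i<2 ^ p. (h i)\<^sup>2 / ?s\<^sup>2) \<le> real n * G\<^sup>2"
  proof -
    have "(h i)\<^sup>2 / ?s\<^sup>2 \<le> real n * G\<^sup>2 / 2 ^ p" if i: "i < 2 ^ p" for i
    proof -
      define a c where "a = real i / 2 ^ p" and "c = real (Suc i) / 2 ^ p"
      let ?I = "{a..<c}"
      have s1: "0 \<le> a" "a \<le> c" "c \<le> 1" and ca: "c - a = 1 / 2 ^ p"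
        using unit[of "Suc i"] i unfolding a_def c_def by (auto intro!: divide_right_mono simp: diff_divide_distrib[symmetric])
      have sub: "?I \<subseteq> {0..1}" using s1 by auto
      have int: "set_integrable lborel ?I q" if "continuous_on {0..1} q" for q :: "real \<Rightarrow> real"
        by (rule set_integrable_subset[OF borel_integrable_atLeastAtMost'[OF that] _ sub]) simp
      have hi: "h i = sqrt n * (LINT x:?I|lborel. g x - f x)"
        unfolding h_def a_def[symmetric] c_def[symmetric] primitive_diff[OF g s1] primitive_diff[OF f s1]
        using int[OF f] int[OF g] by simp
      have "\<bar>h i\<bar> = sqrt n * \<bar>LINT x:?I|lborel. g x - f x\<bar>" unfolding hi by (simp add: abs_mult)
      also have "\<dots> \<le> sqrt n * (G / 2 ^ p)"
      proof (rule mult_left_mono)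
        have "\<bar>LINT x:?I|lborel. g x - f x\<bar> \<le> (LINT x:?I|lborel. \<bar>g x - f x\<bar>)"
          using set_integral_norm_bound[of lborel ?I "\<lambda>x. g x - f x"] int f g by (simp add: set_integral_diff)
        also have "\<dots> \<le> (LINT x:?I|lborel. G)"
        proof (rule set_integral_mono)
          show "set_integrable lborel ?I (\<lambda>x. \<bar>g x - f x\<bar>)" using int f g by (intro set_integrable_abs set_integral_diff) auto
          show "set_integrable lborel ?I (\<lambda>x. G)" by (intro int continuous_on_const)
          show "\<bar>g x - f x\<bar> \<le> G" if "x \<in> ?I" for x using G sub that by blast
        qed
        also have "\<dots> = G / 2 ^ p"
          using s1(2) ca by (simp add: set_lebesgue_integral_def)
        finally show "\<bar>LINT x:?I|lborel. g x - f x\<bar> \<le> G / 2 ^ p" .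
      qed simp
      finally have "\<bar>h i\<bar> \<le> sqrt n * (G / 2 ^ p)" .
      then have "(h i)\<^sup>2 \<le> (sqrt n * (G / 2 ^ p))\<^sup>2" by (metis abs_ge_zero power2_abs power_mono)
      then have "(h i)\<^sup>2 / ?s\<^sup>2 \<le> (sqrt n * (G / 2 ^ p))\<^sup>2 / ?s\<^sup>2" by (rule divide_right_mono) simp
      also have "\<dots> = real n * G\<^sup>2 / 2 ^ p" by (simp add: power_mult_distrib power_divide field_simps power2_eq_square)
      finally show ?thesis .
    qed
    then have "(\<Sum>i<2 ^ p. (h i)\<^sup>2 / ?s\<^sup>2) \<le> (\<Sum>i<(2::nat) ^ p. real n * G\<^sup>2 / 2 ^ p)"
      by (intro sum_mono) auto
    also have "\<dots> = real n * G\<^sup>2" by simp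
    finally show ?thesis .
  qed
  ultimately show ?thesis
    by (auto elim!: order_trans intro!: mult_right_mono ennreal_leI)
qed

lemma observation_law_prob:
  assumes W: "wiener_measure W" and f: "continuous_on {0..1} f"
  shows "prob_space (observation_law W n f)" "sets (observation_law W n f) = sets C01"
proof -
  interpret prob_space W by (rule wiener_properties[OF W])
  show "prob_space (observation_law W n f)" unfolding observation_law_def
    using observation_measurable[OF f] by (intro prob_space_distr) (simp add: measurable_cong_sets[OF wiener_properties(2)[OF W] refl])
qed (simp add: observation_law_def)

lemma observation_law_absolutely_continuous:
  assumes W: "wiener_measure W" and f: "continuous_on {0..1} f" and g: "continuous_on {0..1} g" and n: "n \<ge> 1"
    and D: "D \<in> sets C01" "emeasure (observation_law W n f) D = 0"
  shows "emeasure (observation_law W n g) D = 0"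
proof -
  let ?M = "observation_law W n f" and ?N = "observation_law W n g"
  interpret M: prob_space ?M by (rule observation_law_prob[OF W f])
  interpret N: prob_space ?N by (rule observation_law_prob[OF W g])
  note S = observation_law_prob(2)[OF W f] observation_law_prob(2)[OF W g]
  have "continuous_on {0..1} (\<lambda>x. g x - f x)" by (intro continuous_intros f g)
  from compact_imp_bounded[OF compact_continuous_image[OF this]]
  obtain G where G: "\<forall>x\<in>{0..1}. \<bar>g x - f x\<bar> \<le> G" by (auto simp: bounded_iff)
  define c where "c = exp (real n * G\<^sup>2)"
  have c: "c > 0" by (simp add: c_def)
  \<comment> \<open>A cylinder \<open>E\<close> close to the null set \<open>D\<close> under both
    laws has small measure under the first law, hence by the square-root bound under the second, and
    there it is close to \<open>D\<close> again. Then \<open>e\<close> tends to 0.\<close>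
  have small: "measure ?N D \<le> e + sqrt (c * e)" if e: "e > 0" for e
  proof -
    have gen: "sets ?M = sigma_sets (space C01) cylinders" using S sets_C01_cylinders by simp
    have "\<exists>E\<in>cylinders. measure ?M ((D - E) \<union> (E - D)) < e \<and> measure ?N ((D - E) \<union> (E - D)) < e"
      by (rule M.approx_by_algebra[OF N.finite_measure_axioms _ cylinders_algebra gen _ e]) (use S D in simp_all)
    then obtain E where E: "E \<in> cylinders" "measure ?M ((D - E) \<union> (E - D)) < e" "measure ?N ((D - E) \<union> (E - D)) < e" by blast
    have ES: "E \<in> sets C01" using E(1) cylinders_sets by blast
    have "(emeasure ?N E)\<^sup>2 \<le> ennreal c * emeasure ?M E"
      unfolding c_def using G E(1) by (intro observation_law_cylinder_bound W f g n) auto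
    then have "(measure ?N E)\<^sup>2 \<le> c * measure ?M E"
      using c unfolding N.emeasure_eq_measure M.emeasure_eq_measure
      by (simp add: ennreal_power ennreal_mult'[symmetric] ennreal_le_iff)
    moreover have "measure ?M E \<le> measure ?M (D \<union> ((D - E) \<union> (E - D)))"
      using D ES S by (intro M.finite_measure_mono) auto
    moreover have "measure ?M (D \<union> ((D - E) \<union> (E - D))) \<le> measure ?M D + measure ?M ((D - E) \<union> (E - D))"
      using D ES S by (intro measure_Un_le) auto
    moreover have "measure ?M D = 0" using D(2) by (simp add: M.emeasure_eq_measure)
    ultimately have "(measure ?N E)\<^sup>2 \<le> c * e"
      using E(2) c by (smt (verit) mult_left_mono)
    then have "measure ?N E \<le> sqrt (c * e)" by (rule real_le_rsqrt)
    moreover have "measure ?N D \<le> measure ?N (E \<union> ((D - E) \<union> (E - D)))"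
      using D ES S by (intro N.finite_measure_mono) auto
    moreover have "measure ?N (E \<union> ((D - E) \<union> (E - D))) \<le> measure ?N E + measure ?N ((D - E) \<union> (E - D))"
      using D ES S by (intro measure_Un_le) auto
    ultimately show ?thesis using E(3) by linarith
  qed
  have "((\<lambda>e. e + sqrt (c * e)) \<longlongrightarrow> 0 + sqrt (c * 0)) (at_right 0)"
    by (intro tendsto_intros)
  then have "measure ?N D \<le> 0 + sqrt (c * 0)"
    by (rule tendsto_lowerbound) (auto simp: eventually_at_right_less small intro: eventually_mono[OF eventually_at_right_less])
  then have "measure ?N D = 0" using measure_nonneg[of ?N D] by simp
  then show ?thesis by (simp add: N.emeasure_eq_measure)
qed

section \<open>Wavelet bases\<close>

text \<open>Boundedness is part of the notion because the boundary functions live on a half line,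
  where a Lipschitz condition does not give it. The Lipschitz part provides the pathwise integrals,
  the bound the estimate of the sums over a level.\<close>

definition bounded_lipschitz_on :: "real set \<Rightarrow> (real \<Rightarrow> real) \<Rightarrow> bool" where
  "bounded_lipschitz_on A g \<longleftrightarrow> (\<exists>B L. (\<forall>x\<in>A. \<bar>g x\<bar> \<le> B) \<and> (\<forall>x\<in>A. \<forall>y\<in>A. \<bar>g x - g y\<bar> \<le> L * \<bar>x - y\<bar>))"

lemma bounded_lipschitz_onI:
  "(\<And>x. x \<in> A \<Longrightarrow> \<bar>g x\<bar> \<le> B) \<Longrightarrow> (\<And>x y. x \<in> A \<Longrightarrow> y \<in> A \<Longrightarrow> \<bar>g x - g y\<bar> \<le> L * \<bar>x - y\<bar>) \<Longrightarrow> bounded_lipschitz_on A g"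
  unfolding bounded_lipschitz_on_def by blast

lemma bounded_lipschitz_on_cong:
  "bounded_lipschitz_on A g \<Longrightarrow> (\<And>x. x \<in> A \<Longrightarrow> f x = g x) \<Longrightarrow> bounded_lipschitz_on A f"
  unfolding bounded_lipschitz_on_def by simp

lemma bounded_lipschitz_on_const: "bounded_lipschitz_on A (\<lambda>_. c)"
  by (rule bounded_lipschitz_onI[where B="\<bar>c\<bar>" and L=0]) auto

lemma bounded_lipschitz_on_cmult:
  assumes "bounded_lipschitz_on A g" shows "bounded_lipschitz_on A (\<lambda>x. c * g x)"
proof -
  obtain B L where *: "\<forall>x\<in>A. \<bar>g x\<bar> \<le> B" "\<forall>x\<in>A. \<forall>y\<in>A. \<bar>g x - g y\<bar> \<le> L * \<bar>x - y\<bar>"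
    using assms unfolding bounded_lipschitz_on_def by blast
  show ?thesis
  proof (rule bounded_lipschitz_onI)
    show "\<bar>c * g x\<bar> \<le> \<bar>c\<bar> * B" if "x \<in> A" for x using * that by (simp add: abs_mult mult_left_mono)
    show "\<bar>c * g x - c * g y\<bar> \<le> (\<bar>c\<bar> * L) * \<bar>x - y\<bar>" if "x \<in> A" "y \<in> A" for x y
      using * that by (simp add: right_diff_distrib[symmetric] abs_mult mult_left_mono mult.assoc)
  qed
qed

lemma bounded_lipschitz_on_add:
  assumes "bounded_lipschitz_on A f" "bounded_lipschitz_on A g"
  shows "bounded_lipschitz_on A (\<lambda>x. f x + g x)"
proof -
  obtain B L where *: "\<forall>x\<in>A. \<bar>f x\<bar> \<le> B" "\<forall>x\<in>A. \<forall>y\<in>A. \<bar>f x - f y\<bar> \<le> L * \<bar>x - y\<bar>"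
    using assms(1) unfolding bounded_lipschitz_on_def by blast
  obtain B' L' where **: "\<forall>x\<in>A. \<bar>g x\<bar> \<le> B'" "\<forall>x\<in>A. \<forall>y\<in>A. \<bar>g x - g y\<bar> \<le> L' * \<bar>x - y\<bar>"
    using assms(2) unfolding bounded_lipschitz_on_def by blast
  show ?thesis
  proof (rule bounded_lipschitz_onI)
    show "\<bar>f x + g x\<bar> \<le> B + B'" if "x \<in> A" for x using * ** that by (intro order_trans[OF abs_triangle_ineq] add_mono) auto
    show "\<bar>(f x + g x) - (f y + g y)\<bar> \<le> (L + L') * \<bar>x - y\<bar>" if "x \<in> A" "y \<in> A" for x y
    proof -
      have "\<bar>(f x - f y) + (g x - g y)\<bar> \<le> L * \<bar>x - y\<bar> + L' * \<bar>x - y\<bar>"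
        using * ** that by (intro order_trans[OF abs_triangle_ineq] add_mono) auto
      then show ?thesis by (simp add: algebra_simps)
    qed
  qed
qed

lemma bounded_lipschitz_on_sum:
  "finite I \<Longrightarrow> (\<And>i. i \<in> I \<Longrightarrow> bounded_lipschitz_on A (f i)) \<Longrightarrow> bounded_lipschitz_on A (\<lambda>x. \<Sum>i\<in>I. f i x)"
  by (induction I rule: finite_induct) (auto intro: bounded_lipschitz_on_const bounded_lipschitz_on_add)

lemma bounded_lipschitz_on_affine:
  assumes "bounded_lipschitz_on A g" "\<And>x. x \<in> D \<Longrightarrow> a * x + b \<in> A"
  shows "bounded_lipschitz_on D (\<lambda>x. g (a * x + b))"
proof -
  obtain B L where *: "\<forall>x\<in>A. \<bar>g x\<bar> \<le> B" "\<forall>x\<in>A. \<forall>y\<in>A. \<bar>g x - g y\<bar> \<le> L * \<bar>x - y\<bar>"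
    using assms(1) unfolding bounded_lipschitz_on_def by blast
  show ?thesis
  proof (rule bounded_lipschitz_onI)
    show "\<bar>g (a * x + b)\<bar> \<le> B" if "x \<in> D" for x using * assms(2) that by auto
    show "\<bar>g (a * x + b) - g (a * y + b)\<bar> \<le> (L * \<bar>a\<bar>) * \<bar>x - y\<bar>" if "x \<in> D" "y \<in> D" for x y
    proof -
      have "\<bar>g (a * x + b) - g (a * y + b)\<bar> \<le> L * \<bar>(a * x + b) - (a * y + b)\<bar>"
        by (rule *(2)[rule_format, OF assms(2)[OF that(1)] assms(2)[OF that(2)]])
      also have "(a * x + b) - (a * y + b) = a * (x - y)" by (simp add: algebra_simps)
      finally show ?thesis by (simp add: abs_mult mult.assoc)
    qed
  qed
qed

lemma bounded_lipschitz_on_lipschitz: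
  assumes "bounded_lipschitz_on A g" shows "\<exists>L. L-lipschitz_on A g"
proof -
  obtain B L where *: "\<forall>x\<in>A. \<bar>g x\<bar> \<le> B" "\<forall>x\<in>A. \<forall>y\<in>A. \<bar>g x - g y\<bar> \<le> L * \<bar>x - y\<bar>"
    using assms unfolding bounded_lipschitz_on_def by blast
  have "\<bar>L\<bar>-lipschitz_on A g"
  proof (rule lipschitz_onI)
    show "dist (g x) (g y) \<le> \<bar>L\<bar> * dist x y" if "x \<in> A" "y \<in> A" for x y
      using * that abs_ge_self[of L] unfolding dist_real_def by (meson abs_ge_zero mult_right_mono order_trans)
  qed simp
  then show ?thesis by blast
qed

text \<open>A continuous derivative is bounded on the compact interval and vanishes on the open
  complement, where the function is locally zero. At least one continuous derivative is what makes
  the wavelets Lipschitz.\<close>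

lemma bounded_lipschitz_smooth:
  fixes f :: "real \<Rightarrow> real"
  assumes f: "times_continuously_differentiable S f" and S: "S \<ge> 1" and supp: "\<And>x. x \<notin> {a..b} \<Longrightarrow> f x = 0"
  shows "bounded_lipschitz_on UNIV f"
proof -
  have d: "f differentiable_on UNIV"
    using f S unfolding times_continuously_differentiable_def by (auto dest!: spec[of _ 0])
  have d1: "continuous_on UNIV (deriv f)"
  proof (cases "S = 1")
    case True
    then show ?thesis using f by (simp add: times_continuously_differentiable_def)
  next
    case False
    then have "1 < S" using S by simp
    then have "(deriv ^^ 1) f differentiable_on UNIV"
      using f unfolding times_continuously_differentiable_def by blast
    then show ?thesis by (intro differentiable_imp_continuous_on) simp
  qed
  have c: "continuous_on UNIV f" by (rule differentiable_imp_continuous_on[OF d])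
  obtain B where B: "\<forall>x\<in>{a..b}. \<bar>f x\<bar> \<le> B"
    using compact_imp_bounded[OF compact_continuous_image[OF continuous_on_subset[OF c] compact_Icc[of a b]]]
    by (auto simp: bounded_iff)
  obtain L where L: "\<forall>x\<in>{a..b}. \<bar>deriv f x\<bar> \<le> L"
    using compact_imp_bounded[OF compact_continuous_image[OF continuous_on_subset[OF d1] compact_Icc[of a b]]]
    by (auto simp: bounded_iff)
  have D: "(f has_field_derivative deriv f x) (at x)" for x
    using d by (simp add: differentiable_on_def DERIV_deriv_iff_real_differentiable)
  have out: "deriv f x = 0" if "x \<notin> {a..b}" for x
  proof -
    have "eventually (\<lambda>y. y \<in> - {a..b}) (nhds x)"
      using that by (intro eventually_nhds_in_open) (auto simp: open_Compl)
    then have "eventually (\<lambda>y. f y = 0) (nhds x)" by eventually_elim (simp add: supp)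
    then have "deriv f x = deriv (\<lambda>_. 0) x" by (intro deriv_cong_ev refl)
    then show ?thesis by simp
  qed
  have L': "\<bar>deriv f x\<bar> \<le> max L 0" for x using L out by (cases "x \<in> {a..b}") (auto simp: le_max_iff_disj)
  show ?thesis
  proof (rule bounded_lipschitz_onI)
    show "\<bar>f x\<bar> \<le> max B 0" for x using B supp by (cases "x \<in> {a..b}") (auto simp: le_max_iff_disj)
    show "\<bar>f x - f y\<bar> \<le> max L 0 * \<bar>x - y\<bar>" for x y
      using field_differentiable_bound[of UNIV f "deriv f" "max L 0" x y] D L' by (simp add: real_norm_def)
  qed
qed

lemma bounded_lipschitz_edge_scaling:
  assumes "bounded_lipschitz_on UNIV f"
  shows "bounded_lipschitz_on {0..} (edge_scaling N f k)"
proof (rule bounded_lipschitz_on_cong)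
  show "bounded_lipschitz_on {0..} (\<lambda>x. \<Sum>n = k..2 * N - 2. real (n choose k) * f (1 * x + (real n - real N + 1)))"
    by (intro bounded_lipschitz_on_sum bounded_lipschitz_on_cmult bounded_lipschitz_on_affine[OF assms]) auto
qed (auto simp: edge_scaling_def algebra_simps)

lemma bounded_lipschitz_orthonormalization:
  assumes "orthonormalization N g e" "\<And>j. j < N \<Longrightarrow> bounded_lipschitz_on A (g j)" "i < N"
  shows "bounded_lipschitz_on A (e i)"
proof -
  obtain c :: "nat \<Rightarrow> real" where c: "\<And>x. e i x = (\<Sum>j<N. c j * g j x)"
    using assms(1,3) unfolding orthonormalization_def by blast
  have "bounded_lipschitz_on A (\<lambda>x. \<Sum>j<N. c j * g j x)"
    by (intro bounded_lipschitz_on_sum bounded_lipschitz_on_cmult assms(2)) auto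
  then show ?thesis by (rule bounded_lipschitz_on_cong) (rule c)
qed

lemma bounded_lipschitz_edge_wavelet:
  assumes "\<And>j. j < N \<Longrightarrow> bounded_lipschitz_on {0..} (e j)" "k < N"
  shows "bounded_lipschitz_on {0..} (edge_wavelet N e k)"
proof (rule bounded_lipschitz_on_cong)
  let ?c = "\<lambda>m. LINT y|lborel. sqrt 2 * e k (2 * y) * e m y"
  show "bounded_lipschitz_on {0..} (\<lambda>x. sqrt 2 * e k (2 * x + 0) + (\<Sum>m<N. (- ?c m) * e m x))"
    by (intro bounded_lipschitz_on_add bounded_lipschitz_on_sum bounded_lipschitz_on_cmult
        bounded_lipschitz_on_affine[OF assms(1)] assms) auto
qed (simp add: edge_wavelet_def sum_negf)

lemma level_function_lipschitz:
  assumes "\<And>i. i < N \<Longrightarrow> bounded_lipschitz_on {0..} (Lf i)" "\<And>i. i < N \<Longrightarrow> bounded_lipschitz_on {0..} (Rf i)"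
    and "bounded_lipschitz_on UNIV f" "k < 2 ^ j"
  shows "bounded_lipschitz_on {0..1} (level_function N Lf f Rf j k)"
proof -
  consider "k < N" | "\<not> k < N" "k < 2 ^ j - N" | "\<not> k < N" "\<not> k < 2 ^ j - N" by blast
  then show ?thesis
  proof cases
    case 1
    have "bounded_lipschitz_on {0..1} (\<lambda>x. sqrt (2 ^ j) * Lf k (2 ^ j * x + 0))"
      by (intro bounded_lipschitz_on_cmult bounded_lipschitz_on_affine[OF assms(1)] 1) auto
    then show ?thesis by (rule bounded_lipschitz_on_cong) (simp add: level_function_def 1)
  next
    case 2
    have "bounded_lipschitz_on {0..1} (\<lambda>x. sqrt (2 ^ j) * f (2 ^ j * x + (- real k)))"
      by (intro bounded_lipschitz_on_cmult bounded_lipschitz_on_affine[OF assms(3)]) auto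
    then show ?thesis by (rule bounded_lipschitz_on_cong) (simp add: level_function_def 2)
  next
    case 3
    then have "2 ^ j - 1 - k < N" using assms(4) by auto
    then have "bounded_lipschitz_on {0..1} (\<lambda>x. sqrt (2 ^ j) * Rf (2 ^ j - 1 - k) ((- (2 ^ j)) * x + 2 ^ j))"
      by (intro bounded_lipschitz_on_cmult bounded_lipschitz_on_affine[OF assms(2)]) (auto simp: mult_left_le)
    then show ?thesis by (rule bounded_lipschitz_on_cong) (simp add: level_function_def 3 algebra_simps)
  qed
qed

text \<open>At a given point at most \<open>2 * N\<close> boundary functions and
  \<open>2 * N\<close> translates can be nonzero, each bounded by
  \<open>B * sqrt (2 ^ j)\<close>.\<close>

lemma level_function_sum_bound:
  assumes L: "\<And>i x. i < N \<Longrightarrow> x \<ge> 0 \<Longrightarrow> \<bar>Lf i x\<bar> \<le> B" and R: "\<And>i x. i < N \<Longrightarrow> x \<ge> 0 \<Longrightarrow> \<bar>Rf i x\<bar> \<le> B"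
    and f: "\<And>x. \<bar>f x\<bar> \<le> B" and supp: "\<And>x. x \<notin> {1 - real N..real N} \<Longrightarrow> f x = 0" and x: "x \<in> {0..1}"
  shows "(\<Sum>k<2 ^ j. \<bar>level_function N Lf f Rf j k x\<bar>) \<le> 4 * real N * B * sqrt (2 ^ j)"
proof -
  let ?y = "2 ^ j * x"
  have B: "0 \<le> B" using order_trans[OF abs_ge_zero f] .
  \<comment> \<open>The indices that can be active at \<open>x\<close>: both boundary blocks and the
    translates whose support contains \<open>?y\<close>. The integer interval may begin below 0; its
    image under \<open>nat\<close> is still large enough.\<close>
  define T where "T = {..<N} \<union> {2 ^ j - N..<2 ^ j} \<union> nat ` {\<lceil>?y - real N\<rceil>..\<lfloor>?y + real N - 1\<rfloor>}"
  have fin: "finite T" by (simp add: T_def)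
  have "card (nat ` {\<lceil>?y - real N\<rceil>..\<lfloor>?y + real N - 1\<rfloor>}) \<le> nat (\<lfloor>?y + real N - 1\<rfloor> - \<lceil>?y - real N\<rceil> + 1)"
    using card_image_le[of "{\<lceil>?y - real N\<rceil>..\<lfloor>?y + real N - 1\<rfloor>}" nat] by simp
  also have "\<dots> \<le> 2 * N" by linarith
  finally have "card T \<le> (N + N) + 2 * N"
    unfolding T_def by (intro order_trans[OF card_Un_le] add_mono) auto
  then have cT: "card T \<le> 4 * N" by simp
  have zero: "level_function N Lf f Rf j k x = 0" if k: "k < 2 ^ j" "k \<notin> T" for k
  proof -
    have k2: "\<not> k < N" "k < 2 ^ j - N" using k by (auto simp: T_def)
    have "int k \<notin> {\<lceil>?y - real N\<rceil>..\<lfloor>?y + real N - 1\<rfloor>}"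
      using k(2) unfolding T_def by (metis UnI2 image_eqI nat_int)
    moreover have "int k \<in> {\<lceil>?y - real N\<rceil>..\<lfloor>?y + real N - 1\<rfloor>}" if "?y - real k \<in> {1 - real N..real N}"
    proof -
      have "?y - real N \<le> real k" "real k \<le> ?y + real N - 1" using that unfolding atLeastAtMost_iff by linarith+
      then show ?thesis unfolding atLeastAtMost_iff ceiling_le_iff le_floor_iff by simp
    qed
    ultimately have "?y - real k \<notin> {1 - real N..real N}" by blast
    then show ?thesis using supp k2 by (simp add: level_function_def)
  qed
  have le: "\<bar>level_function N Lf f Rf j k x\<bar> \<le> sqrt (2 ^ j) * B" if k: "k < 2 ^ j" for k
  proof -
    have "0 \<le> ?y" "0 \<le> 2 ^ j * (1 - x)" using x by auto
    moreover have "2 ^ j - 1 - k < N" if "\<not> k < 2 ^ j - N" "\<not> k < N" using k that by auto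
    ultimately show ?thesis unfolding level_function_def using L R f
      by (auto simp: abs_mult intro!: mult_left_mono)
  qed
  have "(\<Sum>k<2 ^ j. \<bar>level_function N Lf f Rf j k x\<bar>) = (\<Sum>k\<in>{..<2 ^ j} \<inter> T. \<bar>level_function N Lf f Rf j k x\<bar>)"
    by (rule sum.mono_neutral_right) (use zero in auto)
  also have "\<dots> \<le> (\<Sum>k\<in>{..<2 ^ j} \<inter> T. sqrt (2 ^ j) * B)"
    by (intro sum_mono le) auto
  also have "\<dots> = real (card ({..<2 ^ j} \<inter> T)) * (sqrt (2 ^ j) * B)" by simp
  also have "\<dots> \<le> real (4 * N) * (sqrt (2 ^ j) * B)"
  proof (rule mult_right_mono)
    have "card ({..<2 ^ j} \<inter> T) \<le> card T" using fin by (intro card_mono) auto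
    then show "real (card ({..<2 ^ j} \<inter> T)) \<le> real (4 * N)" using cT by linarith
  qed (use B in auto)
  finally show ?thesis by (simp add: mult_ac)
qed

text \<open>What the statistical argument uses of the basis. The two sum bounds express bounded
  overlap; \<open>J0 \<ge> 1\<close> keeps the factor \<open>inverse (real l)\<close> of the prior
  variance positive.\<close>

locale wavelet_basis =
  fixes J0 :: nat and \<phi> :: "nat \<Rightarrow> real \<Rightarrow> real" and \<psi> :: "nat \<Rightarrow> nat \<Rightarrow> real \<Rightarrow> real" and B :: real
  assumes onb: "wavelet_orthonormal_basis J0 \<phi> \<psi>" and J0: "J0 \<ge> 1" and B: "B \<ge> 0"
    and phi_lipschitz: "k < 2 ^ J0 \<Longrightarrow> \<exists>L. L-lipschitz_on {0..1} (\<phi> k)"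
    and psi_lipschitz: "l \<ge> J0 \<Longrightarrow> k < 2 ^ l \<Longrightarrow> \<exists>L. L-lipschitz_on {0..1} (\<psi> l k)"
    and phi_bound: "x \<in> {0..1} \<Longrightarrow> (\<Sum>k<2 ^ J0. \<bar>\<phi> k x\<bar>) \<le> B"
    and psi_bound: "l \<ge> J0 \<Longrightarrow> x \<in> {0..1} \<Longrightarrow> (\<Sum>k<2 ^ l. \<bar>\<psi> l k x\<bar>) \<le> B * sqrt (2 ^ l)"

lemma cdv_wavelet_basis:
  assumes cdv: "cdv_basis S J0 \<phi> \<psi>" and S: "S \<ge> 1"
  shows "\<exists>B. wavelet_basis J0 \<phi> \<psi> B"
proof -
  obtain N f w fL fR wL wR where
    onb: "wavelet_orthonormal_basis J0 \<phi> \<psi>" and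
    db: "daubechies_pair N f w" and
    diff: "times_continuously_differentiable S f" "times_continuously_differentiable S w" and
    N: "2 * N \<le> 2 ^ J0" and
    on: "orthonormalization N (edge_scaling N f) fL"
      "orthonormalization N (edge_scaling N (\<lambda>x. f (1 - x))) fR"
      "orthonormalization N (edge_wavelet N fL) wL"
      "orthonormalization N (edge_wavelet N fR) wR" and
    eqs: "\<forall>k<2 ^ J0. \<forall>x\<in>{0..1}. \<phi> k x = level_function N fL f fR J0 k x"
      "\<forall>l\<ge>J0. \<forall>k<2 ^ l. \<forall>x\<in>{0..1}. \<psi> l k x = level_function N wL w wR l k x"
    using cdv unfolding cdv_basis_def by blast
  have N1: "N \<ge> 1" using db by (simp add: daubechies_pair_def)
  have J0: "J0 \<ge> 1" using N N1 by (cases J0) auto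
  have fsupp: "f x = 0" if "x \<notin> {1 - real N..real N}" for x using db that unfolding daubechies_pair_def by blast
  obtain h :: "int \<Rightarrow> real" where w: "\<And>x. w x = sqrt 2 * (\<Sum>n = 1 - int N..int N. (- 1) powi n * h (1 - n) * f (2 * x - of_int n))"
    using db unfolding daubechies_pair_def by blast
  \<comment> \<open>The support is inherited through the two-scale relation: for
    \<open>x > N\<close> and \<open>n \<le> N\<close> the argument \<open>2 * x - n\<close> exceeds
    \<open>N\<close>, and symmetrically on the left.\<close>
  have wsupp: "w x = 0" if x: "x \<notin> {1 - real N..real N}" for x
  proof -
    have "f (2 * x - of_int n) = 0" if n: "n \<in> {1 - int N..int N}" for n
    proof (rule fsupp)
      have "1 - real N \<le> of_int n" "of_int n \<le> real N" using n by auto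
      then show "2 * x - of_int n \<notin> {1 - real N..real N}" using x by auto
    qed
    then show ?thesis unfolding w by simp
  qed
  have f: "bounded_lipschitz_on UNIV f" by (rule bounded_lipschitz_smooth[OF diff(1) S fsupp])
  have w': "bounded_lipschitz_on UNIV w" by (rule bounded_lipschitz_smooth[OF diff(2) S wsupp])
  have fr: "bounded_lipschitz_on UNIV (\<lambda>x. f (1 - x))"
    using bounded_lipschitz_on_affine[OF f, of UNIV "-1" 1] by simp
  have fL: "bounded_lipschitz_on {0..} (fL i)" if "i < N" for i
    by (rule bounded_lipschitz_orthonormalization[OF on(1) bounded_lipschitz_edge_scaling[OF f] that])
  have fR: "bounded_lipschitz_on {0..} (fR i)" if "i < N" for i
    by (rule bounded_lipschitz_orthonormalization[OF on(2) bounded_lipschitz_edge_scaling[OF fr] that])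
  have wL: "bounded_lipschitz_on {0..} (wL i)" if "i < N" for i
    by (rule bounded_lipschitz_orthonormalization[OF on(3) bounded_lipschitz_edge_wavelet[OF fL] that])
  have wR: "bounded_lipschitz_on {0..} (wR i)" if "i < N" for i
    by (rule bounded_lipschitz_orthonormalization[OF on(4) bounded_lipschitz_edge_wavelet[OF fR] that])
  have unif: "\<exists>C. \<forall>i<N. \<forall>x\<in>{0..}. \<bar>e i x\<bar> \<le> C" if "\<And>i. i < N \<Longrightarrow> bounded_lipschitz_on {0..} (e i)" for e
  proof -
    have "\<forall>i. \<exists>C. i < N \<longrightarrow> (\<forall>x\<in>{0..}. \<bar>e i x\<bar> \<le> C)" using that unfolding bounded_lipschitz_on_def by meson
    then obtain C where C: "\<And>i x. i < N \<Longrightarrow> x \<in> {0..} \<Longrightarrow> \<bar>e i x\<bar> \<le> C i" by metis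
    have "\<bar>e i x\<bar> \<le> (\<Sum>i<N. \<bar>C i\<bar>)" if "i < N" "x \<in> {0..}" for i x
      using C[OF that] member_le_sum[of i "{..<N}" "\<lambda>i. \<bar>C i\<bar>"] that by auto
    then show ?thesis by blast
  qed
  obtain C1 where C1: "\<forall>i<N. \<forall>x\<in>{0..}. \<bar>fL i x\<bar> \<le> C1" using unif[of fL] fL by blast
  obtain C2 where C2: "\<forall>i<N. \<forall>x\<in>{0..}. \<bar>fR i x\<bar> \<le> C2" using unif[of fR] fR by blast
  obtain C3 where C3: "\<forall>i<N. \<forall>x\<in>{0..}. \<bar>wL i x\<bar> \<le> C3" using unif[of wL] wL by blast
  obtain C4 where C4: "\<forall>i<N. \<forall>x\<in>{0..}. \<bar>wR i x\<bar> \<le> C4" using unif[of wR] wR by blast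
  obtain C5 where C5: "\<forall>x. \<bar>f x\<bar> \<le> C5" using f unfolding bounded_lipschitz_on_def by blast
  obtain C6 where C6: "\<forall>x. \<bar>w x\<bar> \<le> C6" using w' unfolding bounded_lipschitz_on_def by blast
  define C where "C = Max {C1, C2, C3, C4, C5, C6}"
  have C: "C1 \<le> C" "C2 \<le> C" "C3 \<le> C" "C4 \<le> C" "C5 \<le> C" "C6 \<le> C" unfolding C_def by (auto intro!: Max_ge)
  have bL: "\<bar>fL i x\<bar> \<le> C" "\<bar>fR i x\<bar> \<le> C" "\<bar>wL i x\<bar> \<le> C" "\<bar>wR i x\<bar> \<le> C" if "i < N" "x \<ge> 0" for i x
    using C1 C2 C3 C4 C that order_trans[OF _ C(1), of "\<bar>fL i x\<bar>"] order_trans[OF _ C(2), of "\<bar>fR i x\<bar>"]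
      order_trans[OF _ C(3), of "\<bar>wL i x\<bar>"] order_trans[OF _ C(4), of "\<bar>wR i x\<bar>"] by auto
  have bf: "\<bar>f x\<bar> \<le> C" "\<bar>w x\<bar> \<le> C" for x
    using order_trans[OF C5[rule_format] C(5)] order_trans[OF C6[rule_format] C(6)] by auto
  have Cpos: "C \<ge> 0" using order_trans[OF abs_ge_zero C5[rule_format, of 0]] C(5) by linarith
  show ?thesis
  \<comment> \<open>One constant for both bounds: the scaling functions have the factor
    \<open>sqrt (2 ^ J0)\<close> of their level, and it only enlarges the constant for the
    wavelets.\<close>
  proof (rule exI[of _ "4 * real N * C * sqrt (2 ^ J0)"], rule wavelet_basis.intro[OF onb J0])
    show "0 \<le> 4 * real N * C * sqrt (2 ^ J0)" using Cpos by simp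
    show "\<exists>L. L-lipschitz_on {0..1} (\<phi> k)" if "k < 2 ^ J0" for k
      by (rule bounded_lipschitz_on_lipschitz, rule bounded_lipschitz_on_cong[OF level_function_lipschitz[OF fL fR f that]])
        (use eqs(1) that in auto)
    show "\<exists>L. L-lipschitz_on {0..1} (\<psi> l k)" if "l \<ge> J0" "k < 2 ^ l" for l k
      by (rule bounded_lipschitz_on_lipschitz, rule bounded_lipschitz_on_cong[OF level_function_lipschitz[OF wL wR w' that(2)]])
        (use eqs(2) that in auto)
    show "(\<Sum>k<2 ^ J0. \<bar>\<phi> k x\<bar>) \<le> 4 * real N * C * sqrt (2 ^ J0)" if x: "x \<in> {0..1}" for x
    proof -
      have "(\<Sum>k<2 ^ J0. \<bar>\<phi> k x\<bar>) = (\<Sum>k<2 ^ J0. \<bar>level_function N fL f fR J0 k x\<bar>)"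
        using eqs(1) x by (intro sum.cong) auto
      also have "\<dots> \<le> 4 * real N * C * sqrt (2 ^ J0)"
        by (rule level_function_sum_bound[OF bL(1,2) bf(1) fsupp x])
      finally show ?thesis .
    qed
    show "(\<Sum>k<2 ^ l. \<bar>\<psi> l k x\<bar>) \<le> 4 * real N * C * sqrt (2 ^ J0) * sqrt (2 ^ l)" if l: "l \<ge> J0" and x: "x \<in> {0..1}" for l x
    proof -
      have "(\<Sum>k<2 ^ l. \<bar>\<psi> l k x\<bar>) = (\<Sum>k<2 ^ l. \<bar>level_function N wL w wR l k x\<bar>)"
        using eqs(2) l x by (intro sum.cong) auto
      also have "\<dots> \<le> 4 * real N * C * sqrt (2 ^ l)"
        by (rule level_function_sum_bound[OF bL(3,4) bf(2) wsupp x])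
      also have "\<dots> \<le> (4 * real N * C * sqrt (2 ^ l)) * sqrt (2 ^ J0)"
      proof -
        have "1 \<le> sqrt (2 ^ J0)" by simp
        then show ?thesis using Cpos mult_left_mono[of 1 "sqrt (2 ^ J0)" "4 * real N * C * sqrt (2 ^ l)"] by simp
      qed
      finally show ?thesis by (simp add: mult_ac)
    qed
  qed
qed

context wavelet_basis
begin

lemma phi_continuous: "k < 2 ^ J0 \<Longrightarrow> continuous_on {0..1} (\<phi> k)"
  using phi_lipschitz[of k] by (auto intro: lipschitz_on_continuous_on)

lemma psi_continuous: "l \<ge> J0 \<Longrightarrow> k < 2 ^ l \<Longrightarrow> continuous_on {0..1} (\<psi> l k)"
  using psi_lipschitz[of l k] by (auto intro: lipschitz_on_continuous_on)

lemma level_sum_bound: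
  assumes "l \<ge> J0" "x \<in> {0..1}" "\<And>k. k < 2 ^ l \<Longrightarrow> \<bar>b k\<bar> \<le> d"
  shows "\<bar>\<Sum>k<2 ^ l. b k * \<psi> l k x\<bar> \<le> B * sqrt (2 ^ l) * d"
proof -
  have d: "0 \<le> d" using order_trans[OF abs_ge_zero assms(3)[of 0]] by simp
  have "\<bar>\<Sum>k<2 ^ l. b k * \<psi> l k x\<bar> \<le> (\<Sum>k<2 ^ l. d * \<bar>\<psi> l k x\<bar>)"
  proof (rule order_trans[OF sum_abs], rule sum_mono)
    fix k assume "k \<in> {..<(2::nat) ^ l}"
    then show "\<bar>b k * \<psi> l k x\<bar> \<le> d * \<bar>\<psi> l k x\<bar>"
      unfolding abs_mult by (intro mult_right_mono assms(3)) simp_all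
  qed
  also have "\<dots> \<le> d * (B * sqrt (2 ^ l))"
    unfolding sum_distrib_left[symmetric] by (intro mult_left_mono psi_bound assms d)
  finally show ?thesis by (simp add: mult_ac)
qed

text \<open>The partial sums are uniformly bounded by the right-hand side and converge to \<open>h\<close> in \<open>L\<^sup>2\<close>, so
  \<open>max (\<bar>h\<bar> - b) 0\<close> vanishes.\<close>

lemma sup_le_coefficients:
  assumes h: "continuous_on {0..1} h" and d0: "\<And>k. k < 2 ^ J0 \<Longrightarrow> \<bar>l2_inner h (\<phi> k)\<bar> \<le> d0"
    and d: "\<And>l k. l \<ge> J0 \<Longrightarrow> k < 2 ^ l \<Longrightarrow> \<bar>l2_inner h (\<psi> l k)\<bar> \<le> d l"
    and D: "\<And>L. (\<Sum>l = J0..L. sqrt (2 ^ l) * d l) \<le> D" and x: "x \<in> {0..1}"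
  shows "\<bar>h x\<bar> \<le> B * (d0 + D)"
proof -
  define s where "s L = wavelet_sum J0 \<phi> \<psi> (\<lambda>k. l2_inner h (\<phi> k)) (\<lambda>l k. l2_inner h (\<psi> l k)) L" for L
  define b where "b = B * (d0 + D)"
  have d0': "0 \<le> d0" using order_trans[OF abs_ge_zero d0[of 0]] by simp
  have sb: "\<bar>s L y\<bar> \<le> b" if y: "y \<in> {0..1}" for L y
  proof -
    have "\<bar>\<Sum>k<2 ^ J0. l2_inner h (\<phi> k) * \<phi> k y\<bar> \<le> (\<Sum>k<2 ^ J0. d0 * \<bar>\<phi> k y\<bar>)"
    proof (rule order_trans[OF sum_abs], rule sum_mono)
      fix k assume "k \<in> {..<(2::nat) ^ J0}"
      then show "\<bar>l2_inner h (\<phi> k) * \<phi> k y\<bar> \<le> d0 * \<bar>\<phi> k y\<bar>"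
        unfolding abs_mult by (intro mult_right_mono d0) simp_all
    qed
    also have "\<dots> \<le> d0 * B"
      unfolding sum_distrib_left[symmetric] by (intro mult_left_mono phi_bound y d0')
    finally have 1: "\<bar>\<Sum>k<2 ^ J0. l2_inner h (\<phi> k) * \<phi> k y\<bar> \<le> d0 * B" .
    have "\<bar>\<Sum>l = J0..L. \<Sum>k<2 ^ l. l2_inner h (\<psi> l k) * \<psi> l k y\<bar> \<le> (\<Sum>l = J0..L. B * sqrt (2 ^ l) * d l)"
      by (rule order_trans[OF sum_abs], rule sum_mono, rule level_sum_bound[OF _ y d]) auto
    also have "\<dots> = B * (\<Sum>l = J0..L. sqrt (2 ^ l) * d l)" by (simp add: sum_distrib_left mult.assoc)
    also have "\<dots> \<le> B * D" by (intro mult_left_mono D B)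
    finally have 2: "\<bar>\<Sum>l = J0..L. \<Sum>k<2 ^ l. l2_inner h (\<psi> l k) * \<psi> l k y\<bar> \<le> B * D" .
    show ?thesis unfolding s_def wavelet_sum_def b_def
      using 1 2 by (intro order_trans[OF abs_triangle_ineq]) (simp add: algebra_simps)
  qed
  have sc: "continuous_on {0..1} (s L)" for L
    unfolding s_def wavelet_sum_def
    by (intro continuous_intros phi_continuous psi_continuous) auto
  \<comment> \<open>Completeness of the basis is stated for Borel functions on the line, whereas
    \<open>h\<close> is only controlled on the unit interval.\<close>
  let ?h = "\<lambda>x. indicator {0..1} x * h x"
  have "?h \<in> borel_measurable borel" using borel_measurable_continuous_on_indicator[OF _ h] by simp
  moreover have "set_integrable lborel {0..1} (\<lambda>x. (?h x)\<^sup>2)"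
  proof (rule borel_integrable_atLeastAtMost')
    show "continuous_on {0..1} (\<lambda>x. (?h x)\<^sup>2)"
      by (rule continuous_on_eq[of _ "\<lambda>x. (h x)\<^sup>2"]) (auto intro!: continuous_intros h)
  qed
  ultimately have "(\<lambda>L. LINT x:{0..1}|lborel. (?h x - wavelet_sum J0 \<phi> \<psi> (\<lambda>k. l2_inner ?h (\<phi> k)) (\<lambda>l k. l2_inner ?h (\<psi> l k)) L x)\<^sup>2) \<longlonglongrightarrow> 0"
    using onb unfolding wavelet_orthonormal_basis_def by blast
  moreover have "l2_inner ?h g = l2_inner h g" for g
    unfolding l2_inner_def by (intro set_lebesgue_integral_cong) auto
  moreover have "(LINT x:{0..1}|lborel. (?h x - s L x)\<^sup>2) = (LINT x:{0..1}|lborel. (h x - s L x)\<^sup>2)" for L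
    by (intro set_lebesgue_integral_cong) auto
  ultimately have lim: "(\<lambda>L. LINT x:{0..1}|lborel. (h x - s L x)\<^sup>2) \<longlonglongrightarrow> 0"
    by (simp add: s_def)
  let ?e = "\<lambda>x. (max (\<bar>h x\<bar> - b) 0)\<^sup>2"
  have ec: "continuous_on {0..1} ?e" by (intro continuous_intros h)
  have le: "(LINT x:{0..1}|lborel. ?e x) \<le> (LINT x:{0..1}|lborel. (h x - s L x)\<^sup>2)" for L
  proof (rule set_integral_mono)
    show "set_integrable lborel {0..1} ?e" by (rule borel_integrable_atLeastAtMost'[OF ec])
    show "set_integrable lborel {0..1} (\<lambda>x. (h x - s L x)\<^sup>2)"
      by (intro borel_integrable_atLeastAtMost' continuous_intros h sc)
    fix y :: real assume y: "y \<in> {0..1}"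
    have "max (\<bar>h y\<bar> - b) 0 \<le> \<bar>h y - s L y\<bar>" using sb[OF y, of L] by (auto simp: max_def)
    then show "?e y \<le> (h y - s L y)\<^sup>2" by (metis max.cobounded2 power2_abs power_mono)
  qed
  have "(LINT x:{0..1}|lborel. ?e x) \<le> 0"
    by (rule LIMSEQ_le_const[OF lim]) (use le in blast)
  moreover have "(LINT x:{0..1}|lborel. ?e x) = integral {0..1} ?e"
    by (rule set_borel_integral_eq_integral(2)[OF borel_integrable_atLeastAtMost'[OF ec]])
  moreover have "0 \<le> integral {0..1} ?e"
    by (intro integral_nonneg integrable_continuous_interval ec) auto
  ultimately have "integral {0..1} ?e = 0" by simp
  then have "?e x = 0"
    using integral_eq_0_iff[OF ec] x by auto
  then show ?thesis by (simp add: b_def max_def split: if_splits)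
qed

end

section \<open>The prior\<close>

lemma set_integrable_continuous_mult:
  fixes f u :: "real \<Rightarrow> real"
  assumes f: "continuous_on {0..1} f" and u[measurable]: "u \<in> borel_measurable borel" and b: "\<And>x. \<bar>u x\<bar> \<le> b"
  shows "set_integrable lborel {0..1} (\<lambda>x. f x * u x)"
proof -
  have fi: "set_integrable lborel {0..1} f" by (rule borel_integrable_atLeastAtMost'[OF f])
  have b0: "0 \<le> b" using order_trans[OF abs_ge_zero b] .
  have "integrable lborel (\<lambda>x. u x * (indicator {0..1} x *\<^sub>R f x))"
  proof (rule Bochner_Integration.integrable_bound)
    show "integrable lborel (\<lambda>x. b * (indicator {0..1} x *\<^sub>R f x))"
      using fi unfolding set_integrable_def by simp
    have "(\<lambda>x. indicator {0..1} x *\<^sub>R f x) \<in> borel_measurable lborel"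
      using fi unfolding set_integrable_def by (rule borel_measurable_integrable)
    then show "(\<lambda>x. u x * (indicator {0..1} x *\<^sub>R f x)) \<in> borel_measurable lborel"
      by (intro borel_measurable_times) auto
    show "AE x in lborel. norm (u x * (indicator {0..1} x *\<^sub>R f x)) \<le> norm (b * (indicator {0..1} x *\<^sub>R f x))"
      using b b0 by (intro AE_I2) (auto simp: abs_mult intro!: mult_right_mono)
  qed
  then show ?thesis unfolding set_integrable_def by (simp add: mult_ac)
qed

lemma prob_space_gaussian: "prob_space gaussian_coefficients"
  unfolding gaussian_coefficients_def by (intro prob_space_PiM prob_space_normal_density) simp

lemma gaussian_coordinate_measurable [measurable]: "(\<lambda>g. g i) \<in> borel_measurable gaussian_coefficients"
  unfolding gaussian_coefficients_def
  using measurable_component_singleton[of i UNIV "\<lambda>_. density lborel std_normal_density"] by simp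

lemma gaussian_coordinate_distr:
  "distr gaussian_coefficients borel (\<lambda>g. g i) = density lborel std_normal_density"
proof -
  have "distr gaussian_coefficients (density lborel std_normal_density) (\<lambda>g. g i) = density lborel std_normal_density"
    unfolding gaussian_coefficients_def by (intro distr_PiM_component prob_space_normal_density) auto
  moreover have "distr gaussian_coefficients borel (\<lambda>g. g i) = distr gaussian_coefficients (density lborel std_normal_density) (\<lambda>g. g i)"
    by (intro distr_cong) auto
  ultimately show ?thesis by simp
qed

lemma gaussian_coordinate_tail:
  assumes "u \<ge> 0"
  shows "measure gaussian_coefficients {g \<in> space gaussian_coefficients. \<bar>g i\<bar> > u} \<le> 2 * exp (- (u\<^sup>2 / 4))"
proof -
  have "measure gaussian_coefficients {g \<in> space gaussian_coefficients. \<bar>g i\<bar> > u}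
      = measure (distr gaussian_coefficients borel (\<lambda>g. g i)) {x. \<bar>x\<bar> > u}"
    by (subst measure_distr) (auto simp: vimage_def Int_def conj_commute)
  also have "\<dots> \<le> 2 * exp (- (u\<^sup>2 / 4))"
    unfolding gaussian_coordinate_distr using normal_tail[of 1 u] assms by simp
  finally show ?thesis .
qed

lemma gaussian_char:
  assumes F: "finite F"
  shows "(CLINT g|gaussian_coefficients. iexp (\<Sum>i\<in>F. c i * g i)) = exp (- ((\<Sum>i\<in>F. (c i)\<^sup>2) / 2))"
proof (cases "F = {}")
  case True
  interpret prob_space gaussian_coefficients by (rule prob_space_gaussian)
  show ?thesis using True by (simp add: prob_space)
next
  case False
  interpret prob_space gaussian_coefficients by (rule prob_space_gaussian)
  let ?N = "density lborel std_normal_density"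
  interpret P: product_prob_space "\<lambda>_. ?N" UNIV
    by (intro product_prob_spaceI prob_space_normal_density) simp
  have "distr gaussian_coefficients (PiM F (\<lambda>_. ?N)) (\<lambda>g. restrict g F) = PiM F (\<lambda>_. ?N)"
    unfolding gaussian_coefficients_def by (rule P.distr_PiM_restrict_finite[OF F]) simp
  moreover have "distr gaussian_coefficients (PiM F (\<lambda>_. borel)) (\<lambda>g. restrict g F)
      = distr gaussian_coefficients (PiM F (\<lambda>_. ?N)) (\<lambda>g. restrict g F)"
    by (intro distr_cong refl sets_PiM_cong) auto
  ultimately have "distr gaussian_coefficients (PiM F (\<lambda>_. borel)) (\<lambda>g. \<lambda>i\<in>F. g i)
      = PiM F (\<lambda>i. distr gaussian_coefficients borel (\<lambda>g. g i))"
    by (simp add: gaussian_coordinate_distr)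
  then have "indep_vars (\<lambda>_. borel) (\<lambda>i g. g i) F"
    by (subst indep_vars_iff_distr_eq_PiM'[OF False]) auto
  then have ind: "indep_vars (\<lambda>_. borel) (\<lambda>i g. c i * g i) F"
    by (rule indep_vars_compose2) simp
  have c: "char (distr gaussian_coefficients borel (\<lambda>g. c i * g i)) 1 = complex_of_real (exp (- ((c i)\<^sup>2 / 2)))" for i
  proof -
    have "char (distr gaussian_coefficients borel (\<lambda>g. c i * g i)) 1 = char (distr gaussian_coefficients borel (\<lambda>g. g i)) (c i)"
      unfolding char_def by (simp add: integral_distr)
    then show ?thesis unfolding gaussian_coordinate_distr by (simp add: char_std_normal_distribution)
  qed
  have "(CLINT g|gaussian_coefficients. iexp (\<Sum>i\<in>F. c i * g i)) = char (distr gaussian_coefficients borel (\<lambda>g. \<Sum>i\<in>F. c i * g i)) 1"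
    unfolding char_def by (subst integral_distr) auto
  also have "\<dots> = (\<Prod>i\<in>F. complex_of_real (exp (- ((c i)\<^sup>2 / 2))))"
    unfolding char_distr_sum[OF ind] c ..
  also have "\<dots> = exp (- ((\<Sum>i\<in>F. (c i)\<^sup>2) / 2))"
    unfolding of_real_prod[symmetric] exp_sum[OF F, symmetric] by (simp add: sum_negf sum_divide_distrib)
  finally show ?thesis .
qed

locale wavelet_prior = wavelet_basis +
  fixes \<alpha> :: real
  assumes \<alpha>: "\<alpha> > 0"
begin

text \<open>The basis functions are only specified on \<open>[0, 1]\<close>; the indicator makes them Borel on the line.\<close>

definition bas :: "nat + nat \<times> nat \<Rightarrow> real \<Rightarrow> real" where
  "bas i x = indicator {0..1} x * (case i of Inl k \<Rightarrow> \<phi> k | Inr (l, k) \<Rightarrow> \<psi> l k) x"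

definition pvar :: "nat + nat \<times> nat \<Rightarrow> real" where
  "pvar i = (case i of Inl k \<Rightarrow> 1 | Inr (l, k) \<Rightarrow> inverse (real l) * 2 powr (- (real l * (2 * \<alpha> + 1))))"

definition idx :: "nat \<Rightarrow> (nat + nat \<times> nat) set" where
  "idx L = {..<2 ^ J0} <+> (SIGMA l:{J0..L}. {..<2 ^ l})"

definition valid :: "(nat + nat \<times> nat) set" where "valid = (\<Union>L. idx L)"

lemma finite_idx: "finite (idx L)" by (auto simp: idx_def)

lemma idx_mono: "L \<le> L' \<Longrightarrow> idx L \<subseteq> idx L'" by (auto simp: idx_def)

lemma valid_iff: "Inl k \<in> valid \<longleftrightarrow> k < 2 ^ J0" "Inr (l, k) \<in> valid \<longleftrightarrow> J0 \<le> l \<and> k < 2 ^ l"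
  by (auto simp: valid_def idx_def)

lemma pvar_pos: "i \<in> valid \<Longrightarrow> pvar i > 0"
  using J0 by (cases i) (auto simp: pvar_def valid_iff)

lemma sum_idx: "(\<Sum>i\<in>idx L. h i) = (\<Sum>k<2 ^ J0. h (Inl k)) + (\<Sum>l = J0..L. \<Sum>k<2 ^ l. h (Inr (l, k)))"
  unfolding idx_def by (simp add: sum.Plus sum.Sigma split_def)

lemma partial_sum_eq:
  "x \<in> {0..1} \<Longrightarrow> prior_partial_sum J0 \<phi> \<psi> \<alpha> g L x = (\<Sum>i\<in>idx L. sqrt (pvar i) * g i * bas i x)"
  unfolding sum_idx by (simp add: prior_partial_sum_def wavelet_sum_def bas_def pvar_def)

lemma bas_lipschitz:
  assumes "i \<in> valid" shows "\<exists>L. L-lipschitz_on {0..1} ((case i of Inl k \<Rightarrow> \<phi> k | Inr (l, k) \<Rightarrow> \<psi> l k))"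
  using assms phi_lipschitz psi_lipschitz by (cases i) (auto simp: valid_iff)

lemma bas_integrand: "i \<in> valid \<Longrightarrow> integrand (bas i)"
  using bas_lipschitz[of i] integrand_lipschitz unfolding bas_def by blast

lemma bas_continuous:
  assumes "i \<in> valid" shows "continuous_on {0..1} (bas i)"
proof -
  obtain L where L: "L-lipschitz_on {0..1} ((case i of Inl k \<Rightarrow> \<phi> k | Inr (l, k) \<Rightarrow> \<psi> l k))"
    using bas_lipschitz[OF assms] by blast
  show ?thesis
    by (rule continuous_on_eq[OF lipschitz_on_continuous_on[OF L]]) (simp add: bas_def)
qed

lemma l2_inner_commute: "l2_inner f g = l2_inner g f"
  by (simp add: l2_inner_def mult.commute)

lemma l2_inner_bas: "l2_inner f (bas (Inl k)) = l2_inner f (\<phi> k)" "l2_inner f (bas (Inr (l, k))) = l2_inner f (\<psi> l k)"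
  unfolding l2_inner_def by (intro set_lebesgue_integral_cong; simp add: bas_def)+

lemma bas_orthonormal:
  assumes "i \<in> valid" "j \<in> valid"
  shows "l2_inner (bas i) (bas j) = of_bool (i = j)"
proof -
  note o = onb[unfolded wavelet_orthonormal_basis_def]
  have 1: "l2_inner (\<phi> k) (\<phi> k') = of_bool (k = k')" if "k < 2 ^ J0" "k' < 2 ^ J0" for k k'
    using o that by blast
  have 2: "l2_inner (\<phi> k) (\<psi> l k') = 0" if "k < 2 ^ J0" "J0 \<le> l" "k' < 2 ^ l" for k l k'
    using o that by blast
  have 3: "l2_inner (\<psi> l k) (\<psi> l' k') = of_bool (l = l' \<and> k = k')" if "J0 \<le> l" "k < 2 ^ l" "J0 \<le> l'" "k' < 2 ^ l'" for l k l' k'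
    using o that by blast
  have s: "l2_inner (bas (Inl k)) g = l2_inner (\<phi> k) g" "l2_inner (bas (Inr (l, k))) g = l2_inner (\<psi> l k) g" for k l g
    using l2_inner_bas(1)[of g k] l2_inner_bas(2)[of g l k] by (simp_all add: l2_inner_commute)
  show ?thesis
  proof (cases i)
    case (Inl k)
    then show ?thesis using assms 1 2 by (cases j) (auto simp: valid_iff l2_inner_bas s)
  next
    case (Inr p)
    obtain l k where p: "p = (l, k)" by force
    show ?thesis
    proof (cases j)
      case (Inl k')
      then show ?thesis using assms Inr p 2[of k' l k] by (auto simp: valid_iff l2_inner_bas s l2_inner_commute[of "\<psi> l k"])
    next
      case (Inr q)
      then show ?thesis using assms \<open>i = Inr p\<close> p 3 by (cases q) (auto simp: valid_iff l2_inner_bas s)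
    qed
  qed
qed

section \<open>Uniform convergence of the prior series\<close>

lemma partial_sum_continuous: "continuous_on {0..1} (prior_partial_sum J0 \<phi> \<psi> \<alpha> g L)"
proof -
  have "continuous_on {0..1} (\<lambda>x. \<Sum>i\<in>idx L. sqrt (pvar i) * g i * bas i x)"
    by (intro continuous_intros bas_continuous) (auto simp: valid_def)
  then show ?thesis by (rule continuous_on_eq) (simp add: partial_sum_eq)
qed

lemma partial_sum_measurable:
  assumes "x \<in> {0..1}" shows "(\<lambda>g. prior_partial_sum J0 \<phi> \<psi> \<alpha> g L x) \<in> borel_measurable gaussian_coefficients"
  unfolding partial_sum_eq[OF assms] by measurable

abbreviation pconv :: "(nat + nat \<times> nat \<Rightarrow> real) \<Rightarrow> bool" where
  "pconv g \<equiv> uniformly_convergent_on {0..1} (prior_partial_sum J0 \<phi> \<psi> \<alpha> g)"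

text \<open>A Cauchy condition with countably many quantifiers: tolerances
  \<open>inverse (real (Suc j))\<close> and dyadic points, from which continuity of the partial sums
  recovers all points. This gives measurability of the event of convergence.\<close>

lemma pconv_iff:
  "pconv g \<longleftrightarrow> (\<forall>j::nat. \<exists>M. \<forall>p i m n. i \<le> 2 ^ p \<longrightarrow> M \<le> m \<longrightarrow> M \<le> n \<longrightarrow>
     \<bar>prior_partial_sum J0 \<phi> \<psi> \<alpha> g m (real i / 2 ^ p) - prior_partial_sum J0 \<phi> \<psi> \<alpha> g n (real i / 2 ^ p)\<bar> \<le> inverse (real (Suc j)))"
  (is "_ \<longleftrightarrow> ?R")
proof
  let ?s = "prior_partial_sum J0 \<phi> \<psi> \<alpha> g"
  assume "pconv g"
  then have "uniformly_Cauchy_on {0..1} ?s" by (rule uniformly_convergent_Cauchy)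
  then have C: "\<exists>M. \<forall>x\<in>{0..1}. \<forall>m\<ge>M. \<forall>n\<ge>M. dist (?s m x) (?s n x) < e" if "e > 0" for e
    using that unfolding uniformly_Cauchy_on_def by blast
  show ?R
  proof
    fix j :: nat
    have "0 < inverse (real (Suc j))" by simp
    from C[OF this] obtain M where M: "\<forall>x\<in>{0..1}. \<forall>m\<ge>M. \<forall>n\<ge>M. dist (?s m x) (?s n x) < inverse (real (Suc j))" by blast
    have unit: "real i / 2 ^ p \<in> {0..1}" if "i \<le> 2 ^ p" for i p
      using that unit_dyadics_subset unfolding unit_dyadics_def by blast
    show "\<exists>M. \<forall>p i m n. i \<le> 2 ^ p \<longrightarrow> M \<le> m \<longrightarrow> M \<le> n \<longrightarrow>
       \<bar>?s m (real i / 2 ^ p) - ?s n (real i / 2 ^ p)\<bar> \<le> inverse (real (Suc j))"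
    proof (intro exI[of _ M] allI impI)
      fix p i m n :: nat assume "i \<le> 2 ^ p" "M \<le> m" "M \<le> n"
      then have "dist (?s m (real i / 2 ^ p)) (?s n (real i / 2 ^ p)) < inverse (real (Suc j))"
        using M unit[of i p] by blast
      then show "\<bar>?s m (real i / 2 ^ p) - ?s n (real i / 2 ^ p)\<bar> \<le> inverse (real (Suc j))"
        unfolding dist_real_def by (rule less_imp_le)
    qed
  qed
next
  let ?s = "prior_partial_sum J0 \<phi> \<psi> \<alpha> g"
  assume R: ?R
  have "uniformly_Cauchy_on {0..1} ?s"
    unfolding uniformly_Cauchy_on_def
  proof (intro allI impI)
    fix e :: real assume "e > 0"
    then obtain j where j: "inverse (real (Suc j)) < e" using reals_Archimedean by blast
    from spec[OF R, of j] obtain M where M: "\<forall>p i m n. i \<le> 2 ^ p \<longrightarrow> M \<le> m \<longrightarrow> M \<le> n \<longrightarrow>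
       \<bar>?s m (real i / 2 ^ p) - ?s n (real i / 2 ^ p)\<bar> \<le> inverse (real (Suc j))" ..
    have "dist (?s m x) (?s n x) < e" if x: "x \<in> {0..1}" and mn: "M \<le> m" "M \<le> n" for x m n
    proof -
      have lim: "(\<lambda>p. ?s k (dfloor p x)) \<longlonglongrightarrow> ?s k x" for k
        by (intro continuous_on_tendsto_compose[OF partial_sum_continuous dfloor_tendsto] x always_eventually allI dfloor_unit)
      have "\<bar>?s m (dfloor p x) - ?s n (dfloor p x)\<bar> \<le> inverse (real (Suc j))" for p
      proof -
        obtain i q where d: "dfloor p x = real i / 2 ^ q" "i \<le> 2 ^ q" using dfloor_dyadic[OF x, of p] by (auto simp: unit_dyadics_def)
        show ?thesis unfolding d(1) by (rule M[rule_format, OF d(2) mn])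
      qed
      then have "\<bar>?s m x - ?s n x\<bar> \<le> inverse (real (Suc j))"
        by (intro tendsto_upperbound[OF tendsto_rabs[OF tendsto_diff[OF lim lim]]] always_eventually) auto
      then show ?thesis using j by (simp add: dist_real_def)
    qed
    then show "\<exists>M. \<forall>x\<in>{0..1}. \<forall>m\<ge>M. \<forall>n\<ge>M. dist (?s m x) (?s n x) < e" by blast
  qed
  then show "pconv g" by (rule Cauchy_uniformly_convergent)
qed

lemma pconv_measurable: "Measurable.pred gaussian_coefficients pconv"
proof -
  have *: "Measurable.pred gaussian_coefficients (\<lambda>g. i \<le> 2 ^ p \<longrightarrow>
      \<bar>prior_partial_sum J0 \<phi> \<psi> \<alpha> g m (real i / 2 ^ p) - prior_partial_sum J0 \<phi> \<psi> \<alpha> g n (real i / 2 ^ p)\<bar> \<le> c)" for i p m n c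
  proof (cases "i \<le> 2 ^ p")
    case True
    then have "real i / 2 ^ p \<in> {0..1}" using unit_dyadics_subset unfolding unit_dyadics_def by blast
    note [measurable] = partial_sum_measurable[OF this]
    show ?thesis by measurable
  qed simp
  have iff: "pconv g \<longleftrightarrow> (\<forall>j::nat. \<exists>M. \<forall>p i m n. M \<le> m \<longrightarrow> M \<le> n \<longrightarrow> i \<le> 2 ^ p \<longrightarrow>
     \<bar>prior_partial_sum J0 \<phi> \<psi> \<alpha> g m (real i / 2 ^ p) - prior_partial_sum J0 \<phi> \<psi> \<alpha> g n (real i / 2 ^ p)\<bar> \<le> inverse (real (Suc j)))" for g
    unfolding pconv_iff by (simp only: imp_conjL[symmetric] conj_ac)
  show ?thesis unfolding iff
    by (intro pred_intros_countable pred_intros_imp' *)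
qed

definition pfun :: "(nat + nat \<times> nat \<Rightarrow> real) \<Rightarrow> real \<Rightarrow> real" where
  "pfun g = (if pconv g then (\<lambda>x\<in>{0..1}. lim (\<lambda>L. prior_partial_sum J0 \<phi> \<psi> \<alpha> g L x)) else (\<lambda>x\<in>{0..1}. 0))"

lemma prior_eq: "prior J0 \<phi> \<psi> \<alpha> = distr gaussian_coefficients C01 pfun"
  unfolding prior_def pfun_def ..

lemma pfun_limit:
  assumes "pconv g" shows "uniform_limit {0..1} (prior_partial_sum J0 \<phi> \<psi> \<alpha> g) (pfun g) sequentially"
proof -
  obtain l where l: "uniform_limit {0..1} (prior_partial_sum J0 \<phi> \<psi> \<alpha> g) l sequentially"
    using assms unfolding uniformly_convergent_on_def by blast
  have "pfun g x = l x" if "x \<in> {0..1}" for x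
    using limI[OF tendsto_uniform_limitI[OF l that]] assms that by (simp add: pfun_def)
  then have "uniform_limit {0..1} (prior_partial_sum J0 \<phi> \<psi> \<alpha> g) (pfun g) sequentially
      \<longleftrightarrow> uniform_limit {0..1} (prior_partial_sum J0 \<phi> \<psi> \<alpha> g) l sequentially"
    by (intro uniform_limit_cong') auto
  then show ?thesis using l by (simp only:)
qed

lemma pfun_C01: "pfun g \<in> space C01"
proof (cases "pconv g")
  case True
  have "continuous_on {0..1} (pfun g)"
    by (rule uniform_limit_theorem[OF always_eventually pfun_limit[OF True]]) (auto intro: partial_sum_continuous)
  then show ?thesis by (auto simp: space_C01 pfun_def)
next
  case False
  then show ?thesis by (simp add: space_C01 pfun_def cong: continuous_on_cong_simp)
qed

lemma pfun_measurable [measurable]: "pfun \<in> measurable gaussian_coefficients C01"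
proof (rule measurable_C01I[OF pfun_C01])
  fix t :: real assume t: "t \<in> {0..1}"
  note [measurable] = partial_sum_measurable[OF t] pconv_measurable
  have "(\<lambda>g. if pconv g then lim (\<lambda>L. prior_partial_sum J0 \<phi> \<psi> \<alpha> g L t) else 0) \<in> borel_measurable gaussian_coefficients"
    by (intro measurable_If borel_measurable_lim_metric) measurable
  moreover have "(\<lambda>g. pfun g t) = (\<lambda>g. if pconv g then lim (\<lambda>L. prior_partial_sum J0 \<phi> \<psi> \<alpha> g L t) else 0)"
    using t by (auto simp: pfun_def)
  ultimately show "(\<lambda>g. pfun g t) \<in> borel_measurable gaussian_coefficients" by simp
qed

lemma prob_space_prior: "prob_space (prior J0 \<phi> \<psi> \<alpha>)"
  unfolding prior_eq by (rule prob_space.prob_space_distr[OF prob_space_gaussian pfun_measurable])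

lemma sets_prior: "sets (prior J0 \<phi> \<psi> \<alpha>) = sets C01" "space (prior J0 \<phi> \<psi> \<alpha>) = space C01"
  unfolding prior_eq by simp_all

lemma level_variance:
  assumes "l \<ge> 1"
  shows "sqrt (2 ^ l) * sqrt (pvar (Inr (l, k))) = 2 powr (- (real l * \<alpha>)) / sqrt (real l)"
proof -
  have p: "(2::real) ^ l = 2 powr real l" by (simp add: powr_realpow)
  have e1: "real l + - (real l * (2 * \<alpha> + 1)) = - (real l * \<alpha>) + - (real l * \<alpha>)" by (simp add: algebra_simps)
  have "(2::real) ^ l * pvar (Inr (l, k)) = 2 powr real l * 2 powr (- (real l * (2 * \<alpha> + 1))) / real l"
    unfolding p pvar_def by (simp only: sum.case prod.case divide_inverse mult_ac)
  also have "\<dots> = (2 powr (- (real l * \<alpha>)))\<^sup>2 / real l"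
    unfolding power2_eq_square powr_add[symmetric] e1 ..
  finally have "sqrt (2 ^ l * pvar (Inr (l, k))) = sqrt ((2 powr (- (real l * \<alpha>)))\<^sup>2 / real l)" by (rule arg_cong)
  also have "\<dots> = 2 powr (- (real l * \<alpha>)) / sqrt (real l)"
    unfolding real_sqrt_divide real_sqrt_abs by simp
  finally show ?thesis unfolding real_sqrt_mult .
qed

text \<open>By \<open>level_variance\<close> the \<open>l\<close>-th block has sup norm at most a
  constant times \<open>2 powr (- (l * \<alpha>)) / sqrt l * sqrt (8 * l)\<close>. The factor
  \<open>inverse (real l)\<close> of the prior variance cancels the growth of the coefficients, and
  a geometric majorant is left for the Weierstrass test.\<close>

lemma pconv_if_bounded:
  assumes ev: "\<forall>\<^sub>F l in sequentially. \<forall>k<2 ^ l. \<bar>g (Inr (l, k))\<bar> \<le> sqrt (8 * real l)"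
  shows "pconv g"
proof -
  define t where "t l x = (if l \<ge> J0 then \<Sum>k<2 ^ l. (sqrt (pvar (Inr (l, k))) * g (Inr (l, k))) * \<psi> l k x else 0)" for l x
  define a where "a x = (\<Sum>k<2 ^ J0. g (Inl k) * \<phi> k x)" for x
  have eq: "prior_partial_sum J0 \<phi> \<psi> \<alpha> g L x = a x + (\<Sum>l<Suc L. t l x)" for L x
  proof -
    have "(\<Sum>l<Suc L. t l x) = (\<Sum>l = J0..L. \<Sum>k<2 ^ l. (sqrt (pvar (Inr (l, k))) * g (Inr (l, k))) * \<psi> l k x)"
      by (rule sum.mono_neutral_cong_right) (auto simp: t_def)
    then show ?thesis
      by (simp add: prior_partial_sum_def wavelet_sum_def a_def pvar_def)
  qed
  have "\<forall>\<^sub>F l in sequentially. \<forall>x\<in>{0..1}. norm (t l x) \<le> B * sqrt 8 * (2 powr (- \<alpha>)) ^ l"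
    using ev eventually_ge_at_top[of J0]
  proof eventually_elim
    case (elim l)
    have l: "l \<ge> 1" using elim(2) J0 by simp
    show ?case
    proof
      fix x :: real assume x: "x \<in> {0..1}"
      have "\<bar>\<Sum>k<2 ^ l. (sqrt (pvar (Inr (l, k))) * g (Inr (l, k))) * \<psi> l k x\<bar> \<le> B * sqrt (2 ^ l) * (sqrt (pvar (Inr (l, 0))) * sqrt (8 * real l))"
      proof (rule level_sum_bound[OF elim(2) x])
        fix k :: nat assume "k < 2 ^ l"
        then show "\<bar>sqrt (pvar (Inr (l, k))) * g (Inr (l, k))\<bar> \<le> sqrt (pvar (Inr (l, 0))) * sqrt (8 * real l)"
          using elim(1) unfolding abs_mult by (intro mult_mono) (auto simp: pvar_def)
      qed
      also have "\<dots> = B * (sqrt (2 ^ l) * sqrt (pvar (Inr (l, 0)))) * sqrt (8 * real l)" by simp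
      also have "\<dots> = B * sqrt 8 * 2 powr (- (real l * \<alpha>))"
        unfolding level_variance[OF l] using l by (simp add: real_sqrt_mult)
      also have "2 powr (- (real l * \<alpha>)) = (2 powr (- \<alpha>)) ^ l"
        by (simp add: powr_realpow[symmetric] powr_powr mult.commute)
      finally show "norm (t l x) \<le> B * sqrt 8 * (2 powr (- \<alpha>)) ^ l" using elim(2) by (simp add: t_def)
    qed
  qed
  moreover have "summable (\<lambda>l. B * sqrt 8 * (2 powr (- \<alpha>)) ^ l)"
    using \<alpha> by (intro summable_mult summable_geometric) (simp add: powr_less_one)
  ultimately have "uniform_limit {0..1} (\<lambda>n x. \<Sum>l<n. t l x) (\<lambda>x. suminf (\<lambda>l. t l x)) sequentially"
    by (rule Weierstrass_m_test_ev)
  then have "uniform_limit {0..1} (\<lambda>n x. \<Sum>l<Suc n. t l x) (\<lambda>x. suminf (\<lambda>l. t l x)) sequentially"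
    unfolding uniform_limit_sequentially_iff by (meson le_SucI)
  then have "uniform_limit {0..1} (\<lambda>n x. a x + (\<Sum>l<Suc n. t l x)) (\<lambda>x. a x + suminf (\<lambda>l. t l x)) sequentially"
    by (intro uniform_limit_add uniform_limit_const)
  then show ?thesis unfolding eq uniformly_convergent_on_def by blast
qed

text \<open>Borel-Cantelli. The threshold \<open>sqrt (8 * real l)\<close> gives each of the
  \<open>2 ^ l\<close> coefficients an exceedance probability of at most
  \<open>2 * exp (- 2 * real l)\<close>, and \<open>2 * exp (- 2) < 1\<close>.\<close>

lemma pconv_AE: "AE g in gaussian_coefficients. pconv g"
proof -
  interpret prob_space gaussian_coefficients by (rule prob_space_gaussian)
  let ?G = gaussian_coefficients
  define A where "A l = {g \<in> space ?G. \<not> (\<forall>k<2 ^ l. \<bar>g (Inr (l, k))\<bar> \<le> sqrt (8 * real l))}" for l :: nat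
  have A: "A l \<in> sets ?G" for l unfolding A_def by measurable
  have le: "measure ?G (A l) \<le> 2 * (2 * exp (-2)) ^ l" for l
  proof -
    have "A l = (\<Union>k\<in>{..<2 ^ l}. {g \<in> space ?G. \<bar>g (Inr (l, k))\<bar> > sqrt (8 * real l)})"
      by (auto simp: A_def not_le)
    then have "measure ?G (A l) \<le> (\<Sum>k\<in>{..<2 ^ l}. measure ?G {g \<in> space ?G. \<bar>g (Inr (l, k))\<bar> > sqrt (8 * real l)})"
      by (simp only:) (intro finite_measure_subadditive_finite; auto)
    also have "\<dots> \<le> (\<Sum>k\<in>{..<(2::nat) ^ l}. 2 * exp (- ((sqrt (8 * real l))\<^sup>2 / 4)))"
      by (intro sum_mono gaussian_coordinate_tail) simp
    also have "\<dots> = 2 * (2 ^ l * exp (real l * (-2)))" by simp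
    also have "\<dots> = 2 * (2 * exp (-2)) ^ l" by (simp only: exp_of_nat_mult power_mult_distrib)
    finally show ?thesis .
  qed
  have "exp (2::real) \<ge> 1 + 2" by (rule exp_ge_add_one_self)
  then have "\<bar>2 * exp (-2 :: real)\<bar> < 1" by (simp add: exp_minus field_simps)
  then have s: "summable (\<lambda>l. 2 * (2 * exp (-2 :: real)) ^ l)"
    by (intro summable_mult summable_geometric) simp
  have "AE g in ?G. \<forall>\<^sub>F l in sequentially. g \<in> space ?G - A l"
  proof (rule borel_cantelli_AE1)
    show "summable (\<lambda>l. measure ?G (A l))"
      by (rule summable_comparison_test'[OF s, of 0]) (use le in simp)
  qed (use A in \<open>auto simp: emeasure_eq_measure\<close>)
  then show ?thesis
  proof eventually_elim
    case (elim g)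
    then have "\<forall>\<^sub>F l in sequentially. \<forall>k<2 ^ l. \<bar>g (Inr (l, k))\<bar> \<le> sqrt (8 * real l)"
      by eventually_elim (simp add: A_def)
    then show ?case by (rule pconv_if_bounded)
  qed
qed

text \<open>Partial sums integrate to finite Gaussian sums, and uniform convergence passes to the
  limit. The result is kept as a limit over \<open>L\<close>: later only the effect of changing a
  single coefficient is read off, which is an eventually constant factor.\<close>

lemma prior_char:
  assumes u: "u \<in> borel_measurable borel" and b: "\<And>x. \<bar>u x\<bar> \<le> b"
  shows "(\<lambda>L. complex_of_real (exp (- ((\<Sum>i\<in>idx L. pvar i * (l2_inner (bas i) u)\<^sup>2) / 2)))) \<longlonglongrightarrow>
    (CLINT f|prior J0 \<phi> \<psi> \<alpha>. iexp (LINT x:{0..1}|lborel. f x * u x))"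
proof -
  interpret prob_space gaussian_coefficients by (rule prob_space_gaussian)
  let ?s = "prior_partial_sum J0 \<phi> \<psi> \<alpha>"
  let ?I = "\<lambda>f. LINT x:{0..1}|lborel. f x * u x"
  have Im: "?I \<in> borel_measurable C01" by (rule C01_set_integral_measurable[OF u]) simp
  have b0: "0 \<le> b" using order_trans[OF abs_ge_zero b] .
  have part: "?I (?s g L) = (\<Sum>i\<in>idx L. (sqrt (pvar i) * l2_inner (bas i) u) * g i)" for g L
  proof -
    have i: "set_integrable lborel {0..1} (\<lambda>x. bas i x * u x)" if "i \<in> idx L" for i
      using that by (intro set_integrable_continuous_mult[OF _ u b] bas_continuous) (auto simp: valid_def)
    have "?I (?s g L) = (LINT x:{0..1}|lborel. (\<Sum>i\<in>idx L. (sqrt (pvar i) * g i) * (bas i x * u x)))"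
      by (intro set_lebesgue_integral_cong) (auto simp: partial_sum_eq sum_distrib_right mult.assoc)
    also have "\<dots> = (\<Sum>i\<in>idx L. (LINT x:{0..1}|lborel. (sqrt (pvar i) * g i) * (bas i x * u x)))"
      unfolding set_lebesgue_integral_def scaleR_sum_right
      by (intro Bochner_Integration.integral_sum set_integrable_mult_right[unfolded set_integrable_def] i[unfolded set_integrable_def])
    also have "\<dots> = (\<Sum>i\<in>idx L. (sqrt (pvar i) * l2_inner (bas i) u) * g i)"
      by (intro sum.cong refl) (subst set_integral_mult_right, simp add: l2_inner_def)
    finally show ?thesis .
  qed
  have lim: "(\<lambda>L. ?I (?s g L)) \<longlonglongrightarrow> ?I (pfun g)" if g: "pconv g" for g
  proof (rule LIMSEQ_I)
    fix r :: real assume r: "r > 0"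
    define e where "e = r / (b + 1)"
    have e: "e > 0" using r b0 by (simp add: e_def)
    obtain N where N: "\<And>L x. L \<ge> N \<Longrightarrow> x \<in> {0..1} \<Longrightarrow> dist (?s g L x) (pfun g x) < e"
      using pfun_limit[OF g] e unfolding uniform_limit_sequentially_iff by blast
    show "\<exists>N. \<forall>L\<ge>N. norm (?I (?s g L) - ?I (pfun g)) < r"
    proof (intro exI[of _ N] allI impI)
      fix L assume L: "L \<ge> N"
      have i1: "set_integrable lborel {0..1} (\<lambda>x. ?s g L x * u x)"
        by (intro set_integrable_continuous_mult[OF _ u b] partial_sum_continuous)
      have i2: "set_integrable lborel {0..1} (\<lambda>x. pfun g x * u x)"
        by (intro set_integrable_continuous_mult[OF _ u b] C01_continuous pfun_C01)
      have "norm (?I (?s g L) - ?I (pfun g)) = norm (LINT x:{0..1}|lborel. ?s g L x * u x - pfun g x * u x)"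
        using i1 i2 by simp
      also have "\<dots> \<le> (LINT x:{0..1}|lborel. norm (?s g L x * u x - pfun g x * u x))"
        using i1 i2 by (intro set_integral_norm_bound set_integral_diff)
      also have "\<dots> \<le> (LINT x::real:{0..1}|lborel. e * b)"
      proof (rule set_integral_mono)
        show "set_integrable lborel {0..1} (\<lambda>x. norm (?s g L x * u x - pfun g x * u x))"
          using i1 i2 by (intro set_integrable_norm set_integral_diff)
        show "set_integrable lborel {0..1} (\<lambda>x::real. e * b)"
          by (intro borel_integrable_atLeastAtMost' continuous_on_const)
        fix x :: real assume x: "x \<in> {0..1}"
        have "norm (?s g L x * u x - pfun g x * u x) = dist (?s g L x) (pfun g x) * \<bar>u x\<bar>"
          by (simp add: dist_real_def abs_mult[symmetric] left_diff_distrib)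
        also have "\<dots> \<le> e * b" using N[OF L x] b[of x] e by (intro mult_mono) auto
        finally show "norm (?s g L x * u x - pfun g x * u x) \<le> e * b" .
      qed
      also have "\<dots> = e * b" by (simp add: set_lebesgue_integral_def)
      also have "\<dots> < r" using r b0 by (simp add: e_def field_simps)
      finally show "norm (?I (?s g L) - ?I (pfun g)) < r" .
    qed
  qed
  have "(\<lambda>L. CLINT g|gaussian_coefficients. iexp (?I (?s g L))) \<longlonglongrightarrow> (CLINT g|gaussian_coefficients. iexp (?I (pfun g)))"
  proof (rule integral_dominated_convergence[where w="\<lambda>_. 1"])
    have [measurable]: "(\<lambda>g. ?I (pfun g)) \<in> borel_measurable gaussian_coefficients"
      by (rule measurable_compose[OF pfun_measurable Im])
    show "(\<lambda>g. iexp (?I (pfun g))) \<in> borel_measurable gaussian_coefficients" by measurable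
    show "(\<lambda>g. iexp (?I (?s g L))) \<in> borel_measurable gaussian_coefficients" for L
      unfolding part by measurable
    show "AE g in gaussian_coefficients. (\<lambda>L. iexp (?I (?s g L))) \<longlonglongrightarrow> iexp (?I (pfun g))"
      using pconv_AE by eventually_elim (intro tendsto_intros lim)
  qed auto
  moreover have "(CLINT g|gaussian_coefficients. iexp (?I (?s g L))) = complex_of_real (exp (- ((\<Sum>i\<in>idx L. pvar i * (l2_inner (bas i) u)\<^sup>2) / 2)))" for L
  proof -
    have "(\<Sum>i\<in>idx L. (sqrt (pvar i) * l2_inner (bas i) u)\<^sup>2) = (\<Sum>i\<in>idx L. pvar i * (l2_inner (bas i) u)\<^sup>2)"
    proof (intro sum.cong refl)
      fix i assume "i \<in> idx L"
      then have "pvar i \<ge> 0" using pvar_pos[of i] by (force simp: valid_def)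
      then show "(sqrt (pvar i) * l2_inner (bas i) u)\<^sup>2 = pvar i * (l2_inner (bas i) u)\<^sup>2" by (simp add: power_mult_distrib)
    qed
    then show ?thesis unfolding part gaussian_char[OF finite_idx] by simp
  qed
  moreover have "(CLINT g|gaussian_coefficients. iexp (?I (pfun g))) = (CLINT f|prior J0 \<phi> \<psi> \<alpha>. iexp (?I f))"
    unfolding prior_eq using Im by (subst integral_distr) auto
  ultimately show ?thesis by simp
qed

end

section \<open>The posterior of a single coefficient\<close>

lemma integrand_mult_integrable:
  assumes "integrand u" "integrand w"
  shows "set_integrable lborel {0..1} (\<lambda>x. u x * w x)"
proof -
  obtain B C where b: "\<And>x. \<bar>u x\<bar> \<le> B" "\<And>x. \<bar>w x\<bar> \<le> C" using assms by (auto simp: integrand_def)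
  have "\<bar>u x * w x\<bar> \<le> B * C" for x
    unfolding abs_mult by (intro mult_mono b) (use order_trans[OF abs_ge_zero b(1)] in auto)
  moreover have "(\<lambda>x. u x * w x) \<in> borel_measurable borel" using assms by (auto simp: integrand_def)
  ultimately have "set_integrable lborel {0..1} (\<lambda>x. 1 * (u x * w x))"
    by (intro set_integrable_continuous_mult) auto
  then show ?thesis by simp
qed

lemma integrand_continuous_integrable:
  assumes "continuous_on {0..1} f" "integrand u"
  shows "set_integrable lborel {0..1} (\<lambda>x. f x * u x)"
proof -
  obtain C where "\<And>x. \<bar>u x\<bar> \<le> C" using assms(2) by (auto simp: integrand_def)
  then show ?thesis using assms by (intro set_integrable_continuous_mult) (auto simp: integrand_def)
qed

lemma l2_inner_linear:
  assumes "set_integrable lborel {0..1} (\<lambda>x. f x * u x)" "set_integrable lborel {0..1} (\<lambda>x. f x * w x)"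
  shows "l2_inner f (\<lambda>x. c * u x + w x) = c * l2_inner f u + l2_inner f w"
proof -
  have "l2_inner f (\<lambda>x. c * u x + w x) = (LINT x:{0..1}|lborel. c * (f x * u x) + f x * w x)"
    by (simp add: l2_inner_def distrib_left mult.left_commute)
  also have "\<dots> = (LINT x:{0..1}|lborel. c * (f x * u x)) + (LINT x:{0..1}|lborel. f x * w x)"
    using assms by (intro set_integral_add) auto
  finally show ?thesis by (simp add: l2_inner_def)
qed

lemma complex_integral_product:
  fixes f :: "'a \<Rightarrow> complex" and g :: "'b \<Rightarrow> complex"
  assumes "prob_space M" "prob_space N" and [measurable]: "f \<in> borel_measurable M" "g \<in> borel_measurable N"
    and b: "\<And>x. cmod (f x) \<le> 1" "\<And>x. cmod (g x) \<le> 1"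
  shows "(CLINT z|M \<Otimes>\<^sub>M N. f (fst z) * g (snd z)) = (CLINT x|M. f x) * (CLINT y|N. g y)"
proof -
  interpret M: prob_space M by fact
  interpret N: prob_space N by fact
  interpret P: pair_prob_space M N ..
  have "integrable (M \<Otimes>\<^sub>M N) (\<lambda>z. f (fst z) * g (snd z))"
    by (intro P.P.integrable_const_bound[where B=1] AE_I2) (auto simp: norm_mult intro: mult_le_one b)
  then have "(CLINT z|M \<Otimes>\<^sub>M N. f (fst z) * g (snd z)) = (CLINT x|M. CLINT y|N. f x * g y)"
    using P.integral_fst'[of "\<lambda>z. f (fst z) * g (snd z)"] by simp
  also have "\<dots> = (CLINT x|M. f x) * (CLINT y|N. g y)" by simp
  finally show ?thesis .
qed

lemma wiener_path_integral_tail: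
  assumes W: "wiener_measure W" and u: "integrand u" "(LINT x:{0..1}|lborel. (u x)\<^sup>2) = 1" and t: "t \<ge> 0"
  shows "measure W {b \<in> space W. \<bar>path_integral u b\<bar> > t} \<le> 2 * exp (- (t\<^sup>2 / 4))"
proof -
  interpret prob_space W by (rule wiener_properties[OF W])
  have m: "path_integral u \<in> borel_measurable W"
    using path_integral_measurable[OF u(1)] by (simp add: measurable_cong_sets[OF wiener_properties(2)[OF W] refl])
  have "measure W {b \<in> space W. b \<in> space W \<and> path_integral u b \<in> {x. \<bar>x\<bar> > t}} =
      measure (density lborel (normal_density 0 1)) {x. \<bar>x\<bar> > t} * measure W (space W)"
  proof (rule conditional_normal[OF m])
    fix a
    have "(CLINT b|W. indicator (space W) b * iexp (a * path_integral u b)) = (CLINT b|W. iexp (a * path_integral u b))"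
      by (intro Bochner_Integration.integral_cong) auto
    also have "\<dots> = exp (- (1\<^sup>2 * a\<^sup>2 / 2)) * measure W (space W)"
      unfolding wiener_char[OF W u(1)] u(2) by (simp add: prob_space)
    finally show "(CLINT b|W. indicator (space W) b * iexp (a * path_integral u b)) = exp (- (1\<^sup>2 * a\<^sup>2 / 2)) * measure W (space W)" .
  qed auto
  then have "measure W {b \<in> space W. \<bar>path_integral u b\<bar> > t} = measure (density lborel (normal_density 0 1)) {x. \<bar>x\<bar> > t}"
    by (simp add: prob_space)
  also have "\<dots> \<le> 2 * exp (- (t\<^sup>2 / 4))" using normal_tail[of 1 t] t by simp
  finally show ?thesis .
qed

text \<open>A single coefficient \<open>i\<close> is fixed: the union bound at the end consumes
  one-dimensional posterior marginals, so the conjugate computation is carried out for each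
  coefficient separately.\<close>

locale posterior_coordinate = wavelet_prior +
  fixes W :: "(real \<Rightarrow> real) measure" and n :: nat and Q :: "(real \<Rightarrow> real) \<Rightarrow> (real \<Rightarrow> real) measure"
    and i :: "nat + nat \<times> nat"
  assumes W: "wiener_measure W" and n: "n \<ge> 1" and Q: "posterior W (prior J0 \<phi> \<psi> \<alpha>) n Q" and i: "i \<in> valid"
begin

abbreviation "P \<equiv> prior J0 \<phi> \<psi> \<alpha>"
abbreviation "JJ \<equiv> P \<Otimes>\<^sub>M W"
abbreviation "e \<equiv> bas i"

text \<open>Given the observation \<open>Y\<close>, the posterior law of the coefficient will be \<open>N(\<rho> \<langle>e, dY\<rangle>, \<rho> / n)\<close>.\<close>

definition \<rho> :: real where "\<rho> = real n * pvar i / (real n * pvar i + 1)"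
definition obs :: "(real \<Rightarrow> real) \<times> (real \<Rightarrow> real) \<Rightarrow> real \<Rightarrow> real" where "obs z = observation n (fst z) (snd z)"
definition res :: "(real \<Rightarrow> real) \<times> (real \<Rightarrow> real) \<Rightarrow> real" where
  "res z = l2_inner (fst z) e - \<rho> * path_integral e (obs z)"

lemma prob_P: "prob_space P" and prob_W: "prob_space W" and prob_JJ: "prob_space JJ"
proof -
  show P: "prob_space P" by (rule prob_space_prior)
  show W': "prob_space W" by (rule wiener_properties[OF W])
  interpret P0: prob_space P by fact
  interpret W0: prob_space W by fact
  interpret PW: pair_prob_space P W ..
  show "prob_space JJ" by (rule PW.P.prob_space_axioms)
qed

lemma sets_JJ [measurable_cong]: "sets JJ = sets (C01 \<Otimes>\<^sub>M C01)"
  by (intro sets_pair_measure_cong sets_prior wiener_properties(2)[OF W])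

lemma space_JJ: "space JJ = space C01 \<times> space C01"
  by (simp add: space_pair_measure sets_prior wiener_properties(3)[OF W])

lemma sets_W [measurable_cong]: "sets W = sets C01" by (rule wiener_properties(2)[OF W])

lemma sets_P [measurable_cong]: "sets P = sets C01" by (rule sets_prior)

lemma integrand_e: "integrand e" by (rule bas_integrand[OF i])

lemma obs_measurable [measurable]: "obs \<in> measurable JJ C01"
proof -
  have "obs \<in> measurable (C01 \<Otimes>\<^sub>M C01) C01"
    using observation_measurable_pair[of n] by (simp add: obs_def[abs_def] split_def)
  then show ?thesis by (simp add: measurable_cong_sets[OF sets_JJ refl])
qed

lemma l2_measurable [measurable]: "integrand u \<Longrightarrow> (\<lambda>f. l2_inner f u) \<in> borel_measurable C01"
  unfolding l2_inner_def by (rule C01_set_integral_measurable) (auto simp: integrand_def)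

lemma res_measurable [measurable]: "res \<in> borel_measurable JJ"
proof -
  note [measurable] = l2_measurable[OF integrand_e] path_integral_measurable[OF integrand_e]
  show ?thesis unfolding res_def[abs_def] by measurable
qed

text \<open>\<open>rho_eq\<close> is the decorrelation identity: the residual carries the signal
  with weight \<open>1 - \<rho>\<close> and the noise with weight \<open>- \<rho>\<close>, so its
  covariances with the data through signal and noise are \<open>pvar i * (1 - \<rho>)\<close> and
  \<open>- \<rho> / n\<close>. The common value is also the posterior variance.\<close>

lemma one_minus_rho: "1 - \<rho> = 1 / (real n * pvar i + 1)"
  and rho_pos: "\<rho> > 0" and rho_le: "\<rho> \<le> 1" and rho_eq: "pvar i * (1 - \<rho>) = \<rho> / n"
proof -
  have p: "real n * pvar i > 0" "real n > 0" using pvar_pos[OF i] n by auto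
  then show 1: "1 - \<rho> = 1 / (real n * pvar i + 1)" by (simp add: \<rho>_def field_simps)
  show "\<rho> > 0" "\<rho> \<le> 1" using p by (auto simp: \<rho>_def)
  show "pvar i * (1 - \<rho>) = \<rho> / n" unfolding 1 using p by (simp add: \<rho>_def)
qed

lemma norm_e: "(LINT x:{0..1}|lborel. (e x)\<^sup>2) = 1"
  using bas_orthonormal[OF i i] by (simp add: l2_inner_def power2_eq_square)

lemma joint_char:
  assumes u: "integrand u" and w: "integrand w"
  shows "(CLINT z|JJ. iexp (l2_inner (fst z) u + path_integral w (snd z) / sqrt n)) =
    (CLINT f|P. iexp (l2_inner f u)) * complex_of_real (exp (- (LINT x:{0..1}|lborel. (w x)\<^sup>2) / (2 * n)))"
proof -
  note [measurable] = l2_measurable[OF u] path_integral_measurable[OF w]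
  have "(CLINT z|JJ. iexp (l2_inner (fst z) u + path_integral w (snd z) / sqrt n)) =
      (CLINT z|JJ. iexp (l2_inner (fst z) u) * iexp (1 / sqrt n * path_integral w (snd z)))"
    by (simp add: exp_add[symmetric] distrib_left)
  also have "\<dots> = (CLINT f|P. iexp (l2_inner f u)) * (CLINT b|W. iexp (1 / sqrt n * path_integral w b))"
    by (intro complex_integral_product prob_P prob_W) (simp_all, measurable)
  also have "(CLINT b|W. iexp (1 / sqrt n * path_integral w b)) = complex_of_real (exp (- (LINT x:{0..1}|lborel. (w x)\<^sup>2) / (2 * n)))"
    unfolding wiener_char[OF W w] using n by (simp add: power_divide)
  finally show ?thesis .
qed

text \<open>By orthonormality, adding a multiple of \<open>e\<close> changes only the
  \<open>i\<close>-th term of the quadratic form. Once \<open>idx L\<close> contains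
  \<open>i\<close> the two exponentials differ by a fixed factor, which survives the limit.\<close>

lemma prior_char_shift:
  assumes u: "integrand u"
  shows "(CLINT f|P. iexp (l2_inner f (\<lambda>x. A * e x + u x))) =
    complex_of_real (exp (- (pvar i * (A\<^sup>2 + 2 * A * l2_inner e u)) / 2)) * (CLINT f|P. iexp (l2_inner f u))"
proof -
  have w: "integrand (\<lambda>x. A * e x + u x)" by (rule integrand_linear[OF integrand_e u])
  have lim: "(\<lambda>L. complex_of_real (exp (- ((\<Sum>j\<in>idx L. pvar j * (l2_inner (bas j) h)\<^sup>2) / 2)))) \<longlonglongrightarrow> (CLINT f|P. iexp (l2_inner f h))"
    if h: "integrand h" for h
  proof -
    obtain C where "\<And>x. \<bar>h x\<bar> \<le> C" using h by (auto simp: integrand_def)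
    then show ?thesis using prior_char[of h C] h unfolding l2_inner_def by (simp add: integrand_def)
  qed
  obtain L0 where L0: "i \<in> idx L0" using i by (auto simp: valid_def)
  have S: "(\<Sum>j\<in>idx L. pvar j * (l2_inner (bas j) (\<lambda>x. A * e x + u x))\<^sup>2) =
      (\<Sum>j\<in>idx L. pvar j * (l2_inner (bas j) u)\<^sup>2) + pvar i * (A\<^sup>2 + 2 * A * l2_inner e u)" if L: "L \<ge> L0" for L
  proof -
    have iL: "i \<in> idx L" using idx_mono[OF L] L0 by blast
    have "(\<Sum>j\<in>idx L. pvar j * (l2_inner (bas j) (\<lambda>x. A * e x + u x))\<^sup>2) =
        (\<Sum>j\<in>idx L. pvar j * (l2_inner (bas j) u)\<^sup>2 + (if j = i then pvar i * (A\<^sup>2 + 2 * A * l2_inner e u) else 0))"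
    proof (intro sum.cong refl)
      fix j assume j: "j \<in> idx L"
      then have jv: "j \<in> valid" by (auto simp: valid_def)
      have "l2_inner (bas j) (\<lambda>x. A * e x + u x) = A * l2_inner (bas j) e + l2_inner (bas j) u"
        by (intro l2_inner_linear integrand_mult_integrable bas_integrand jv i u)
      then have eq: "l2_inner (bas j) (\<lambda>x. A * e x + u x) = A * of_bool (j = i) + l2_inner (bas j) u"
        using bas_orthonormal[OF jv i] by simp
      show "pvar j * (l2_inner (bas j) (\<lambda>x. A * e x + u x))\<^sup>2 =
         pvar j * (l2_inner (bas j) u)\<^sup>2 + (if j = i then pvar i * (A\<^sup>2 + 2 * A * l2_inner e u) else 0)"
        unfolding eq by (cases "j = i") (simp_all add: power2_eq_square algebra_simps)
    qed
    also have "\<dots> = (\<Sum>j\<in>idx L. pvar j * (l2_inner (bas j) u)\<^sup>2) + pvar i * (A\<^sup>2 + 2 * A * l2_inner e u)"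
      unfolding sum.distrib using iL finite_idx by simp
    finally show ?thesis .
  qed
  have "(\<lambda>L. complex_of_real (exp (- (pvar i * (A\<^sup>2 + 2 * A * l2_inner e u)) / 2)) *
      complex_of_real (exp (- ((\<Sum>j\<in>idx L. pvar j * (l2_inner (bas j) u)\<^sup>2) / 2))))
      \<longlonglongrightarrow> complex_of_real (exp (- (pvar i * (A\<^sup>2 + 2 * A * l2_inner e u)) / 2)) * (CLINT f|P. iexp (l2_inner f u))"
    by (intro tendsto_mult tendsto_const lim u)
  moreover have "\<forall>\<^sub>F L in sequentially. complex_of_real (exp (- (pvar i * (A\<^sup>2 + 2 * A * l2_inner e u)) / 2)) *
      complex_of_real (exp (- ((\<Sum>j\<in>idx L. pvar j * (l2_inner (bas j) u)\<^sup>2) / 2))) =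
      complex_of_real (exp (- ((\<Sum>j\<in>idx L. pvar j * (l2_inner (bas j) (\<lambda>x. A * e x + u x))\<^sup>2) / 2)))"
    using eventually_ge_at_top[of L0]
    by eventually_elim (simp only: S of_real_mult[symmetric] exp_add[symmetric], simp add: field_simps)
  ultimately have "(\<lambda>L. complex_of_real (exp (- ((\<Sum>j\<in>idx L. pvar j * (l2_inner (bas j) (\<lambda>x. A * e x + u x))\<^sup>2) / 2))))
      \<longlonglongrightarrow> complex_of_real (exp (- (pvar i * (A\<^sup>2 + 2 * A * l2_inner e u)) / 2)) * (CLINT f|P. iexp (l2_inner f u))"
    by (rule Lim_transform_eventually)
  then show ?thesis using LIMSEQ_unique[OF lim[OF w]] by blast
qed

text \<open>The residual \<open>res\<close> and the observation are jointly Gaussian, and \<open>\<rho>\<close> is chosen so that they are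
  uncorrelated, that is, so that the mixed term in the joint characteristic function cancels.\<close>

lemma res_obs_char:
  assumes J: "finite J" "J \<subseteq> unit_dyadics"
  shows "(CLINT z|JJ. iexp (a * res z) * iexp (\<Sum>t\<in>J. c t * obs z t)) =
    complex_of_real (exp (- ((\<rho> / n) * a\<^sup>2 / 2))) * (CLINT z|JJ. iexp (\<Sum>t\<in>J. c t * obs z t))"
proof -
  interpret prob_space JJ by (rule prob_JJ)
  \<comment> \<open>The step function whose path integral against the observation is
    \<open>\<Sum>t\<in>J. c t * obs z t\<close>; this uses that the observation starts at 0, which
    holds almost surely.\<close>
  define u where "u x = (\<Sum>t\<in>J. c t * indicator {0..<t} x)" for x :: real
  have uu: "integrand u \<and> (\<forall>b. continuous_on {0..1} b \<longrightarrow> path_integral u b = (\<Sum>t\<in>J. c t * path_integral (indicator {0..<t}) b))"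
    unfolding u_def using J by (intro integrand_sum integrand_indicator) auto
  then have u: "integrand u" by blast
  have up: "path_integral u b = (\<Sum>t\<in>J. c t * (b t - b 0))" if "continuous_on {0..1} b" for b
    using uu that J by (auto simp: path_integral_indicator subset_eq intro!: sum.cong)
  \<comment> \<open>Collecting terms, the exponent is linear in the independent pair:
    \<open>\<eta>\<close> is integrated against the function and \<open>w\<close> against the
    noise.\<close>
  define w where "w x = (- a * \<rho>) * e x + u x" for x
  have w: "integrand w" unfolding w_def by (rule integrand_linear[OF integrand_e u])
  define \<eta> where "\<eta> x = (a * (1 - \<rho>)) * e x + u x" for x
  have \<eta>: "integrand \<eta>" unfolding \<eta>_def by (rule integrand_linear[OF integrand_e u])
  have AEb: "AE z in JJ. snd z 0 = 0"
  proof -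
    interpret P0: prob_space P by (rule prob_P)
    interpret W0: prob_space W by (rule prob_W)
    interpret PW: pair_prob_space P W ..
    have [measurable]: "(\<lambda>b. b 0) \<in> borel_measurable C01" by (rule C01_eval) simp
    have "AE f in P. AE b in W. b 0 = 0" using wiener_properties(4)[OF W] by simp
    then have "AE z in JJ. (case z of (f, b) \<Rightarrow> b 0 = 0)"
      by (intro PW.AE_pair_measure) (auto simp: split_beta)
    then show ?thesis by (simp add: split_beta)
  qed
  have key: "a * res z + (\<Sum>t\<in>J. c t * obs z t) = l2_inner (fst z) \<eta> + path_integral w (snd z) / sqrt n"
    "(\<Sum>t\<in>J. c t * obs z t) = l2_inner (fst z) u + path_integral u (snd z) / sqrt n"
    if z: "z \<in> space JJ" "snd z 0 = 0" for z
  proof -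
    have zc: "continuous_on {0..1} (fst z)" "continuous_on {0..1} (snd z)"
      using z by (auto simp: space_JJ C01_continuous)
    have oc: "continuous_on {0..1} (obs z)" unfolding obs_def by (intro C01_continuous observation_in_C01 zc)
    have o0: "obs z 0 = 0" unfolding obs_def observation_def using z(2) by (simp add: primitive_at_0[unfolded atLeastAtMost_singleton])
    have pio: "path_integral h (obs z) = l2_inner (fst z) h + path_integral h (snd z) / sqrt n" if "integrand h" for h
      unfolding obs_def l2_inner_def by (rule path_integral_observation[OF that zc])
    have s: "(\<Sum>t\<in>J. c t * obs z t) = path_integral u (obs z)"
      unfolding up[OF oc] o0 by simp
    show 2: "(\<Sum>t\<in>J. c t * obs z t) = l2_inner (fst z) u + path_integral u (snd z) / sqrt n"
      unfolding s by (rule pio[OF u])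
    have h1: "l2_inner (fst z) \<eta> = a * (1 - \<rho>) * l2_inner (fst z) e + l2_inner (fst z) u"
      unfolding \<eta>_def by (intro l2_inner_linear integrand_continuous_integrable zc integrand_e u)
    have h2: "path_integral w (snd z) = - a * \<rho> * path_integral e (snd z) + path_integral u (snd z)"
      unfolding w_def by (rule path_integral_linear[OF integrand_e u zc(2)])
    have h3: "res z = l2_inner (fst z) e - \<rho> * (l2_inner (fst z) e + path_integral e (snd z) / sqrt n)"
      unfolding res_def pio[OF integrand_e] ..
    show "a * res z + (\<Sum>t\<in>J. c t * obs z t) = l2_inner (fst z) \<eta> + path_integral w (snd z) / sqrt n"
      unfolding 2 h1 h2 h3 by (simp add: algebra_simps add_divide_distrib diff_divide_distrib)
  qed
  have [measurable]: "(\<lambda>z. obs z t) \<in> borel_measurable JJ" if "t \<in> J" for t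
    using that J unit_dyadics_subset by (intro measurable_compose[OF obs_measurable C01_eval]) auto
  note [measurable] = l2_measurable[OF u] l2_measurable[OF \<eta>] path_integral_measurable[OF w] path_integral_measurable[OF u]
  have wsq: "(LINT x:{0..1}|lborel. (w x)\<^sup>2) = (a * \<rho>)\<^sup>2 - 2 * a * \<rho> * l2_inner e u + (LINT x:{0..1}|lborel. (u x)\<^sup>2)"
  proof -
    have "l2_inner w w = - a * \<rho> * l2_inner w e + l2_inner w u"
      unfolding w_def[abs_def] by (intro l2_inner_linear integrand_mult_integrable integrand_e u integrand_linear)
    moreover have "l2_inner w e = - a * \<rho> * l2_inner e e + l2_inner e u"
      unfolding l2_inner_commute[of w] unfolding w_def[abs_def] by (intro l2_inner_linear integrand_mult_integrable integrand_e u)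
    moreover have "l2_inner w u = - a * \<rho> * l2_inner e u + l2_inner u u"
      unfolding l2_inner_commute[of w] l2_inner_commute[of e] unfolding w_def[abs_def] by (intro l2_inner_linear integrand_mult_integrable integrand_e u)
    moreover have "l2_inner e e = 1" using bas_orthonormal[OF i i] by simp
    ultimately have "l2_inner w w = (a * \<rho>)\<^sup>2 - 2 * a * \<rho> * l2_inner e u + l2_inner u u"
      by (simp add: power2_eq_square algebra_simps)
    then show ?thesis by (simp add: l2_inner_def power2_eq_square)
  qed
  have "(CLINT z|JJ. iexp (a * res z) * iexp (\<Sum>t\<in>J. c t * obs z t)) = (CLINT z|JJ. iexp (a * res z + (\<Sum>t\<in>J. c t * obs z t)))"
    by (intro Bochner_Integration.integral_cong refl) (simp add: exp_add[symmetric] distrib_left)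
  also have "\<dots> = (CLINT z|JJ. iexp (l2_inner (fst z) \<eta> + path_integral w (snd z) / sqrt n))"
  proof (rule integral_cong_AE)
    show "AE z in JJ. iexp (a * res z + (\<Sum>t\<in>J. c t * obs z t)) = iexp (l2_inner (fst z) \<eta> + path_integral w (snd z) / sqrt n)"
      using AEb AE_space by eventually_elim (simp only: key(1))
  qed measurable
  also have "\<dots> = (CLINT f|P. iexp (l2_inner f \<eta>)) * complex_of_real (exp (- (LINT x:{0..1}|lborel. (w x)\<^sup>2) / (2 * n)))"
    by (rule joint_char[OF \<eta> w])
  also have "(CLINT f|P. iexp (l2_inner f \<eta>)) =
      complex_of_real (exp (- (pvar i * ((a * (1 - \<rho>))\<^sup>2 + 2 * (a * (1 - \<rho>)) * l2_inner e u)) / 2)) * (CLINT f|P. iexp (l2_inner f u))"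
    unfolding \<eta>_def[abs_def] by (rule prior_char_shift[OF u])
  also have "complex_of_real (exp (- (pvar i * ((a * (1 - \<rho>))\<^sup>2 + 2 * (a * (1 - \<rho>)) * l2_inner e u)) / 2)) * (CLINT f|P. iexp (l2_inner f u))
      * complex_of_real (exp (- (LINT x:{0..1}|lborel. (w x)\<^sup>2) / (2 * n)))
    = complex_of_real (exp (- ((\<rho> / n) * a\<^sup>2 / 2))) * ((CLINT f|P. iexp (l2_inner f u)) * complex_of_real (exp (- (LINT x:{0..1}|lborel. (u x)\<^sup>2) / (2 * n))))"
  proof -
    let ?U = "LINT x:{0..1}|lborel. (u x)\<^sup>2" and ?k = "l2_inner e u"
    have r2: "pvar i * ((a * (1 - \<rho>))\<^sup>2 + 2 * (a * (1 - \<rho>)) * ?k) = (pvar i * (1 - \<rho>)) * (a\<^sup>2 * (1 - \<rho>) + 2 * a * ?k)"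
      by (simp add: power2_eq_square algebra_simps)
    \<comment> \<open>By \<open>rho_eq\<close> the two terms in \<open>a * ?k\<close> cancel, and
      the quadratic terms combine as
      \<open>(\<rho> / n) * ((1 - \<rho>) + \<rho>) * a\<^sup>2 / 2\<close>.\<close>
    have "- (pvar i * ((a * (1 - \<rho>))\<^sup>2 + 2 * (a * (1 - \<rho>)) * ?k)) / 2 + (- ((a * \<rho>)\<^sup>2 - 2 * a * \<rho> * ?k + ?U) / (2 * n))
       = - ((\<rho> / n) * a\<^sup>2 / 2) + (- ?U / (2 * n))"
      unfolding r2 rho_eq using n by (simp add: field_simps power2_eq_square)
    then have "exp (- (pvar i * ((a * (1 - \<rho>))\<^sup>2 + 2 * (a * (1 - \<rho>)) * ?k)) / 2) * exp (- ((a * \<rho>)\<^sup>2 - 2 * a * \<rho> * ?k + ?U) / (2 * n))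
       = exp (- ((\<rho> / n) * a\<^sup>2 / 2)) * exp (- ?U / (2 * n))"
      by (simp only: exp_add[symmetric])
    then have "complex_of_real (exp (- (pvar i * ((a * (1 - \<rho>))\<^sup>2 + 2 * (a * (1 - \<rho>)) * ?k)) / 2)) * complex_of_real (exp (- ((a * \<rho>)\<^sup>2 - 2 * a * \<rho> * ?k + ?U) / (2 * n)))
       = complex_of_real (exp (- ((\<rho> / n) * a\<^sup>2 / 2))) * complex_of_real (exp (- ?U / (2 * n)))"
      by (simp only: of_real_mult[symmetric])
    moreover have "(x * y) * z = x' * (y * z')" if xz: "x * z = x' * z'" for x y z x' z' :: complex
    proof -
      have "(x * y) * z = (x * z) * y" by (simp only: mult_ac)
      also have "\<dots> = x' * (y * z')" unfolding xz by (simp only: mult_ac)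
      finally show ?thesis .
    qed
    ultimately show ?thesis unfolding wsq by blast
  qed
  also have "(CLINT f|P. iexp (l2_inner f u)) * complex_of_real (exp (- (LINT x:{0..1}|lborel. (u x)\<^sup>2) / (2 * n)))
      = (CLINT z|JJ. iexp (l2_inner (fst z) u + path_integral u (snd z) / sqrt n))"
    by (rule joint_char[OF u u, symmetric])
  also have "\<dots> = (CLINT z|JJ. iexp (\<Sum>t\<in>J. c t * obs z t))"
  proof (rule integral_cong_AE)
    show "AE z in JJ. iexp (l2_inner (fst z) u + path_integral u (snd z) / sqrt n) = iexp (\<Sum>t\<in>J. c t * obs z t)"
      using AEb AE_space by eventually_elim (simp only: key(2))
  qed measurable
  finally show ?thesis .
qed

text \<open>The bounded weight \<open>iexp (a * res z)\<close> minus its would-be mean is orthogonal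
  to all exponentials of the path at dyadic times, by \<open>res_obs_char\<close>. Hence it
  integrates to zero over every event of the observation, and \<open>conditional_normal\<close>
  identifies the law of the residual given that event.\<close>

lemma res_independent:
  assumes D: "D \<in> sets C01" and A: "A \<in> sets borel"
  shows "measure JJ {z \<in> space JJ. obs z \<in> D \<and> res z \<in> A} =
    measure (density lborel (normal_density 0 (sqrt (\<rho> / n)))) A * measure JJ (obs -` D \<inter> space JJ)"
proof -
  interpret prob_space JJ by (rule prob_JJ)
  let ?D = "obs -` D \<inter> space JJ"
  have v: "\<rho> / n > 0" using rho_pos n by simp
  have D': "?D \<in> sets JJ" by (rule measurable_sets[OF obs_measurable D])
  have "(CLINT z|JJ. indicator ?D z * iexp (a * res z)) = complex_of_real (exp (- ((sqrt (\<rho> / n))\<^sup>2 * a\<^sup>2 / 2)) * measure JJ ?D)" for a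
  proof -
    let ?c = "exp (- ((\<rho> / n) * a\<^sup>2 / 2))"
    have "0 \<le> (\<rho> / n) * a\<^sup>2 / 2" by (intro less_imp_le[OF v] divide_nonneg_pos mult_nonneg_nonneg) auto
    then have c1: "?c \<le> 1" by (simp only: exp_le_one_iff neg_le_0_iff_le)
    have "(CLINT z:?D|JJ. iexp (a * res z) - complex_of_real ?c) = 0"
    proof (rule weighted_char_zero_path[OF obs_measurable _ _ _ D, where K=2])
      show "cmod (iexp (a * res z) - complex_of_real ?c) \<le> 2" for z
      proof -
        have "cmod (iexp (a * res z) - complex_of_real ?c) \<le> cmod (iexp (a * res z)) + cmod (complex_of_real ?c)"
          by (rule norm_triangle_ineq4)
        also have "\<dots> = 1 + ?c" by (simp only: norm_exp_i_times norm_of_real abs_exp_cancel)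
        finally show ?thesis using c1 by linarith
      qed
      fix J :: "real set" and b :: "real \<Rightarrow> real" assume J: "finite J" "J \<subseteq> unit_dyadics"
      have [measurable]: "(\<lambda>z. obs z t) \<in> borel_measurable JJ" if "t \<in> J" for t
        using that J unit_dyadics_subset by (intro measurable_compose[OF obs_measurable C01_eval]) auto
      have "(CLINT z|JJ. (iexp (a * res z) - complex_of_real ?c) * iexp (\<Sum>t\<in>J. b t * obs z t)) =
         (CLINT z|JJ. iexp (a * res z) * iexp (\<Sum>t\<in>J. b t * obs z t) - complex_of_real ?c * iexp (\<Sum>t\<in>J. b t * obs z t))"
        by (simp only: left_diff_distrib)
      also have "\<dots> = (CLINT z|JJ. iexp (a * res z) * iexp (\<Sum>t\<in>J. b t * obs z t)) - (CLINT z|JJ. complex_of_real ?c * iexp (\<Sum>t\<in>J. b t * obs z t))"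
        by (intro Bochner_Integration.integral_diff integrable_const_bound[where B=1] AE_I2)
          (use c1 in \<open>simp_all add: norm_mult del: of_real_mult of_real_sum\<close>)
      also have "\<dots> = 0" unfolding res_obs_char[OF J] by simp
      finally show "(CLINT z|JJ. (iexp (a * res z) - complex_of_real ?c) * iexp (\<Sum>t\<in>J. b t * obs z t)) = 0" .
    qed measurable
    moreover have "(CLINT z:?D|JJ. iexp (a * res z) - complex_of_real ?c) = (CLINT z|JJ. indicator ?D z * iexp (a * res z) - complex_of_real ?c * indicator ?D z)"
      unfolding set_lebesgue_integral_def by (intro Bochner_Integration.integral_cong) (auto split: split_indicator)
    moreover have "\<dots> = (CLINT z|JJ. indicator ?D z * iexp (a * res z)) - (CLINT z|JJ. complex_of_real ?c * indicator ?D z)"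
      using D' c1 by (intro Bochner_Integration.integral_diff integrable_const_bound[where B=1] AE_I2)
        (auto simp: norm_mult split: split_indicator)
    moreover have "(CLINT z|JJ. complex_of_real ?c * indicator ?D z) = complex_of_real (?c * measure JJ ?D)"
    proof -
      have "(CLINT z|JJ. complex_of_real ?c * indicator ?D z) = (CLINT z|JJ. complex_of_real (?c * indicator ?D z))"
        by (intro Bochner_Integration.integral_cong) (auto split: split_indicator)
      also have "\<dots> = complex_of_real (?c * measure JJ ?D)" using D' by simp
      finally show ?thesis .
    qed
    ultimately show ?thesis using v by simp
  qed
  from conditional_normal[OF res_measurable D' _ this A] v
  have "measure JJ {z \<in> space JJ. z \<in> ?D \<and> res z \<in> A} = measure (density lborel (normal_density 0 (sqrt (\<rho> / n)))) A * measure JJ ?D"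
    by simp
  moreover have "{z \<in> space JJ. z \<in> ?D \<and> res z \<in> A} = {z \<in> space JJ. obs z \<in> D \<and> res z \<in> A}" by auto
  ultimately show ?thesis by simp
qed

section \<open>Disintegration of the joint law by the posterior\<close>

abbreviation "mm \<equiv> distr JJ C01 obs"

lemma Q_measurable: "Q \<in> measurable C01 (subprob_algebra C01)" "Q \<in> measurable C01 (prob_algebra C01)"
  using Q by (auto simp: posterior_def intro: measurable_prob_algebraD)

lemma Q_prob: "y \<in> space C01 \<Longrightarrow> prob_space (Q y)" "y \<in> space C01 \<Longrightarrow> sets (Q y) = sets C01"
  using measurable_space[OF Q_measurable(2)] by (auto simp: space_prob_algebra)

text \<open>The definition of the posterior covers products of an event for the function and one for
  the data. The residual event is not such a product, as its centre depends on \<open>y\<close>; so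
  the joint law is identified with \<open>mm\<close> composed with the kernel
  \<open>\<kappa>\<close>, by uniqueness on products.\<close>

lemma posterior_joint:
  assumes E: "E \<in> sets (C01 \<Otimes>\<^sub>M C01)"
  shows "emeasure JJ {z \<in> space JJ. (fst z, obs z) \<in> E} = (\<integral>\<^sup>+y. emeasure (Q y) {f \<in> space C01. (f, y) \<in> E} \<partial>mm)"
    and "(\<lambda>y. emeasure (Q y) {f \<in> space C01. (f, y) \<in> E}) \<in> borel_measurable C01"
proof -
  interpret prob_space JJ by (rule prob_JJ)
  interpret mm: prob_space mm by (rule prob_space_distr) simp
  let ?C = "C01 \<Otimes>\<^sub>M C01"
  define \<kappa> where "\<kappa> y = distr (Q y) ?C (\<lambda>f. (f, y))" for y
  have \<kappa>: "\<kappa> \<in> measurable C01 (subprob_algebra ?C)"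
    unfolding \<kappa>_def[abs_def] by (rule measurable_distr2[OF _ Q_measurable(1)]) (simp add: split_def)
  have \<kappa>': "\<kappa> \<in> measurable mm (subprob_algebra ?C)" using \<kappa> by simp
  have \<kappa>E: "emeasure (\<kappa> y) X = emeasure (Q y) {f \<in> space C01. (f, y) \<in> X}" if "y \<in> space C01" "X \<in> sets ?C" for y X
  proof -
    have "(\<lambda>f. (f, y)) \<in> measurable (Q y) ?C"
      using that(1) Q_prob(2)[OF that(1)] by (simp add: measurable_cong_sets[OF Q_prob(2)[OF that(1)] refl])
    moreover have "space (Q y) = space C01" using Q_prob(2)[OF that(1)] by (rule sets_eq_imp_space_eq)
    ultimately show ?thesis unfolding \<kappa>_def using that(2)
      by (subst emeasure_distr) (auto simp: vimage_def Int_def conj_commute)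
  qed
  have ne: "space mm \<noteq> {}" using mm.not_empty .
  let ?K = "mm \<bind> \<kappa>" and ?H = "distr JJ ?C (\<lambda>z. (fst z, obs z))"
  have Hm: "(\<lambda>z. (fst z, obs z)) \<in> measurable JJ ?C" by measurable
  have "?K = ?H"
  proof (rule measure_eqI_generator_eq[OF Int_stable_pair_measure_generator])
    show "{a \<times> b |a b. a \<in> sets C01 \<and> b \<in> sets C01} \<subseteq> Pow (space C01 \<times> space C01)"
      using sets.sets_into_space by blast
    show "sets ?K = sigma_sets (space C01 \<times> space C01) {a \<times> b |a b. a \<in> sets C01 \<and> b \<in> sets C01}"
      using sets_bind[OF _ ne, of \<kappa> ?C] by (simp add: \<kappa>_def sets_pair_measure)
    show "sets ?H = sigma_sets (space C01 \<times> space C01) {a \<times> b |a b. a \<in> sets C01 \<and> b \<in> sets C01}"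
      by (simp add: sets_pair_measure)
    show "range (\<lambda>_::nat. space C01 \<times> space C01) \<subseteq> {a \<times> b |a b. a \<in> sets C01 \<and> b \<in> sets C01}" by blast
    show "(\<Union>i::nat. space C01 \<times> space C01) = space C01 \<times> space C01" by simp
    show eq: "emeasure ?K X = emeasure ?H X" if X: "X \<in> {a \<times> b |a b. a \<in> sets C01 \<and> b \<in> sets C01}" for X
    proof -
      obtain A D where X: "X = A \<times> D" "A \<in> sets C01" "D \<in> sets C01" using X by blast
      have XC: "X \<in> sets ?C" using X by simp
      have "emeasure ?K X = (\<integral>\<^sup>+y. emeasure (\<kappa> y) X \<partial>mm)" by (rule emeasure_bind[OF ne \<kappa>' XC])
      also have "\<dots> = (\<integral>\<^sup>+y. emeasure (Q y) A * indicator D y \<partial>mm)"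
      proof (intro nn_integral_cong)
        fix y assume "y \<in> space mm"
        then have y: "y \<in> space C01" by simp
        have "{f \<in> space C01. (f, y) \<in> X} = (if y \<in> D then A else {})"
          using X sets.sets_into_space[OF X(2)] by auto
        then show "emeasure (\<kappa> y) X = emeasure (Q y) A * indicator D y"
          unfolding \<kappa>E[OF y XC] by (auto split: split_indicator)
      qed
      also have "\<dots> = emeasure JJ {(f, b) \<in> space JJ. f \<in> A \<and> observation n f b \<in> D}"
      proof -
        have "mm = distr JJ C01 (\<lambda>(f, b). observation n f b)" by (simp add: obs_def[abs_def] split_def)
        then show ?thesis using Q X unfolding posterior_def by auto
      qed
      also have "\<dots> = emeasure ?H X"
        using XC by (subst emeasure_distr[OF Hm]) (auto simp: X(1) obs_def split_def intro!: arg_cong2[where f=emeasure])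
      finally show ?thesis .
    qed
    show "emeasure ?K (space C01 \<times> space C01) \<noteq> \<infinity>" for i :: nat
    proof -
      interpret H: prob_space ?H by (rule prob_space_distr[OF Hm])
      have "emeasure ?K (space C01 \<times> space C01) = emeasure ?H (space C01 \<times> space C01)" by (rule eq) blast
      then show ?thesis by simp
    qed
  qed
  then have "emeasure ?H E = (\<integral>\<^sup>+y. emeasure (\<kappa> y) E \<partial>mm)"
    using emeasure_bind[OF ne \<kappa>' E] by simp
  also have "\<dots> = (\<integral>\<^sup>+y. emeasure (Q y) {f \<in> space C01. (f, y) \<in> E} \<partial>mm)"
    by (intro nn_integral_cong) (simp add: \<kappa>E[OF _ E])
  also have "emeasure ?H E = emeasure JJ {z \<in> space JJ. (fst z, obs z) \<in> E}"
    using E by (subst emeasure_distr[OF Hm]) (auto simp: vimage_def Int_def conj_commute)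
  finally show "emeasure JJ {z \<in> space JJ. (fst z, obs z) \<in> E} = (\<integral>\<^sup>+y. emeasure (Q y) {f \<in> space C01. (f, y) \<in> E} \<partial>mm)" .
  have "(\<lambda>y. emeasure (\<kappa> y) E) \<in> borel_measurable C01"
    by (rule measurable_compose[OF \<kappa> measurable_emeasure_subprob_algebra[OF E]])
  then show "(\<lambda>y. emeasure (Q y) {f \<in> space C01. (f, y) \<in> E}) \<in> borel_measurable C01"
    by (rule measurable_cong[THEN iffD1, rotated]) (simp add: \<kappa>E[OF _ E])
qed

text \<open>By independence \<open>q\<close> has over each event \<open>D\<close> of the data the
  same integral as a constant, so it equals that constant almost everywhere.\<close>

lemma posterior_residual_AE:
  fixes t :: real
  defines "q \<equiv> \<lambda>y. emeasure (Q y) {f \<in> space C01. \<bar>l2_inner f e - \<rho> * path_integral e y\<bar> > t}"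
  shows "q \<in> borel_measurable C01"
    and "AE y in mm. q y = ennreal (measure (density lborel (normal_density 0 (sqrt (\<rho> / n)))) {x. \<bar>x\<bar> > t})"
proof -
  interpret prob_space JJ by (rule prob_JJ)
  interpret mm: prob_space mm by (rule prob_space_distr) simp
  note [measurable] = l2_measurable[OF integrand_e] path_integral_measurable[OF integrand_e]
  let ?c = "measure (density lborel (normal_density 0 (sqrt (\<rho> / n)))) {x. \<bar>x\<bar> > t}"
  define E where "E D = {z \<in> space (C01 \<Otimes>\<^sub>M C01). snd z \<in> D \<and> \<bar>l2_inner (fst z) e - \<rho> * path_integral e (snd z)\<bar> > t}" for D
  have E: "E D \<in> sets (C01 \<Otimes>\<^sub>M C01)" if [measurable]: "D \<in> sets C01" for D unfolding E_def by measurable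
  have Eq: "emeasure (Q y) {f \<in> space C01. (f, y) \<in> E D} = q y * indicator D y" if "y \<in> space C01" for y D
    using that unfolding q_def E_def by (auto simp: space_pair_measure split: split_indicator intro!: arg_cong2[where f=emeasure])
  have "(\<lambda>y. emeasure (Q y) {f \<in> space C01. (f, y) \<in> E (space C01)}) \<in> borel_measurable C01"
    by (rule posterior_joint(2)[OF E]) simp
  then show qm: "q \<in> borel_measurable C01"
    by (rule measurable_cong[THEN iffD1, rotated]) (simp add: Eq)
  show "AE y in mm. q y = ennreal ?c"
  proof (rule mm.density_unique2)
    fix D assume "D \<in> sets mm"
    then have D: "D \<in> sets C01" by simp
    have "(\<integral>\<^sup>+y\<in>D. q y \<partial>mm) = (\<integral>\<^sup>+y. emeasure (Q y) {f \<in> space C01. (f, y) \<in> E D} \<partial>mm)"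
      by (intro nn_integral_cong) (simp add: Eq)
    also have "\<dots> = emeasure JJ {z \<in> space JJ. (fst z, obs z) \<in> E D}"
      by (rule posterior_joint(1)[OF E[OF D], symmetric])
    also have "{z \<in> space JJ. (fst z, obs z) \<in> E D} = {z \<in> space JJ. obs z \<in> D \<and> res z \<in> {x. \<bar>x\<bar> > t}}"
      using measurable_space[OF obs_measurable] by (auto simp: E_def res_def space_pair_measure space_JJ sets_prior wiener_properties(3)[OF W])
    also have "emeasure JJ \<dots> = ennreal (?c * measure JJ (obs -` D \<inter> space JJ))"
      unfolding emeasure_eq_measure by (subst res_independent[OF D]) auto
    also have "\<dots> = ennreal ?c * emeasure mm D"
      using D by (simp add: emeasure_distr emeasure_eq_measure ennreal_mult'')
    also have "\<dots> = (\<integral>\<^sup>+y\<in>D. ennreal ?c \<partial>mm)" using D by (simp add: nn_integral_cmult_indicator)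
    finally show "(\<integral>\<^sup>+y\<in>D. q y \<partial>mm) = (\<integral>\<^sup>+y\<in>D. ennreal ?c \<partial>mm)" .
  qed (use qm in simp_all)
qed

text \<open>The posterior is only determined up to null sets of the marginal law \<open>mm\<close> of the observation;
  absolute continuity transfers statements about it to the law under \<open>f0\<close>.\<close>

lemma AE_observation_law:
  assumes f0: "continuous_on {0..1} f0" and R: "Measurable.pred C01 R" and ae: "AE y in mm. R y"
  shows "AE y in observation_law W n f0. R y"
proof -
  interpret P0: prob_space P by (rule prob_P)
  interpret W0: prob_space W by (rule prob_W)
  interpret PW: pair_prob_space P W ..
  define N where "N = {y \<in> space C01. \<not> R y}"
  have N: "N \<in> sets C01" using R unfolding N_def by measurable
  have "AE z in JJ. R (obs z)"
    using ae R by (subst (asm) AE_distr_iff) auto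
  \<comment> \<open>The marginal law is a mixture over draws \<open>f\<close> from the prior, so
    some draw has \<open>R\<close> almost surely under its own data law. That law dominates the one
    for \<open>f0\<close>.\<close>
  then have "AE f in P. AE b in W. R (obs (f, b))"
    by (rule PW.AE_pair)
  then have "AE f in P. f \<in> space C01 \<and> (AE b in W. R (obs (f, b)))"
    using AE_space[of P] by eventually_elim (simp add: sets_prior)
  then obtain f where f: "f \<in> space C01" "AE b in W. R (obs (f, b))"
    using eventually_happens'[OF P0.ae_filter_bot] by blast
  have fc: "continuous_on {0..1} f" using f(1) by (rule C01_continuous)
  have om: "observation n f \<in> measurable W C01"
    using observation_measurable[OF fc] by (simp add: measurable_cong_sets[OF sets_W refl])
  have "AE y in observation_law W n f. R y"
    unfolding observation_law_def using f(2) om R by (subst AE_distr_iff) (auto simp: obs_def)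
  then have "emeasure (observation_law W n f) N = 0"
    using N unfolding N_def by (subst (asm) AE_iff_measurable[of N]) (auto simp: observation_law_def N_def)
  then have "emeasure (observation_law W n f0) N = 0"
    by (rule observation_law_absolutely_continuous[OF W fc f0 n N])
  then show ?thesis using N
    by (subst AE_iff_measurable[of N]) (auto simp: observation_law_def N_def)
qed

text \<open>Of \<open>2 * t\<close>, one \<open>t\<close> is for the posterior spread around its
  centre and one for the noise in that centre; the constant 4 is the sum of the two tail constants
  2.\<close>

lemma coordinate_contraction:
  assumes f0: "continuous_on {0..1} f0" and t: "t \<ge> 0"
  shows "(\<integral>\<^sup>+y. emeasure (Q y) {f \<in> space C01. \<bar>l2_inner f e - l2_inner f0 e\<bar> > 2 * t + (1 - \<rho>) * \<bar>l2_inner f0 e\<bar>} \<partial>observation_law W n f0)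
    \<le> ennreal (4 * exp (- (t\<^sup>2 / (4 * (\<rho> / n)))))"
proof -
  interpret W: prob_space W by (rule prob_W)
  interpret O: prob_space "observation_law W n f0" by (rule observation_law_prob[OF W f0])
  have sO: "sets (observation_law W n f0) = sets C01" "space (observation_law W n f0) = space C01"
    by (simp_all add: observation_law_def)
  note [measurable] = l2_measurable[OF integrand_e] path_integral_measurable[OF integrand_e]
  have v: "\<rho> / n > 0" using rho_pos n by simp
  let ?T = "2 * exp (- (t\<^sup>2 / (4 * (\<rho> / n))))"
  define q where "q y = emeasure (Q y) {f \<in> space C01. \<bar>l2_inner f e - \<rho> * path_integral e y\<bar> > t}" for y
  \<comment> \<open>The data for which the centre of the posterior is too noisy. There the posterior
    probability is bounded by 1, elsewhere by the residual probability \<open>q\<close>.\<close>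
  define H where "H = {y \<in> space C01. \<bar>\<rho> * (path_integral e y - l2_inner f0 e)\<bar> > t}"
  have H: "H \<in> sets C01" unfolding H_def by measurable
  have qm: "q \<in> borel_measurable C01" unfolding q_def[abs_def] by (rule posterior_residual_AE(1))
  have le: "emeasure (Q y) {f \<in> space C01. \<bar>l2_inner f e - l2_inner f0 e\<bar> > 2 * t + (1 - \<rho>) * \<bar>l2_inner f0 e\<bar>} \<le> q y + indicator H y"
    if y: "y \<in> space C01" for y
  proof (cases "y \<in> H")
    case True
    interpret Qy: prob_space "Q y" by (rule Q_prob[OF y])
    show ?thesis using True Qy.emeasure_le_1 by (auto intro: order_trans add_increasing)
  next
    case False
    then have h: "\<bar>\<rho> * (path_integral e y - l2_inner f0 e)\<bar> \<le> t" using y by (simp add: H_def not_less)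
    have "{f \<in> space C01. \<bar>l2_inner f e - l2_inner f0 e\<bar> > 2 * t + (1 - \<rho>) * \<bar>l2_inner f0 e\<bar>}
      \<subseteq> {f \<in> space C01. \<bar>l2_inner f e - \<rho> * path_integral e y\<bar> > t}"
    proof safe
      fix f assume f: "2 * t + (1 - \<rho>) * \<bar>l2_inner f0 e\<bar> < \<bar>l2_inner f e - l2_inner f0 e\<bar>"
      have "l2_inner f e - l2_inner f0 e = (l2_inner f e - \<rho> * path_integral e y) + \<rho> * (path_integral e y - l2_inner f0 e) - (1 - \<rho>) * l2_inner f0 e"
        by (simp add: algebra_simps)
      moreover have "\<bar>(1 - \<rho>) * l2_inner f0 e\<bar> = (1 - \<rho>) * \<bar>l2_inner f0 e\<bar>" using rho_le by (simp add: abs_mult)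
      ultimately show "t < \<bar>l2_inner f e - \<rho> * path_integral e y\<bar>" using f h by linarith
    qed
    moreover have "{f \<in> space C01. \<bar>l2_inner f e - \<rho> * path_integral e y\<bar> > t} \<in> sets (Q y)"
      unfolding Q_prob(2)[OF y] by measurable
    ultimately show ?thesis using False unfolding q_def by (simp add: emeasure_mono)
  qed
  have tail: "measure (density lborel (normal_density 0 (sqrt (\<rho> / n)))) {x. \<bar>x\<bar> > t} \<le> ?T"
    using normal_tail[of "sqrt (\<rho> / n)" t] v t by simp
  have "AE y in observation_law W n f0. q y = ennreal (measure (density lborel (normal_density 0 (sqrt (\<rho> / n)))) {x. \<bar>x\<bar> > t})"
  proof (rule AE_observation_law[OF f0])
    show "AE y in mm. q y = ennreal (measure (density lborel (normal_density 0 (sqrt (\<rho> / n)))) {x. \<bar>x\<bar> > t})"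
      unfolding q_def by (rule posterior_residual_AE(2))
    show "Measurable.pred C01 (\<lambda>y. q y = ennreal (measure (density lborel (normal_density 0 (sqrt (\<rho> / n)))) {x. \<bar>x\<bar> > t}))"
      using qm by measurable
  qed
  then have "AE y in observation_law W n f0. q y \<le> ennreal ?T"
    by eventually_elim (simp only: ennreal_leI[OF tail])
  then have "(\<integral>\<^sup>+y. q y \<partial>observation_law W n f0) \<le> (\<integral>\<^sup>+y. ennreal ?T \<partial>observation_law W n f0)"
    by (rule nn_integral_mono_AE)
  then have q: "(\<integral>\<^sup>+y. q y \<partial>observation_law W n f0) \<le> ennreal ?T"
    by (simp add: O.emeasure_space_1)
  have "emeasure (observation_law W n f0) H = emeasure W {b \<in> space W. observation n f0 b \<in> H}"
    unfolding observation_law_def using H observation_measurable[OF f0]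
    by (subst emeasure_distr) (auto simp: measurable_cong_sets[OF sets_W refl] vimage_def Int_def conj_commute)
  also have "{b \<in> space W. observation n f0 b \<in> H} = {b \<in> space W. \<bar>path_integral e b\<bar> > t * sqrt n / \<rho>}"
  proof -
    have "observation n f0 b \<in> H \<longleftrightarrow> \<bar>path_integral e b\<bar> > t * sqrt n / \<rho>" if "b \<in> space W" for b
    proof -
      have bc: "continuous_on {0..1} b" using that wiener_properties(3)[OF W] C01_continuous by simp
      have "\<rho> * (path_integral e (observation n f0 b) - l2_inner f0 e) = \<rho> * path_integral e b / sqrt n"
        unfolding path_integral_observation[OF integrand_e f0 bc] l2_inner_def by simp
      moreover have "t < \<bar>\<rho> * path_integral e b / sqrt n\<bar> \<longleftrightarrow> t * sqrt n / \<rho> < \<bar>path_integral e b\<bar>"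
        using rho_pos n by (simp add: abs_mult field_simps)
      ultimately show ?thesis using observation_in_C01[OF f0 bc, of n] by (simp add: H_def)
    qed
    then show ?thesis by auto
  qed
  also have "emeasure W \<dots> \<le> ennreal (2 * exp (- ((t * sqrt n / \<rho>)\<^sup>2 / 4)))"
    unfolding W.emeasure_eq_measure using t rho_pos
    by (intro ennreal_leI wiener_path_integral_tail[OF W integrand_e norm_e]) simp
  also have "\<dots> \<le> ennreal ?T"
  proof (intro ennreal_leI mult_left_mono)
    \<comment> \<open>The noise in the centre has variance \<open>\<rho>\<^sup>2 / n\<close>, at
      most \<open>\<rho> / n\<close> since \<open>\<rho> \<le> 1\<close>; so both tails obey the
      same bound.\<close>
    have "t\<^sup>2 / (4 * (\<rho> / n)) = t\<^sup>2 * n / (4 * \<rho>)" by simp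
    also have "\<dots> \<le> t\<^sup>2 * n / (4 * \<rho>\<^sup>2)"
      using rho_pos rho_le by (intro divide_left_mono) (auto simp: power2_eq_square mult_left_le)
    also have "\<dots> = (t * sqrt n / \<rho>)\<^sup>2 / 4" by (simp add: power_mult_distrib power_divide)
    finally show "exp (- ((t * sqrt n / \<rho>)\<^sup>2 / 4)) \<le> exp (- (t\<^sup>2 / (4 * (\<rho> / n))))" by simp
  qed simp
  finally have Hle: "emeasure (observation_law W n f0) H \<le> ennreal ?T" .
  have "(\<integral>\<^sup>+y. emeasure (Q y) {f \<in> space C01. \<bar>l2_inner f e - l2_inner f0 e\<bar> > 2 * t + (1 - \<rho>) * \<bar>l2_inner f0 e\<bar>} \<partial>observation_law W n f0)
    \<le> (\<integral>\<^sup>+y. q y + indicator H y \<partial>observation_law W n f0)"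
    using le sO by (intro nn_integral_mono) simp
  also have "\<dots> = (\<integral>\<^sup>+y. q y \<partial>observation_law W n f0) + emeasure (observation_law W n f0) H"
    using qm H sO by (subst nn_integral_add) (auto simp: measurable_cong_sets[OF sO(1) refl])
  also have "\<dots> \<le> ennreal ?T + ennreal ?T" by (intro add_mono q Hle)
  also have "\<dots> = ennreal (4 * exp (- (t\<^sup>2 / (4 * (\<rho> / n)))))" by (simp add: ennreal_plus[symmetric] del: ennreal_plus)
  finally show ?thesis .
qed

end

section \<open>Contraction rate\<close>

text \<open>The unit interval has length one, so a sup bound controls all \<open>r\<close> at
  once.\<close>

lemma Lr_norm_le:
  assumes r: "1 \<le> r" and h: "\<And>x. x \<in> {0..1} \<Longrightarrow> \<bar>h x\<bar> \<le> c"
  shows "Lr_norm r h \<le> c"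
proof (cases "r = \<infinity>")
  case True
  then show ?thesis unfolding Lr_norm_def using h by (auto intro!: cSUP_least)
next
  case False
  then obtain p where p: "r = ereal p" "1 \<le> p" using r by (cases r) (auto simp: one_ereal_def)
  have c: "0 \<le> c" using order_trans[OF abs_ge_zero h[of 0]] by simp
  have "(LINT x:{0..1}|lborel. \<bar>h x\<bar> powr p) \<le> (LINT x::real:{0..1}|lborel. c powr p)"
    unfolding set_lebesgue_integral_def
  proof (rule integral_mono')
    show "integrable lborel (\<lambda>x::real. indicator {0..1} x *\<^sub>R (c powr p))" by simp
    show "indicator {0..1} x *\<^sub>R (\<bar>h x\<bar> powr p) \<le> indicator {0..1} x *\<^sub>R (c powr p)" for x :: real
      using h[of x] p by (auto split: split_indicator intro!: powr_mono2)
  qed auto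
  also have "\<dots> = c powr p" by (simp add: set_lebesgue_integral_def)
  finally have le: "(LINT x:{0..1}|lborel. \<bar>h x\<bar> powr p) \<le> c powr p" .
  moreover have "0 \<le> (LINT x:{0..1}|lborel. \<bar>h x\<bar> powr p)"
    unfolding set_lebesgue_integral_def by (rule Bochner_Integration.integral_nonneg) (auto split: split_indicator)
  ultimately have "(LINT x:{0..1}|lborel. \<bar>h x\<bar> powr p) powr (1 / p) \<le> (c powr p) powr (1 / p)"
    using p by (intro powr_mono2) auto
  also have "\<dots> = c" using p c by (simp add: powr_powr)
  finally show ?thesis using p by (simp add: Lr_norm_def)
qed

text \<open>Splitting at the integer part of \<open>\<tau>\<close> leaves two geometric series, each
  bounded by \<open>1 / (1 - 2 powr (- \<beta>))\<close>.\<close>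

lemma two_sided_geometric:
  fixes \<beta> \<tau> :: real
  assumes \<beta>: "\<beta> > 0" and \<tau>: "\<tau> \<ge> 0"
  shows "(\<Sum>l = J..L. 2 powr (- \<beta> * \<bar>real l - \<tau>\<bar>)) \<le> 2 / (1 - 2 powr (- \<beta>))"
proof -
  define r where "r = 2 powr (- \<beta>)"
  have r: "0 < r" "r < 1" using \<beta> by (auto simp: r_def powr_less_one)
  have rp: "2 powr (- \<beta> * real k) = r ^ k" for k
    using r by (simp add: r_def powr_realpow[symmetric] powr_powr)
  have mono: "2 powr (- \<beta> * y) \<le> r ^ k" if "real k \<le> y" for y k
    unfolding rp[symmetric] using that \<beta> by (intro powr_mono) (auto intro: mult_left_mono)
  define m where "m = nat \<lfloor>\<tau>\<rfloor>"
  have m: "real m \<le> \<tau>" "\<tau> < real m + 1" using \<tau> by (auto simp: m_def)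
  have geo: "(\<Sum>i<k. r ^ i) \<le> 1 / (1 - r)" for k
  proof -
    have "(\<Sum>i<k. r ^ i) = (1 - r ^ k) / (1 - r)" using r by (simp add: sum_gp_strict)
    also have "\<dots> \<le> 1 / (1 - r)" using r by (intro divide_right_mono) auto
    finally show ?thesis .
  qed
  have "(\<Sum>l = J..L. 2 powr (- \<beta> * \<bar>real l - \<tau>\<bar>)) \<le> (\<Sum>l\<in>{..m} \<union> {m<..L}. 2 powr (- \<beta> * \<bar>real l - \<tau>\<bar>))"
    by (intro sum_mono2) auto
  also have "\<dots> = (\<Sum>l\<in>{..m}. 2 powr (- \<beta> * \<bar>real l - \<tau>\<bar>)) + (\<Sum>l\<in>{m<..L}. 2 powr (- \<beta> * \<bar>real l - \<tau>\<bar>))"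
    by (intro sum.union_disjoint) auto
  also have "(\<Sum>l\<in>{..m}. 2 powr (- \<beta> * \<bar>real l - \<tau>\<bar>)) \<le> (\<Sum>l\<in>{..m}. r ^ (m - l))"
    using m by (intro sum_mono mono) (auto simp: of_nat_diff)
  also have "(\<Sum>l\<in>{..m}. r ^ (m - l)) = (\<Sum>i<Suc m. r ^ i)"
    by (rule sum.reindex_bij_witness[of _ "\<lambda>i. m - i" "\<lambda>i. m - i"]) auto
  also have "\<dots> \<le> 1 / (1 - r)" by (rule geo)
  also have "(\<Sum>l\<in>{m<..L}. 2 powr (- \<beta> * \<bar>real l - \<tau>\<bar>)) \<le> (\<Sum>l\<in>{m<..L}. r ^ (l - Suc m))"
    using m by (intro sum_mono mono) (auto simp: of_nat_diff)
  also have "(\<Sum>l\<in>{m<..L}. r ^ (l - Suc m)) = (\<Sum>i<L - m. r ^ i)"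
    by (rule sum.reindex_bij_witness[of _ "\<lambda>i. i + Suc m" "\<lambda>i. i - Suc m"]) auto
  also have "\<dots> \<le> 1 / (1 - r)" by (rule geo)
  finally show ?thesis by (simp add: r_def)
qed

text \<open>The cutoff \<open>\<tau>\<close> is the level at which the prior variances and the noise level balance.\<close>

lemma cutoff:
  fixes \<alpha> :: real and n :: nat
  assumes \<alpha>: "\<alpha> > 0" and n: "n \<ge> 2"
  defines "\<tau> \<equiv> log 2 (real n / ln (real n)) / (2 * \<alpha> + 1)"
  shows "\<tau> \<ge> 0" "ln (real n) / real n = 2 powr (- ((2 * \<alpha> + 1) * \<tau>))"
    "contraction_rate \<alpha> n = 2 powr (- (\<alpha> * \<tau>))"
    "\<tau> \<le> 2 / ((2 * \<alpha> + 1) * ln 2) * ln (real n)" "ln (real n) \<le> 2 * (2 * \<alpha> + 1) * ln 2 * \<tau>"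
    "1 / real n \<le> 2 * (ln (real n) / real n)"
proof -
  let ?N = "real n / ln (real n)"
  have q: "2 * \<alpha> + 1 > 0" using \<alpha> by simp
  have ln2: "ln (2::real) \<ge> 1 / 2" using ln2_ge_two_thirds by linarith
  have "ln 2 \<le> ln (real n)" using n by simp
  then have lnn: "ln (real n) \<ge> 1 / 2" using ln2 by linarith
  have n0: "real n > 0" "real n \<ge> 2" using n by auto
  \<comment> \<open>Yields \<open>sqrt n \<le> ?N\<close>; together with
    \<open>?N \<le> n * n\<close> it makes \<open>\<tau>\<close> and \<open>ln n\<close> comparable
    up to constants depending on \<alpha> only.\<close>
  have N1: "ln (real n) \<le> sqrt (real n)"
  proof -
    have "ln (sqrt (real n) / 2) \<le> sqrt (real n) / 2 - 1"
      using n0 by (intro ln_le_minus_one) simp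
    moreover have "ln (sqrt (real n) / 2) = ln (real n) / 2 - ln 2"
      using n0 by (simp add: ln_div ln_sqrt)
    ultimately show ?thesis using ln_2_less_1 by linarith
  qed
  have N0: "?N > 0" using lnn n0 by simp
  have Nle: "?N \<le> real n * real n"
  proof -
    have "1 / ln (real n) \<le> real n" using lnn n0 mult_mono[of "1/2" "ln (real n)" 2 "real n"] by (simp add: field_simps)
    then have "real n * (1 / ln (real n)) \<le> real n * real n" using n0 by (intro mult_left_mono) auto
    then show ?thesis by simp
  qed
  have Nge: "sqrt (real n) \<le> ?N"
  proof -
    have "sqrt (real n) * ln (real n) \<le> sqrt (real n) * sqrt (real n)" using N1 by (intro mult_left_mono) auto
    then show ?thesis using lnn n0 by (simp add: field_simps)
  qed
  have N1': "?N \<ge> 1"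
  proof -
    have "1 \<le> sqrt (real n)" using n0 by simp
    then show ?thesis using Nge by linarith
  qed
  have ql: "(2 * \<alpha> + 1) * \<tau> = log 2 ?N" using q by (simp add: \<tau>_def)
  have pN: "2 powr (log 2 ?N) = ?N" using N0 by simp
  show "1 / real n \<le> 2 * (ln (real n) / real n)" using lnn n0 by (simp add: field_simps)
  show "\<tau> \<ge> 0" unfolding \<tau>_def using N1' q by (intro divide_nonneg_pos) auto
  have "2 powr (- ((2 * \<alpha> + 1) * \<tau>)) = inverse ?N" unfolding ql powr_minus pN ..
  then show "ln (real n) / real n = 2 powr (- ((2 * \<alpha> + 1) * \<tau>))" by simp
  have "?N powr (- (\<alpha> / (2 * \<alpha> + 1))) = 2 powr (log 2 ?N * (- (\<alpha> / (2 * \<alpha> + 1))))"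
    unfolding powr_powr[symmetric] pN ..
  also have "log 2 ?N * (- (\<alpha> / (2 * \<alpha> + 1))) = - (\<alpha> * \<tau>)" by (simp add: \<tau>_def)
  finally show "contraction_rate \<alpha> n = 2 powr (- (\<alpha> * \<tau>))" using n by (simp add: contraction_rate_def)
  have lam: "\<tau> = ln ?N / ((2 * \<alpha> + 1) * ln 2)" by (simp add: \<tau>_def log_def mult.commute)
  have "ln ?N \<le> ln (real n * real n)" using Nle N0 n0 by (subst ln_le_cancel_iff) auto
  also have "\<dots> = 2 * ln (real n)" using n0 by (simp add: ln_mult)
  finally have "ln ?N / ((2 * \<alpha> + 1) * ln 2) \<le> 2 * ln (real n) / ((2 * \<alpha> + 1) * ln 2)"
    using q ln2 by (intro divide_right_mono) auto
  then show "\<tau> \<le> 2 / ((2 * \<alpha> + 1) * ln 2) * ln (real n)" unfolding lam by simp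
  have "ln (sqrt (real n)) \<le> ln ?N" using Nge N0 n0 by (subst ln_le_cancel_iff) auto
  then have "ln (real n) \<le> 2 * ln ?N" using n0 by (simp add: ln_sqrt)
  moreover have "2 * (2 * \<alpha> + 1) * ln 2 * \<tau> = 2 * ln ?N"
  proof -
    define d where "d = (2 * \<alpha> + 1) * ln (2::real)"
    have "d \<noteq> 0" using q ln2 by (simp add: d_def)
    then have "d * \<tau> = ln ?N" unfolding lam d_def[symmetric] by simp
    then show ?thesis unfolding d_def by (simp only: mult.assoc)
  qed
  ultimately show "ln (real n) \<le> 2 * (2 * \<alpha> + 1) * ln 2 * \<tau>" by simp
qed

lemma sqrt_product_le:
  assumes "x * (v * s) \<le> c * (2 powr z)\<^sup>2"
  shows "sqrt x * (sqrt v * sqrt s) \<le> sqrt c * 2 powr z"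
proof -
  have "sqrt (x * (v * s)) \<le> sqrt (c * (2 powr z)\<^sup>2)" using assms by (rule real_sqrt_le_mono)
  then show ?thesis by (simp add: real_sqrt_mult)
qed

text \<open>Noise: up to the cutoff the posterior variance is at most \<open>1 / n\<close> and
  \<open>l + ln n\<close> is of order \<open>ln n\<close>, giving decay \<open>1 / 2\<close> towards
  low levels; beyond it the variance is at most \<open>\<mu>\<close> and \<open>l + ln n\<close> is
  of order \<open>l\<close>, which cancels the factor \<open>inverse (real l)\<close>, giving decay
  \<alpha>. Bias: decay \<open>\<alpha> + 1\<close> below and \<alpha> above. The smallest of these
  exponents is \<open>\<beta>\<close>.\<close>

lemma level_noise_bound:
  fixes \<alpha> \<tau> a b :: real and n l :: nat
  assumes \<alpha>: "\<alpha> > 0" and n: "n \<ge> 2" and l: "l \<ge> 1" and \<tau>: "\<tau> \<ge> 0"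
    and ln_n: "ln (real n) / real n = 2 powr (- ((2 * \<alpha> + 1) * \<tau>))"
    and ab: "\<tau> \<le> a * ln (real n)" "ln (real n) \<le> b * \<tau>" "a \<ge> 0" "b \<ge> 0"
  defines "\<mu> \<equiv> inverse (real l) * 2 powr (- (real l * (2 * \<alpha> + 1)))"
  defines "\<beta> \<equiv> min (1 / 2) \<alpha>"
  shows "sqrt (2 ^ l) * (sqrt (\<mu> / (real n * \<mu> + 1)) * sqrt (real l + ln (real n)))
      \<le> (sqrt (a + 1) + sqrt (b + 1)) * (2 powr (- (\<alpha> * \<tau>)) * 2 powr (- \<beta> * \<bar>real l - \<tau>\<bar>))" (is ?noise)
    and "sqrt (2 ^ l) * (2 powr (- (real l * (\<alpha> + 1 / 2))) / (real n * \<mu> + 1))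
      \<le> (a + 1) * (2 powr (- (\<alpha> * \<tau>)) * 2 powr (- \<beta> * \<bar>real l - \<tau>\<bar>))" (is ?bias)
proof -
  let ?R = "2 powr (- (\<alpha> * \<tau>)) * 2 powr (- \<beta> * \<bar>real l - \<tau>\<bar>)"
  have n0: "real n > 0" using n by simp
  have lnn: "0 \<le> ln (real n)" using n by simp
  have \<mu>: "\<mu> > 0" using l by (simp add: \<mu>_def)
  have \<beta>: "\<beta> \<le> 1 / 2" "\<beta> \<le> \<alpha>" "\<beta> > 0" using \<alpha> by (auto simp: \<beta>_def)
  have v: "\<mu> / (real n * \<mu> + 1) \<le> 1 / real n" "\<mu> / (real n * \<mu> + 1) \<le> \<mu>" "0 \<le> \<mu> / (real n * \<mu> + 1)"
    using \<mu> n0 by (auto simp: field_simps add_pos_pos)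
  have p2: "(2::real) ^ l = 2 powr real l" by (simp add: powr_realpow)
  have sq: "(2 powr z)\<^sup>2 = 2 powr (2 * z)" for z :: real by (simp add: power2_eq_square powr_add[symmetric])
  have Rz: "2 powr z \<le> ?R" if "z \<le> - (\<alpha> * \<tau>) - \<beta> * \<bar>real l - \<tau>\<bar>" for z
    unfolding powr_add[symmetric] using that by (intro powr_mono) auto
  have l0: "real l > 0" using l by simp
  show ?noise
  proof (cases "real l \<le> \<tau>")
    case True
    have "\<mu> / (real n * \<mu> + 1) * (real l + ln (real n)) \<le> 1 / real n * ((a + 1) * ln (real n))"
      using True ab v lnn n0 by (intro mult_mono) (auto simp: algebra_simps)
    then have "2 ^ l * (\<mu> / (real n * \<mu> + 1) * (real l + ln (real n))) \<le> 2 ^ l * (1 / real n * ((a + 1) * ln (real n)))"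
      by (intro mult_left_mono) auto
    also have "\<dots> = (a + 1) * (2 powr real l * (ln (real n) / real n))" unfolding p2 by simp
    also have "\<dots> = (a + 1) * (2 powr ((real l - (2 * \<alpha> + 1) * \<tau>) / 2))\<^sup>2"
    proof -
      have "2 * ((real l - (2 * \<alpha> + 1) * \<tau>) / 2) = real l + - ((2 * \<alpha> + 1) * \<tau>)" by simp
      then show ?thesis unfolding ln_n sq powr_add[symmetric] by (simp only:)
    qed
    finally have "sqrt (2 ^ l) * (sqrt (\<mu> / (real n * \<mu> + 1)) * sqrt (real l + ln (real n)))
        \<le> sqrt (a + 1) * 2 powr ((real l - (2 * \<alpha> + 1) * \<tau>) / 2)"
      by (rule sqrt_product_le)
    also have "\<dots> \<le> sqrt (a + 1) * ?R"
    proof (intro mult_left_mono Rz)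
      have "\<beta> * (\<tau> - real l) \<le> 1 / 2 * (\<tau> - real l)" using True \<beta> by (intro mult_right_mono) auto
      moreover have "(real l - (2 * \<alpha> + 1) * \<tau>) / 2 = - (\<alpha> * \<tau>) - 1 / 2 * (\<tau> - real l)" by (simp add: field_simps)
      moreover have "\<bar>real l - \<tau>\<bar> = \<tau> - real l" using True by simp
      ultimately show "(real l - (2 * \<alpha> + 1) * \<tau>) / 2 \<le> - (\<alpha> * \<tau>) - \<beta> * \<bar>real l - \<tau>\<bar>"
        by (simp only:)
    qed (use ab in auto)
    also have "\<dots> \<le> (sqrt (a + 1) + sqrt (b + 1)) * ?R" using ab by (intro mult_right_mono) auto
    finally show ?thesis .
  next
    case False
    then have "b * \<tau> \<le> b * real l" using ab by (intro mult_left_mono) auto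
    then have "real l + ln (real n) \<le> (b + 1) * real l" using ab by (simp add: algebra_simps)
    then have "\<mu> / (real n * \<mu> + 1) * (real l + ln (real n)) \<le> \<mu> * ((b + 1) * real l)"
      using v lnn \<mu> by (intro mult_mono) auto
    then have "2 ^ l * (\<mu> / (real n * \<mu> + 1) * (real l + ln (real n))) \<le> 2 ^ l * (\<mu> * ((b + 1) * real l))"
      by (intro mult_left_mono) auto
    also have "\<dots> = (b + 1) * (2 powr real l * 2 powr (- (real l * (2 * \<alpha> + 1))))"
      unfolding p2 \<mu>_def using l0 by simp
    also have "\<dots> = (b + 1) * (2 powr (- (\<alpha> * real l)))\<^sup>2"
      unfolding sq powr_add[symmetric] by (simp add: algebra_simps)
    finally have "sqrt (2 ^ l) * (sqrt (\<mu> / (real n * \<mu> + 1)) * sqrt (real l + ln (real n)))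
        \<le> sqrt (b + 1) * 2 powr (- (\<alpha> * real l))"
      by (rule sqrt_product_le)
    also have "\<dots> \<le> sqrt (b + 1) * ?R"
    proof (intro mult_left_mono Rz)
      have "\<beta> * (real l - \<tau>) \<le> \<alpha> * (real l - \<tau>)" using False \<beta> by (intro mult_right_mono) auto
      then show "- (\<alpha> * real l) \<le> - (\<alpha> * \<tau>) - \<beta> * \<bar>real l - \<tau>\<bar>"
        using False by (simp add: algebra_simps)
    qed (use ab in auto)
    also have "\<dots> \<le> (sqrt (a + 1) + sqrt (b + 1)) * ?R" using ab by (intro mult_right_mono) auto
    finally show ?thesis .
  qed
  have sl: "sqrt (2 ^ l) * 2 powr (- (real l * (\<alpha> + 1 / 2))) = 2 powr (- (real l * \<alpha>))"
  proof -
    have "sqrt (2 ^ l) = sqrt ((2 powr (real l / 2))\<^sup>2)" unfolding sq p2 by simp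
    also have "\<dots> = 2 powr (real l / 2)" by simp
    finally show ?thesis by (simp add: powr_add[symmetric] algebra_simps)
  qed
  have eq: "sqrt (2 ^ l) * (2 powr (- (real l * (\<alpha> + 1 / 2))) / (real n * \<mu> + 1)) = 2 powr (- (real l * \<alpha>)) / (real n * \<mu> + 1)"
    unfolding sl[symmetric] by simp
  show ?bias
  proof (cases "real l \<le> \<tau>")
    case True
    \<comment> \<open>Dividing by \<open>real n * \<mu>\<close> brings in a factor \<open>l\<close>,
      the price of the factor \<open>inverse (real l)\<close> in the prior; as
      \<open>l \<le> \<tau> \<le> a * ln n\<close> it becomes the logarithm in the rate.\<close>
    have "2 powr (- (real l * \<alpha>)) / (real n * \<mu> + 1) \<le> 2 powr (- (real l * \<alpha>)) / (real n * \<mu>)"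
      using \<mu> n0 by (intro divide_left_mono) (auto intro!: mult_pos_pos add_pos_pos)
    also have "\<dots> = real l * (2 powr (- (real l * \<alpha>)) * 2 powr (real l * (2 * \<alpha> + 1))) / real n"
    proof -
      have "X / (real n * (inverse (real l) * inverse Y)) = real l * (X * Y) / real n" if "Y > 0" for X Y :: real
        using that l0 n0 by (simp add: field_simps)
      then show ?thesis unfolding \<mu>_def powr_minus[of 2 "real l * (2 * \<alpha> + 1)"] by simp
    qed
    also have "\<dots> = real l * 2 powr (real l * (\<alpha> + 1)) / real n"
      unfolding powr_add[symmetric] by (simp add: algebra_simps)
    also have "\<dots> \<le> (a * ln (real n)) * 2 powr (real l * (\<alpha> + 1)) / real n"
      using True ab n0 by (intro divide_right_mono mult_right_mono) auto
    also have "\<dots> = a * (2 powr (real l * (\<alpha> + 1)) * (ln (real n) / real n))" by simp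
    also have "\<dots> = a * 2 powr (real l * (\<alpha> + 1) - (2 * \<alpha> + 1) * \<tau>)"
      unfolding ln_n powr_add[symmetric] by simp
    also have "\<dots> \<le> a * ?R"
    proof (intro mult_left_mono Rz)
      have "\<beta> * (\<tau> - real l) \<le> (\<alpha> + 1) * (\<tau> - real l)" using True \<beta> by (intro mult_right_mono) auto
      then show "real l * (\<alpha> + 1) - (2 * \<alpha> + 1) * \<tau> \<le> - (\<alpha> * \<tau>) - \<beta> * \<bar>real l - \<tau>\<bar>"
        using True by (simp add: algebra_simps)
    qed (use ab in auto)
    also have "\<dots> \<le> (a + 1) * ?R" by (intro mult_right_mono) auto
    finally show ?thesis unfolding eq .
  next
    case False
    have "2 powr (- (real l * \<alpha>)) / (real n * \<mu> + 1) \<le> 2 powr (- (real l * \<alpha>)) / 1"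
      using \<mu> n0 by (intro divide_left_mono) (auto intro!: add_pos_pos mult_pos_pos)
    also have "\<dots> \<le> ?R"
    proof -
      have "\<beta> * (real l - \<tau>) \<le> \<alpha> * (real l - \<tau>)" using False \<beta> by (intro mult_right_mono) auto
      then show ?thesis using False by (simp only: div_by_1) (intro Rz, simp add: algebra_simps)
    qed
    also have "\<dots> \<le> (a + 1) * ?R" using mult_right_mono[of 1 "a + 1" ?R] ab by simp
    finally show ?thesis unfolding eq .
  qed
qed

section \<open>Simultaneous control of all coefficients\<close>

context wavelet_prior
begin

text \<open>The posterior variance \<open>\<rho> / n\<close> of coefficient
  \<open>i\<close>.\<close>

definition pv :: "nat \<Rightarrow> nat + nat \<times> nat \<Rightarrow> real" where
  "pv n i = pvar i / (real n * pvar i + 1)"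

text \<open>The event of \<open>coordinate_contraction\<close>, with \<open>1 - \<rho>\<close>
  written out because \<open>\<rho>\<close> depends on the coefficient. The thresholds
  \<open>t\<close> stay free until the union bound.\<close>

definition bad :: "(real \<Rightarrow> real) \<Rightarrow> nat \<Rightarrow> (nat + nat \<times> nat \<Rightarrow> real) \<Rightarrow> nat + nat \<times> nat \<Rightarrow> (real \<Rightarrow> real) set" where
  "bad f0 n t i = {f \<in> space C01. \<bar>l2_inner f (bas i) - l2_inner f0 (bas i)\<bar> > 2 * t i + \<bar>l2_inner f0 (bas i)\<bar> / (real n * pvar i + 1)}"

lemma bad_sets: "i \<in> valid \<Longrightarrow> bad f0 n t i \<in> sets C01"
proof -
  assume i: "i \<in> valid"
  have [measurable]: "(\<lambda>f. l2_inner f (bas i)) \<in> borel_measurable C01"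
    unfolding l2_inner_def using bas_integrand[OF i] by (intro C01_set_integral_measurable) (auto simp: integrand_def)
  show ?thesis unfolding bad_def by measurable
qed

lemma bad_bound:
  assumes "wiener_measure W" "n \<ge> 1" "posterior W (prior J0 \<phi> \<psi> \<alpha>) n Q" and i: "i \<in> valid"
    and f0: "continuous_on {0..1} f0" and t: "t i \<ge> 0"
  shows "(\<integral>\<^sup>+y. emeasure (Q y) (bad f0 n t i) \<partial>observation_law W n f0) \<le> ennreal (4 * exp (- ((t i)\<^sup>2 / (4 * pv n i))))"
proof -
  interpret posterior_coordinate J0 \<phi> \<psi> B \<alpha> W n Q i
    using assms by unfold_locales
  have 1: "\<rho> / n = pv n i" unfolding rho_eq[symmetric] one_minus_rho pv_def by simp
  have 2: "(1 - \<rho>) * x = x / (real n * pvar i + 1)" for x unfolding one_minus_rho by simp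
  show ?thesis using coordinate_contraction[OF f0 t] unfolding 1 2 bad_def .
qed

text \<open>The thresholds make the tail at level \<open>l\<close> equal to
  \<open>4 * exp (- (T\<^sup>2 / 4) * (l + ln n))\<close>. From \<open>T \<ge> 3\<close> follows
  \<open>T\<^sup>2 / 4 \<ge> 2\<close>, so \<open>exp (- 2 * real l)\<close> pays for the
  \<open>2 ^ l\<close> wavelets, and the power of \<open>n\<close> factors out. The 3 bounds the
  geometric series of ratio \<open>2 * exp (- 2) \<le> 2 / 3\<close>.\<close>

lemma union_bound:
  assumes W: "wiener_measure W" and n: "n \<ge> 2" and Q: "posterior W (prior J0 \<phi> \<psi> \<alpha>) n Q"
    and f0: "continuous_on {0..1} f0" and T: "T \<ge> 3"
    and t1: "\<And>k. t (Inl k) = T * (sqrt (pv n (Inl k)) * sqrt (ln (real n)))"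
    and t2: "\<And>l k. t (Inr (l, k)) = T * (sqrt (pv n (Inr (l, k))) * sqrt (real l + ln (real n)))"
  shows "(\<integral>\<^sup>+y. emeasure (Q y) (\<Union>i\<in>valid. bad f0 n t i) \<partial>observation_law W n f0)
    \<le> ennreal (4 * (2 ^ J0 + 3) * real n powr (- (T\<^sup>2 / 4)))"
proof -
  have n0: "real n > 0" "ln (real n) \<ge> 0" using n by auto
  have sO: "space (observation_law W n f0) = space C01" "sets (observation_law W n f0) = sets C01" by (simp_all add: observation_law_def)
  let ?O = "observation_law W n f0"
  have Qm: "Q \<in> measurable C01 (subprob_algebra C01)"
    using Q by (auto simp: posterior_def intro: measurable_prob_algebraD)
  have Qs: "sets (Q y) = sets C01" if "y \<in> space C01" for y
    using measurable_space[OF Qm that] by (simp add: space_subprob_algebra)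
  \<comment> \<open>as \<open>J0 \<ge> 1\<close>, level \<open>0\<close> is free for the scaling functions\<close>
  define I :: "nat \<Rightarrow> (nat + nat \<times> nat) set" where "I l = (if l = 0 then Inl ` {..<2 ^ J0} else if l \<ge> J0 then (\<lambda>k. Inr (l, k)) ` {..<2 ^ l} else {})" for l
  have I: "finite (I l)" "I l \<subseteq> valid" for l using J0 by (auto simp: I_def valid_iff)
  have U: "(\<Union>i\<in>valid. bad f0 n t i) = (\<Union>l. \<Union>i\<in>I l. bad f0 n t i)"
  proof -
    have "valid = (\<Union>l. I l)"
    proof (intro set_eqI iffI)
      fix i assume "i \<in> valid"
      then show "i \<in> (\<Union>l. I l)"
      proof (cases i)
        case (Inl k)
        then have "i \<in> I 0" using \<open>i \<in> valid\<close> by (simp add: I_def valid_iff)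
        then show ?thesis by blast
      next
        case (Inr q)
        obtain l k where q: "q = (l, k)" by force
        then have "i \<in> I l" using \<open>i \<in> valid\<close> Inr J0 by (auto simp: I_def valid_iff)
        then show ?thesis by blast
      qed
    next
      fix i assume "i \<in> (\<Union>l. I l)" then show "i \<in> valid" using I(2) by blast
    qed
    then show ?thesis by blast
  qed
  let ?r = "2 * exp (-2 :: real)"
  have r: "0 < ?r" "?r \<le> 2 / 3"
  proof -
    have "exp (2::real) \<ge> 1 + 2" by (rule exp_ge_add_one_self)
    then show "?r \<le> 2 / 3" by (simp add: exp_minus field_simps)
  qed simp
  define q where "q = real n powr (- (T\<^sup>2 / 4))"
  have q: "q = exp (- (T\<^sup>2 / 4) * ln (real n))" using n0 by (simp add: q_def powr_def)
  have q0: "q > 0" using n0 by (simp add: q_def)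
  \<comment> \<open>The power \<open>?r ^ l\<close> is charged at every level, also where there are
    no wavelets, which keeps the series geometric.\<close>
  define p where "p l = 4 * q * ((if l = 0 then 2 ^ J0 else 0) + ?r ^ l)" for l :: nat
  have p0: "p l \<ge> 0" for l using q0 r by (auto simp: p_def)
  have tb: "(t i)\<^sup>2 / (4 * pv n i) = T\<^sup>2 / 4 * s" if "t i = T * (sqrt (pv n i) * sqrt s)" "i \<in> valid" "s \<ge> 0" for i s
  proof -
    have "pv n i > 0" using pvar_pos[OF that(2)] by (simp add: pv_def add_nonneg_pos)
    then show ?thesis unfolding that(1) using that(3) by (simp add: power_mult_distrib)
  qed
  have level: "(\<Sum>i\<in>I l. 4 * exp (- ((t i)\<^sup>2 / (4 * pv n i)))) \<le> p l" for l
  proof -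
    consider "l = 0" | "l > 0" "l \<ge> J0" | "l > 0" "l < J0" by linarith
    then show ?thesis
    proof cases
      case 1
      have "(\<Sum>i\<in>I l. 4 * exp (- ((t i)\<^sup>2 / (4 * pv n i)))) = (\<Sum>i\<in>I l. 4 * q)"
      proof (intro sum.cong refl)
        fix i assume i: "i \<in> I l"
        then obtain k where k: "i = Inl k" using 1 by (auto simp: I_def)
        have "(t i)\<^sup>2 / (4 * pv n i) = T\<^sup>2 / 4 * ln (real n)"
          using I(2) i n0 t1 k by (intro tb) auto
        then show "4 * exp (- ((t i)\<^sup>2 / (4 * pv n i))) = 4 * q" by (simp add: q)
      qed
      also have "\<dots> = 2 ^ J0 * (4 * q)" using 1 by (simp add: I_def card_image)
      also have "\<dots> \<le> p l" using 1 q0 by (simp add: p_def)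
      finally show ?thesis .
    next
      case 2
      have "(\<Sum>i\<in>I l. 4 * exp (- ((t i)\<^sup>2 / (4 * pv n i)))) \<le> (\<Sum>i\<in>I l. 4 * (q * exp (- 2 * real l)))"
      proof (intro sum_mono)
        fix i assume i: "i \<in> I l"
        then obtain k where k: "i = Inr (l, k)" using 2 by (auto simp: I_def)
        have "(t i)\<^sup>2 / (4 * pv n i) = T\<^sup>2 / 4 * (real l + ln (real n))"
          using I(2) i n0 t2 k by (intro tb) auto
        moreover have "2 * real l \<le> T\<^sup>2 / 4 * real l"
        proof (rule mult_right_mono)
          have "3\<^sup>2 \<le> T\<^sup>2" using T by (intro power_mono) auto
          then show "2 \<le> T\<^sup>2 / 4" by simp
        qed simp
        ultimately have "- ((t i)\<^sup>2 / (4 * pv n i)) \<le> - (T\<^sup>2 / 4) * ln (real n) + (- 2 * real l)" by (simp add: algebra_simps)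
        then have "exp (- ((t i)\<^sup>2 / (4 * pv n i))) \<le> q * exp (- 2 * real l)"
          unfolding q exp_add[symmetric] by simp
        then show "4 * exp (- ((t i)\<^sup>2 / (4 * pv n i))) \<le> 4 * (q * exp (- 2 * real l))" by simp
      qed
      also have "\<dots> = 2 ^ l * (4 * (q * exp (- 2 * real l)))" using 2 by (simp add: I_def card_image inj_on_def)
      also have "\<dots> = 4 * q * ?r ^ l"
        by (simp add: power_mult_distrib exp_of_nat_mult[symmetric] mult.commute)
      also have "\<dots> = p l" using 2 by (simp add: p_def)
      finally show ?thesis .
    next
      case 3
      then show ?thesis using p0 by (simp add: I_def)
    qed
  qed
  have mble: "(\<lambda>y. emeasure (Q y) X) \<in> borel_measurable ?O" if "X \<in> sets C01" for X
    using measurable_compose[OF Qm measurable_emeasure_subprob_algebra[OF that]]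
    by (simp add: measurable_cong_sets[OF sO(2) refl])
  have Ib: "(\<Union>i\<in>I l. bad f0 n t i) \<in> sets C01" for l
    using I(2)[of l] by (intro sets.finite_UN I bad_sets) blast
  have "(\<integral>\<^sup>+y. emeasure (Q y) (\<Union>i\<in>valid. bad f0 n t i) \<partial>?O) \<le> (\<integral>\<^sup>+y. (\<Sum>l. emeasure (Q y) (\<Union>i\<in>I l. bad f0 n t i)) \<partial>?O)"
    unfolding U using Ib Qs sO by (intro nn_integral_mono emeasure_subadditive_countably) auto
  also have "\<dots> = (\<Sum>l. \<integral>\<^sup>+y. emeasure (Q y) (\<Union>i\<in>I l. bad f0 n t i) \<partial>?O)"
    by (intro nn_integral_suminf mble Ib)
  also have "\<dots> \<le> (\<Sum>l. ennreal (p l))"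
  proof (intro suminf_le summableI)
    fix l
    have "(\<integral>\<^sup>+y. emeasure (Q y) (\<Union>i\<in>I l. bad f0 n t i) \<partial>?O) \<le> (\<integral>\<^sup>+y. (\<Sum>i\<in>I l. emeasure (Q y) (bad f0 n t i)) \<partial>?O)"
    proof (intro nn_integral_mono emeasure_subadditive_finite I)
      fix y assume "y \<in> space ?O"
      then show "bad f0 n t ` I l \<subseteq> sets (Q y)" using Qs[of y] sO I(2)[of l] bad_sets by auto
    qed
    also have "\<dots> = (\<Sum>i\<in>I l. \<integral>\<^sup>+y. emeasure (Q y) (bad f0 n t i) \<partial>?O)"
      using I(2)[of l] by (intro nn_integral_sum mble bad_sets) blast
    also have "\<dots> \<le> (\<Sum>i\<in>I l. ennreal (4 * exp (- ((t i)\<^sup>2 / (4 * pv n i)))))"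
    proof (intro sum_mono bad_bound W Q f0)
      fix i assume "i \<in> I l"
      then show i: "i \<in> valid" using I(2) by blast
      have "pv n i \<ge> 0" using pvar_pos[OF i] by (simp add: pv_def)
      then show "0 \<le> t i" using T n0 by (cases i) (auto simp: t1 t2)
    qed (use n in auto)
    also have "\<dots> = ennreal (\<Sum>i\<in>I l. 4 * exp (- ((t i)\<^sup>2 / (4 * pv n i))))" by (intro sum_ennreal) auto
    also have "\<dots> \<le> ennreal (p l)" by (intro ennreal_leI level)
    finally show "(\<integral>\<^sup>+y. emeasure (Q y) (\<Union>i\<in>I l. bad f0 n t i) \<partial>?O) \<le> ennreal (p l)" .
  qed
  also have "\<dots> \<le> ennreal (4 * (2 ^ J0 + 3) * q)"
  proof -
    have s1: "(\<lambda>l. if l = 0 then 2 ^ J0 else (0::real)) sums 2 ^ J0"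
      using sums_single[of 0 "\<lambda>_. (2::real) ^ J0"] by simp
    have s2: "(\<lambda>l. ?r ^ l) sums (1 / (1 - ?r))" using r by (intro geometric_sums) simp
    have "p sums (4 * q * (2 ^ J0 + 1 / (1 - ?r)))"
      unfolding p_def[abs_def] by (intro sums_mult sums_add s1 s2)
    then have "(\<Sum>l. ennreal (p l)) = ennreal (4 * q * (2 ^ J0 + 1 / (1 - ?r)))"
      by (rule suminf_ennreal_eq[OF p0])
    also have "\<dots> \<le> ennreal (4 * q * (2 ^ J0 + 3))"
    proof (intro ennreal_leI mult_left_mono add_left_mono)
      show "1 / (1 - ?r) \<le> 3" using r by (simp add: divide_le_eq)
    qed (use q0 in auto)
    finally show ?thesis by (simp add: mult_ac)
  qed
  finally show ?thesis by (simp add: q_def)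
qed

text \<open>\<open>ennreal\<close> sends negative reals to 0, so a negative \<open>K\<close> stands
  for norm 0; hence \<open>max K 0\<close>.\<close>

lemma holder_coefficients:
  assumes f0: "f0 \<in> holder_space J0 \<phi> \<psi> \<alpha>" and K: "besov_norm J0 \<phi> \<psi> \<alpha> f0 = ennreal K"
  shows "k < 2 ^ J0 \<Longrightarrow> \<bar>l2_inner f0 (\<phi> k)\<bar> \<le> max K 0"
    and "l \<ge> J0 \<Longrightarrow> k < 2 ^ l \<Longrightarrow> \<bar>l2_inner f0 (\<psi> l k)\<bar> \<le> max K 0 * 2 powr (- (real l * (\<alpha> + 1 / 2)))"
proof -
  have K': "ennreal K = ennreal (max K 0)" by (simp add: max_def ennreal_neg)
  have sum: "(SUP k\<in>{..<2 ^ J0}. ennreal \<bar>l2_inner f0 (\<phi> k)\<bar>) + (SUP l\<in>{J0..}. ennreal (2 powr (real l * (\<alpha> + 1 / 2))) *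
        (SUP k\<in>{..<2 ^ l}. ennreal \<bar>l2_inner f0 (\<psi> l k)\<bar>)) = ennreal (max K 0)"
    using K unfolding besov_norm_def K' .
  show "\<bar>l2_inner f0 (\<phi> k)\<bar> \<le> max K 0" if "k < 2 ^ J0"
  proof -
    have "ennreal \<bar>l2_inner f0 (\<phi> k)\<bar> \<le> (SUP k\<in>{..<2 ^ J0}. ennreal \<bar>l2_inner f0 (\<phi> k)\<bar>)" using that by (intro SUP_upper) simp
    also have "\<dots> \<le> ennreal (max K 0)" unfolding sum[symmetric] by simp
    finally show ?thesis by (rule ennreal_le_iff[THEN iffD1, rotated]) simp
  qed
  show "\<bar>l2_inner f0 (\<psi> l k)\<bar> \<le> max K 0 * 2 powr (- (real l * (\<alpha> + 1 / 2)))" if "l \<ge> J0" "k < 2 ^ l"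
  proof -
    let ?p = "2 powr (real l * (\<alpha> + 1 / 2))"
    have "ennreal (?p * \<bar>l2_inner f0 (\<psi> l k)\<bar>) = ennreal ?p * ennreal \<bar>l2_inner f0 (\<psi> l k)\<bar>" by (simp add: ennreal_mult)
    also have "\<dots> \<le> ennreal ?p * (SUP k\<in>{..<2 ^ l}. ennreal \<bar>l2_inner f0 (\<psi> l k)\<bar>)"
      using that by (intro mult_left_mono SUP_upper) auto
    also have "\<dots> \<le> (SUP l\<in>{J0..}. ennreal (2 powr (real l * (\<alpha> + 1 / 2))) * (SUP k\<in>{..<2 ^ l}. ennreal \<bar>l2_inner f0 (\<psi> l k)\<bar>))"
      using that by (intro SUP_upper2[of l]) auto
    also have "\<dots> \<le> ennreal (max K 0)" unfolding sum[symmetric] by simp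
    finally have "?p * \<bar>l2_inner f0 (\<psi> l k)\<bar> \<le> max K 0" by (rule ennreal_le_iff[THEN iffD1, rotated]) simp
    then show ?thesis by (simp add: powr_minus field_simps)
  qed
qed

text \<open>Purely deterministic: outside the bad events every coefficient is within bias plus
  \<open>2 * t\<close>, and the weighted sum over levels is geometric around the cutoff. The
  constants are chosen before \<open>f0\<close>, \<open>n\<close> and \<open>T\<close>, which gives
  the uniformity of the theorem.\<close>

lemma sup_bound:
  fixes K :: real
  shows "\<exists>c1 c2. 0 \<le> c2 \<and> (\<forall>f0 n T t f. f0 \<in> holder_space J0 \<phi> \<psi> \<alpha> \<longrightarrow> besov_norm J0 \<phi> \<psi> \<alpha> f0 = ennreal K \<longrightarrow> n \<ge> 2 \<longrightarrow> T \<ge> 0 \<longrightarrow>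
    (\<forall>k. t (Inl k) = T * (sqrt (pv n (Inl k)) * sqrt (ln (real n)))) \<longrightarrow>
    (\<forall>l k. t (Inr (l, k)) = T * (sqrt (pv n (Inr (l, k))) * sqrt (real l + ln (real n)))) \<longrightarrow>
    f \<in> space C01 \<longrightarrow> f \<notin> (\<Union>i\<in>valid. bad f0 n t i) \<longrightarrow>
    (\<forall>x\<in>{0..1}. \<bar>f x - f0 x\<bar> \<le> (c1 + c2 * T) * contraction_rate \<alpha> n))"
proof -
  define a where "a = 2 / ((2 * \<alpha> + 1) * ln 2)"
  define b where "b = 2 * (2 * \<alpha> + 1) * ln 2"
  have ab: "a \<ge> 0" "b \<ge> 0" using \<alpha> by (auto simp: a_def b_def)
  define \<beta> where "\<beta> = min (1 / 2) \<alpha>"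
  have \<beta>: "\<beta> > 0" using \<alpha> by (simp add: \<beta>_def)
  define G where "G = 2 / (1 - 2 powr (- \<beta>))"
  have G: "G \<ge> 0" using \<beta> by (auto simp: G_def powr_less_one less_imp_le)
  define K' where "K' = max K 0"
  have K': "K' \<ge> 0" by (simp add: K'_def)
  define A1 where "A1 = sqrt (a + 1) + sqrt (b + 1)"
  have A1: "A1 \<ge> 0" using ab by (simp add: A1_def)
  \<comment> \<open>\<open>c1\<close> collects the bias and is the only constant involving
    \<open>K\<close>; \<open>c2\<close> multiplies the noise level \<open>T\<close>. In each, the
    first summand comes from the scaling functions, the one with \<open>G\<close> from the wavelets,
    and \<open>B\<close> is the overlap constant.\<close>
  define c1 where "c1 = B * (2 * K' + K' * (a + 1) * G)"
  define c2 where "c2 = B * (2 + 2 * A1 * G)"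
  show ?thesis
  proof (rule exI[of _ c1], rule exI[of _ c2], intro conjI allI impI ballI)
    show "0 \<le> c2" using B A1 G by (simp add: c2_def)
    fix f0 f :: "real \<Rightarrow> real" and n T t x
    assume f0: "f0 \<in> holder_space J0 \<phi> \<psi> \<alpha>" "besov_norm J0 \<phi> \<psi> \<alpha> f0 = ennreal K" and n: "(2::nat) \<le> n" and T: "(0::real) \<le> T"
      and t1: "\<forall>k. t (Inl k) = T * (sqrt (pv n (Inl k)) * sqrt (ln (real n)))"
      and t2: "\<forall>l k. t (Inr (l, k)) = T * (sqrt (pv n (Inr (l, k))) * sqrt (real l + ln (real n)))"
      and f: "f \<in> space C01" "f \<notin> (\<Union>i\<in>valid. bad f0 n t i)" and x: "x \<in> {0..1::real}"
    define \<tau> where "\<tau> = log 2 (real n / ln (real n)) / (2 * \<alpha> + 1)"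
    note cut = cutoff[OF \<alpha> n, folded \<tau>_def]
    define \<epsilon> where "\<epsilon> = contraction_rate \<alpha> n"
    have \<epsilon>: "\<epsilon> = 2 powr (- (\<alpha> * \<tau>))" "\<epsilon> > 0" using cut(3) by (simp_all add: \<epsilon>_def)
    have n0: "real n > 0" "ln (real n) \<ge> 0" using n by auto
    have f0c: "continuous_on {0..1} f0" using f0 by (simp add: holder_space_def)
    have fc: "continuous_on {0..1} f" using f by (simp add: C01_continuous)
    let ?h = "\<lambda>x. f x - f0 x"
    have diff: "l2_inner ?h (bas i) = l2_inner f (bas i) - l2_inner f0 (bas i)" if i: "i \<in> valid" for i
    proof -
      have "l2_inner ?h (bas i) = (LINT x:{0..1}|lborel. f x * bas i x - f0 x * bas i x)"
        by (simp add: l2_inner_def left_diff_distrib)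
      also have "\<dots> = l2_inner f (bas i) - l2_inner f0 (bas i)"
        unfolding l2_inner_def by (intro set_integral_diff integrand_continuous_integrable bas_integrand i fc f0c)
      finally show ?thesis .
    qed
    have coef: "\<bar>l2_inner ?h (bas i)\<bar> \<le> 2 * t i + \<bar>l2_inner f0 (bas i)\<bar> / (real n * pvar i + 1)" if i: "i \<in> valid" for i
      using f i unfolding diff[OF i] bad_def by (auto simp: not_less)
    define m where "m l = inverse (real l) * 2 powr (- (real l * (2 * \<alpha> + 1)))" for l :: nat
    define d where "d l = 2 * T * (sqrt (m l / (real n * m l + 1)) * sqrt (real l + ln (real n))) + K' * (2 powr (- (real l * (\<alpha> + 1 / 2))) / (real n * m l + 1))" for l :: nat
    have pm: "pvar (Inr (l, k)) = m l" for l k by (simp add: pvar_def m_def)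
    have "\<bar>?h x\<bar> \<le> B * ((2 * T + 2 * K') * \<epsilon> + (2 * T * A1 + K' * (a + 1)) * (\<epsilon> * G))"
    proof (rule sup_le_coefficients[where h="?h" and d=d and x=x])
      show "continuous_on {0..1} ?h" by (intro continuous_intros fc f0c)
      show "\<bar>l2_inner ?h (\<phi> k)\<bar> \<le> (2 * T + 2 * K') * \<epsilon>" if k: "k < 2 ^ J0" for k
      proof -
        have v: "Inl k \<in> valid" using k by (simp add: valid_iff)
        have "\<bar>l2_inner ?h (\<phi> k)\<bar> \<le> 2 * t (Inl k) + \<bar>l2_inner f0 (\<phi> k)\<bar> / (real n + 1)"
          using coef[OF v] by (simp add: l2_inner_bas pvar_def)
        \<comment> \<open>The finitely many scaling coefficients are estimated at almost parametric
          rate: \<open>sqrt (ln n / n)\<close> is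
          \<open>2 powr (- ((2 * \<alpha> + 1) * \<tau> / 2))\<close>, smaller than
          \<open>\<epsilon>\<close> because
          \<open>(2 * \<alpha> + 1) / 2 > \<alpha>\<close>.\<close>
        also have "t (Inl k) \<le> T * \<epsilon>"
        proof -
          have "sqrt (pv n (Inl k)) * sqrt (ln (real n)) = sqrt (ln (real n) / (real n + 1))"
            by (simp add: pv_def pvar_def real_sqrt_mult[symmetric])
          also have "\<dots> \<le> sqrt (ln (real n) / real n)" using n0 by (intro real_sqrt_le_mono divide_left_mono) auto
          also have "\<dots> = sqrt ((2 powr (- ((2 * \<alpha> + 1) * \<tau>) / 2))\<^sup>2)"
          proof -
            have "- ((2 * \<alpha> + 1) * \<tau>) / 2 + - ((2 * \<alpha> + 1) * \<tau>) / 2 = - ((2 * \<alpha> + 1) * \<tau>)" by simp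
            then show ?thesis unfolding cut(2) power2_eq_square powr_add[symmetric] by (simp only:)
          qed
          also have "\<dots> = 2 powr (- ((2 * \<alpha> + 1) * \<tau>) / 2)" by simp
          also have "\<dots> \<le> \<epsilon>" unfolding \<epsilon>(1) using cut(1) by (intro powr_mono) (auto simp: algebra_simps)
          finally show ?thesis using t1 T by (simp add: mult_left_mono)
        qed
        also have "\<bar>l2_inner f0 (\<phi> k)\<bar> / (real n + 1) \<le> K' * (2 * \<epsilon>)"
        proof -
          have "\<bar>l2_inner f0 (\<phi> k)\<bar> / (real n + 1) \<le> K' / real n"
            using holder_coefficients(1)[OF f0 k] n0 K' unfolding K'_def by (intro frac_le) auto
          also have "\<dots> = K' * (1 / real n)" by simp
          also have "\<dots> \<le> K' * (2 * (ln (real n) / real n))" by (intro mult_left_mono cut(6) K')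
          also have "\<dots> \<le> K' * (2 * \<epsilon>)"
          proof (intro mult_left_mono K')
            have "0 \<le> \<alpha> * \<tau>" using \<alpha> cut(1) by simp
            then show "ln (real n) / real n \<le> \<epsilon>" unfolding cut(2) \<epsilon>(1) using cut(1)
              by (intro powr_mono) (auto simp: algebra_simps)
          qed simp
          finally show ?thesis .
        qed
        finally show ?thesis by (simp add: algebra_simps)
      qed
      show "\<bar>l2_inner ?h (\<psi> l k)\<bar> \<le> d l" if lk: "l \<ge> J0" "k < 2 ^ l" for l k
      proof -
        have v: "Inr (l, k) \<in> valid" using lk by (simp add: valid_iff)
        have "m l \<ge> 0" by (simp add: m_def)
        have "\<bar>l2_inner ?h (\<psi> l k)\<bar> \<le> 2 * t (Inr (l, k)) + \<bar>l2_inner f0 (\<psi> l k)\<bar> / (real n * m l + 1)"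
          using coef[OF v] by (simp add: l2_inner_bas pm)
        also have "\<bar>l2_inner f0 (\<psi> l k)\<bar> / (real n * m l + 1) \<le> K' * 2 powr (- (real l * (\<alpha> + 1 / 2))) / (real n * m l + 1)"
          using holder_coefficients(2)[OF f0 lk] \<open>m l \<ge> 0\<close> unfolding K'_def by (intro divide_right_mono) auto
        finally show ?thesis using t2 by (simp add: d_def pv_def pm)
      qed
      show "(\<Sum>l = J0..L. sqrt (2 ^ l) * d l) \<le> (2 * T * A1 + K' * (a + 1)) * (\<epsilon> * G)" for L
      proof -
        have le: "sqrt (2 ^ l) * d l \<le> (2 * T * A1 + K' * (a + 1)) * (\<epsilon> * 2 powr (- \<beta> * \<bar>real l - \<tau>\<bar>))" if l: "l \<in> {J0..L}" for l
        proof -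
          have l1: "l \<ge> 1" using l J0 by simp
          note lb = level_noise_bound[OF \<alpha> n l1 cut(1,2) cut(4,5)[folded a_def b_def] ab, folded m_def \<beta>_def A1_def \<epsilon>(1)]
          have "sqrt (2 ^ l) * d l = 2 * T * (sqrt (2 ^ l) * (sqrt (m l / (real n * m l + 1)) * sqrt (real l + ln (real n))))
             + K' * (sqrt (2 ^ l) * (2 powr (- (real l * (\<alpha> + 1 / 2))) / (real n * m l + 1)))"
            by (simp add: d_def algebra_simps)
          also have "\<dots> \<le> 2 * T * (A1 * (\<epsilon> * 2 powr (- \<beta> * \<bar>real l - \<tau>\<bar>))) + K' * ((a + 1) * (\<epsilon> * 2 powr (- \<beta> * \<bar>real l - \<tau>\<bar>)))"
            using T K' by (intro add_mono mult_left_mono lb) auto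
          finally show ?thesis by (simp add: algebra_simps)
        qed
        have "(\<Sum>l = J0..L. sqrt (2 ^ l) * d l) \<le> (\<Sum>l = J0..L. (2 * T * A1 + K' * (a + 1)) * (\<epsilon> * 2 powr (- \<beta> * \<bar>real l - \<tau>\<bar>)))"
          by (intro sum_mono le)
        also have "\<dots> = (2 * T * A1 + K' * (a + 1)) * (\<epsilon> * (\<Sum>l = J0..L. 2 powr (- \<beta> * \<bar>real l - \<tau>\<bar>)))"
          by (simp only: sum_distrib_left)
        also have "\<dots> \<le> (2 * T * A1 + K' * (a + 1)) * (\<epsilon> * G)"
          using two_sided_geometric[OF \<beta> cut(1)] T A1 K' ab \<epsilon>(2) unfolding G_def by (intro mult_left_mono) auto
        finally show ?thesis .
      qed
    qed (rule x)
    also have "\<dots> = (c1 + c2 * T) * \<epsilon>" by (simp add: c1_def c2_def algebra_simps)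
    finally show "\<bar>f x - f0 x\<bar> \<le> (c1 + c2 * T) * contraction_rate \<alpha> n" by (simp add: \<epsilon>_def)
  qed
qed

end

text \<open>\<open>K\<close> is quantified before \<open>C\<close> and \<open>M0\<close>, and
  \<open>f0\<close> after them: so the constants depend on \<open>f0\<close> through its norm alone.
  The sup-norm bound outside the bad events is scaled to the radius \<open>M\<close>, and the union
  bound supplies the probability.\<close>

theorem theorem1:
  fixes \<alpha> :: real and S J0 :: nat
    and \<phi> :: "nat \<Rightarrow> real \<Rightarrow> real" and \<psi> :: "nat \<Rightarrow> nat \<Rightarrow> real \<Rightarrow> real"
  assumes "0 < \<alpha>" and "\<alpha> < real S"
    and "cdv_basis S J0 \<phi> \<psi>"
  shows "\<forall>K::real. \<exists>C M0 :: real. 0 < C \<and>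
    (\<forall>f0. f0 \<in> holder_space J0 \<phi> \<psi> \<alpha> \<and> besov_norm J0 \<phi> \<psi> \<alpha> f0 = ennreal K \<longrightarrow>
      (\<forall>(M :: real) (r :: ereal) (n :: nat) W Q.
        M0 \<le> M \<and> 1 \<le> r \<and> 1 \<le> n \<and>
        wiener_measure W \<and> posterior W (prior J0 \<phi> \<psi> \<alpha>) n Q \<longrightarrow>
        (\<integral>\<^sup>+ y. emeasure (Q y)
            {f \<in> space C01. Lr_norm r (\<lambda>x. f x - f0 x) > M * contraction_rate \<alpha> n}
          \<partial>observation_law W n f0)
        \<le> ennreal (real n powr (- (C\<^sup>2 * (M - M0)\<^sup>2)))))"
proof
  fix K :: real
  have "S \<ge> 1" using assms by (cases S) auto
  then obtain B where "wavelet_basis J0 \<phi> \<psi> B" using cdv_wavelet_basis[OF assms(3)] by blast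
  then interpret wavelet_prior J0 \<phi> \<psi> B \<alpha>
    using assms(1) by (simp add: wavelet_prior_def wavelet_prior_axioms_def)
  obtain c1 c2 where c2: "0 \<le> c2" and sup: "\<And>f0 n T t f x. \<lbrakk>f0 \<in> holder_space J0 \<phi> \<psi> \<alpha>; besov_norm J0 \<phi> \<psi> \<alpha> f0 = ennreal K; n \<ge> 2; T \<ge> 0;
    \<forall>k. t (Inl k) = T * (sqrt (pv n (Inl k)) * sqrt (ln (real n)));
    \<forall>l k. t (Inr (l, k)) = T * (sqrt (pv n (Inr (l, k))) * sqrt (real l + ln (real n)));
    f \<in> space C01; f \<notin> (\<Union>i\<in>valid. bad f0 n t i); x \<in> {0..1}\<rbrakk>
    \<Longrightarrow> \<bar>f x - f0 x\<bar> \<le> (c1 + c2 * T) * contraction_rate \<alpha> n"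
    using sup_bound[of K] by metis
  \<comment> \<open>The summand 1 makes \<open>\<gamma>\<close> positive even if \<open>c2\<close>
    is 0.\<close>
  define \<gamma> where "\<gamma> = c2 + 1"
  have \<gamma>: "\<gamma> > 0" using c2 by (simp add: \<gamma>_def)
  \<comment> \<open>Chosen so that \<open>T = (M - c1) / \<gamma>\<close> gives
    \<open>T\<^sup>2 / 4 = C\<^sup>2 * (M - c1)\<^sup>2\<close>.\<close>
  define C where "C = 1 / (2 * \<gamma>)"
  have C: "C > 0" using \<gamma> by (simp add: C_def)
  define A where "A = 4 * (2 ^ J0 + 3 :: real)"
  have A: "A \<ge> 1" by (simp add: A_def)
  \<comment> \<open>the shift \<open>d\<close> in \<open>M0\<close> absorbs the constant factor \<open>A\<close> of the union bound\<close>
  define d where "d = max (3 * \<gamma>) (sqrt (log 2 A) / C)"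
  have d: "3 * \<gamma> \<le> d" "0 \<le> d" "A \<le> 2 powr (C\<^sup>2 * d\<^sup>2)"
  proof -
    show "3 * \<gamma> \<le> d" by (simp add: d_def)
    then show "0 \<le> d" using \<gamma> by simp
    have lA: "0 \<le> log 2 A" using A by simp
    have "sqrt (log 2 A) / C \<le> d" by (simp add: d_def)
    then have "sqrt (log 2 A) \<le> d * C" using C by (simp only: pos_divide_le_eq)
    then have "sqrt (log 2 A) \<le> C * d" by (simp only: mult.commute)
    then have "(sqrt (log 2 A))\<^sup>2 \<le> (C * d)\<^sup>2" using lA by (intro power_mono) auto
    then have "log 2 A \<le> C\<^sup>2 * d\<^sup>2" using lA by (simp add: power_mult_distrib)
    then have "2 powr (log 2 A) \<le> 2 powr (C\<^sup>2 * d\<^sup>2)" by (intro powr_mono) auto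
    then show "A \<le> 2 powr (C\<^sup>2 * d\<^sup>2)" using A by simp
  qed
  define M0 where "M0 = c1 + d"
  show "\<exists>C M0 :: real. 0 < C \<and>
    (\<forall>f0. f0 \<in> holder_space J0 \<phi> \<psi> \<alpha> \<and> besov_norm J0 \<phi> \<psi> \<alpha> f0 = ennreal K \<longrightarrow>
      (\<forall>(M :: real) (r :: ereal) (n :: nat) W Q.
        M0 \<le> M \<and> 1 \<le> r \<and> 1 \<le> n \<and>
        wiener_measure W \<and> posterior W (prior J0 \<phi> \<psi> \<alpha>) n Q \<longrightarrow>
        (\<integral>\<^sup>+ y. emeasure (Q y)
            {f \<in> space C01. Lr_norm r (\<lambda>x. f x - f0 x) > M * contraction_rate \<alpha> n}
          \<partial>observation_law W n f0)
        \<le> ennreal (real n powr (- (C\<^sup>2 * (M - M0)\<^sup>2)))))"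
  proof (rule exI[of _ C], rule exI[of _ M0], intro conjI C allI impI)
    fix f0 and M :: real and r :: ereal and n :: nat and W Q
    assume "f0 \<in> holder_space J0 \<phi> \<psi> \<alpha> \<and> besov_norm J0 \<phi> \<psi> \<alpha> f0 = ennreal K"
      and "M0 \<le> M \<and> 1 \<le> r \<and> 1 \<le> n \<and> wiener_measure W \<and> posterior W (prior J0 \<phi> \<psi> \<alpha>) n Q"
    then have f0: "f0 \<in> holder_space J0 \<phi> \<psi> \<alpha>" "besov_norm J0 \<phi> \<psi> \<alpha> f0 = ennreal K"
      and M: "M0 \<le> M" and r: "1 \<le> r" and n: "1 \<le> n" and W: "wiener_measure W" and Q: "posterior W (prior J0 \<phi> \<psi> \<alpha>) n Q"
      by auto
    have f0c: "continuous_on {0..1} f0" using f0 by (simp add: holder_space_def)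
    let ?O = "observation_law W n f0"
    let ?X = "{f \<in> space C01. Lr_norm r (\<lambda>x. f x - f0 x) > M * contraction_rate \<alpha> n}"
    interpret O: prob_space ?O by (rule observation_law_prob[OF W f0c])
    have sO: "space ?O = space C01" by (simp add: observation_law_def)
    have Qm: "Q \<in> measurable C01 (prob_algebra C01)" using Q by (simp add: posterior_def)
    have Qp: "prob_space (Q y)" "sets (Q y) = sets C01" if "y \<in> space C01" for y
      using measurable_space[OF Qm that] by (auto simp: space_prob_algebra)
    show "(\<integral>\<^sup>+ y. emeasure (Q y) ?X \<partial>?O) \<le> ennreal (real n powr (- (C\<^sup>2 * (M - M0)\<^sup>2)))"
    proof (cases "n = 1")
      \<comment> \<open>For \<open>n = 1\<close> the right-hand side is 1, so the trivial bound on
        probabilities suffices.\<close>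
      case True
      have "(\<integral>\<^sup>+ y. emeasure (Q y) ?X \<partial>?O) \<le> (\<integral>\<^sup>+ y. 1 \<partial>?O)"
        using Qp sO by (intro nn_integral_mono prob_space.emeasure_le_1) auto
      also have "\<dots> = 1" by (simp add: O.emeasure_space_1)
      finally show ?thesis using True by simp
    next
      case False
      then have n2: "n \<ge> 2" using n by simp
      \<comment> \<open>With this noise level the radius \<open>c1 + c2 * T\<close> stays below
        \<open>M\<close>; the part \<open>3 * \<gamma> \<le> d\<close> of the shift ensures
        \<open>T \<ge> 3\<close>, as the union bound requires.\<close>
      define T where "T = (M - c1) / \<gamma>"
      have "3 * \<gamma> \<le> M - c1" using M d by (simp add: M0_def)
      then have T: "T \<ge> 3" using \<gamma> by (simp add: T_def le_divide_eq)
      define t where "t i = T * (sqrt (pv n i) * sqrt (case i of Inl k \<Rightarrow> ln (real n) | Inr (l, k) \<Rightarrow> real l + ln (real n)))" for i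
      have rate: "contraction_rate \<alpha> n \<ge> 0" by (simp add: contraction_rate_def)
      have Ub: "(\<Union>i\<in>valid. bad f0 n t i) \<in> sets C01" using bad_sets by (intro sets.countable_UN') auto
      have sub: "?X \<subseteq> (\<Union>i\<in>valid. bad f0 n t i)"
      proof (rule ccontr)
        assume "\<not> ?thesis"
        then obtain f where f: "f \<in> space C01" "Lr_norm r (\<lambda>x. f x - f0 x) > M * contraction_rate \<alpha> n" "f \<notin> (\<Union>i\<in>valid. bad f0 n t i)" by blast
        have "\<bar>f x - f0 x\<bar> \<le> M * contraction_rate \<alpha> n" if x: "x \<in> {0..1}" for x
        proof -
          have "\<bar>f x - f0 x\<bar> \<le> (c1 + c2 * T) * contraction_rate \<alpha> n"
            using T by (intro sup[OF f0 n2 _ _ _ f(1,3) x]) (auto simp: t_def)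
          also have "\<dots> \<le> M * contraction_rate \<alpha> n"
          proof (rule mult_right_mono[OF _ rate])
            have "c1 + c2 * T \<le> c1 + \<gamma> * T" using T by (simp add: \<gamma>_def)
            also have "\<dots> = M" using \<gamma> by (simp add: T_def)
            finally show "c1 + c2 * T \<le> M" .
          qed
          finally show ?thesis .
        qed
        from Lr_norm_le[where h="\<lambda>x. f x - f0 x", OF r this] f(2) show False by simp
      qed
      have "(\<integral>\<^sup>+ y. emeasure (Q y) ?X \<partial>?O) \<le> (\<integral>\<^sup>+ y. emeasure (Q y) (\<Union>i\<in>valid. bad f0 n t i) \<partial>?O)"
        using Qp sO Ub by (intro nn_integral_mono emeasure_mono[OF sub]) simp
      also have "\<dots> \<le> ennreal (4 * (2 ^ J0 + 3) * real n powr (- (T\<^sup>2 / 4)))"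
        by (rule union_bound[OF W n2 Q f0c T]) (simp_all add: t_def)
      also have "\<dots> \<le> ennreal (real n powr (- (C\<^sup>2 * (M - M0)\<^sup>2)))"
      proof (rule ennreal_leI)
        have TC: "T\<^sup>2 / 4 = C\<^sup>2 * (M - c1)\<^sup>2" by (simp add: T_def C_def power_divide power_mult_distrib)
        \<comment> \<open>Separates a factor \<open>n powr (- (C\<^sup>2 * d\<^sup>2))\<close> from
          the bound; since \<open>n \<ge> 2\<close> and
          \<open>A \<le> 2 powr (C\<^sup>2 * d\<^sup>2)\<close>, it outweighs the prefactor
          \<open>A\<close>.\<close>
        have "(M - M0)\<^sup>2 + d\<^sup>2 \<le> ((M - M0) + d)\<^sup>2" using M d(2) by (simp add: power2_sum)
        also have "(M - M0) + d = M - c1" by (simp add: M0_def)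
        finally have "C\<^sup>2 * ((M - M0)\<^sup>2 + d\<^sup>2) \<le> C\<^sup>2 * (M - c1)\<^sup>2" by (intro mult_left_mono) auto
        then have le: "- (T\<^sup>2 / 4) \<le> - (C\<^sup>2 * (M - M0)\<^sup>2) + - (C\<^sup>2 * d\<^sup>2)" unfolding TC by (simp add: distrib_left)
        have "A \<le> 2 powr (C\<^sup>2 * d\<^sup>2)" by (rule d(3))
        also have "\<dots> \<le> real n powr (C\<^sup>2 * d\<^sup>2)" using n2 by (intro powr_mono2) auto
        finally have An: "A * real n powr (- (C\<^sup>2 * d\<^sup>2)) \<le> 1" using n2 by (simp add: powr_minus field_simps)
        have "A * real n powr (- (T\<^sup>2 / 4)) \<le> A * real n powr (- (C\<^sup>2 * (M - M0)\<^sup>2) + - (C\<^sup>2 * d\<^sup>2))"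
          using n2 A le by (intro mult_left_mono powr_mono) auto
        also have "\<dots> = real n powr (- (C\<^sup>2 * (M - M0)\<^sup>2)) * (A * real n powr (- (C\<^sup>2 * d\<^sup>2)))"
          unfolding powr_add by simp
        also have "\<dots> \<le> real n powr (- (C\<^sup>2 * (M - M0)\<^sup>2)) * 1" by (intro mult_left_mono An) auto
        finally show "4 * (2 ^ J0 + 3) * real n powr (- (T\<^sup>2 / 4)) \<le> real n powr (- (C\<^sup>2 * (M - M0)\<^sup>2))"
          by (simp add: A_def)
      qed
      finally show ?thesis .
    qed
  qed
qed

end
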